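(* Let $\mu,\mu_1,\mu_2,\ldots$ be Borel measures on $S$ such that $\mu\in\mathcal S_{00}$, $\mu_n\in\mathcal S_{00}$ for all $n\ge 1$, and $$\lim_{n\to\infty}\|R_1\mu_n-R_1\mu\|_{L^\infty(S,\mu_n+\mu)}=0 .$$ Let $A_n=(A_n(t))_{t\ge0}$ and $A=(A(t))_{t\ge0}$ be the PCAFs of $X$ associated with $\mu_n$ and $\mu$, respectively, by the Revuz correspondence. Then, for any $T>0$, $$\lim_{n\to\infty}\ \sup_{x\in S}E_x\Big[\sup_{0\le t\le T}|A_n(t)-A(t)|^2\Big]=0 .$$
   Context: Setting. $S$ is a locally compact separable metrizable space; $S_\Delta=S\cup\{\Delta\}$ is its one-point compactification ($\Delta$ isolated if $S$ is compact). Functions $f$ on $S$ are extended by $f(\Delta)=0$; $\inf\emptyset=\infty$. $X=(\Omega,\mathscr M,(X_t)_{t\in[0,\infty]},(P_x)_{x\in S_\Delta},(\theta_t)_{t\in[0,\infty]})$ is a standard process on $S$ (a normal, right-continuous strong Markov process with cemetery $\Delta$, having left limits and quasi-left-continuous on $[0,\zeta)$, where $\zeta=\inf\{t: X_t=\Delta\}$ is the lifetime; $X_\infty=\Delta$; $\theta_t$ are shift operators, $X_s\circ\theta_t=X_{s+t}$). $(\mathscr F_t)_{t\in[0,\infty]}$ is the minimum augmented admissible filtration. Standing assumption (duality and absolute continuity): there exist another standard process $\hat X$ on $S$ with laws $\hat P_x$, a $\sigma$-finite Borel measure $m$ on $S$ and a Borel measurable function $p:(0,\infty)\times S\times S\to[0,\infty]$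 such that for all $s,t>0$, $x,y\in S$: $P_x(X_t\in dy)=p_t(x,y)\,m(dy)$; $\hat P_y(\hat X_t\in dx)=p_t(x,y)\,m(dx)$; $p_{t+s}(x,y)=\int_S p_t(x,z)p_s(z,y)\,m(dz)$. Notation. For $\alpha\ge0$: $r_\alpha(x,y)=\int_0^\infty e^{-\alpha t}p_t(x,y)\,dt$ and, for a Borel measure $\mu$, $R_\alpha\mu(x)=\int_S r_\alpha(x,y)\,\mu(dy)$ (the $\alpha$-potential). $\mu^E(dx)=1_E(x)\mu(dx)$. $\|f\|_\infty=\sup_{x\in S}|f(x)|$; $\|f\|_{L^\infty(S,\nu)}=\inf\{C>0:|f|\le C\ \nu\text{-a.e.}\}$. For Borel $E\subseteq S$: $\sigma_E=\inf\{t\in(0,\infty):X_t\in E\}$, $\tau_E=\inf\{t\in[0,\infty):X_t\notin E\}$. A set is thin if it is contained in a nearly Borel set $B$ with $P_x(\sigma_B=0)=0$ for all $x$; a set is semipolar if it is contained in a countable union of thin sets. $\mathcal S_{00}$: finite Borel measures $\mu$ on $S$ charging no semipolar set with $\|R_1\mu\|_\infty<\infty$. A Borel measure $\mu$ is smooth ($\mu\in\mathcal S_1$) if it charges no semipolar set and there is an increasing sequence of Borel sets $E_n$ with $\bigcup_nE_n=S$, $\mu(E_n)<\infty$, $\|R_1\mu^{E_n}\|_\infty<\infty$ for all $n$, and $P_x(\lim_n\tau_{E_n}\ge\zeta)=1$ for all $x\in S$. One has $\mathcal S_{00}\subseteq\mathcal S_1$. PCAF: an $(\mathscr F_t)$-adapted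 non-negative process $A=(A_t)_{t\ge0}$ for which there is $\Lambda\in\mathscr F_\infty$ (a defining set) with $P_x(\Lambda)=1$ for all $x\in S$, $\theta_t(\Lambda)\subseteq\Lambda$ for all $t\ge0$, and for every $\omega\in\Lambda$: $A_0(\omega)=0$, $t\mapsto A_t(\omega)\in[0,\infty]$ is continuous on $[0,\infty)$, $A_t(\omega)<\infty$ for $t<\zeta(\omega)$, $A_t(\omega)=A_{\zeta(\omega)}(\omega)$ for $t\ge\zeta(\omega)$, and $A_{t+s}(\omega)=A_t(\omega)+A_s(\theta_t\omega)$ for all $s,t\ge0$. Two PCAFs are equivalent if they coincide for all $t$ on a common defining set. Revuz correspondence (known): equivalence classes of PCAFs $A$ and smooth measures $\mu$ are in one-to-one correspondence, characterized by $E_x[\int_0^\infty e^{-\alpha t}f(X_t)\,dA_t]=\int_S r_\alpha(x,y)f(y)\,\mu(dy)$ for all $\alpha>0$, $x\in S$ and non-negative Borel $f$. *)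

theory Defs
  imports "HOL-Probability.Probability"
begin

section \<open>The state space with cemetery\<close>

text \<open>
  The one-point compactification of \<open>S\<close> is carried by the option type: \<open>Some x\<close> is the point
  \<open>x\<close> of \<open>S\<close> and \<open>None\<close> is the cemetery. If \<open>S\<close> is compact, then \<open>{None}\<close> is open in
  the Alexandroff topology, so the cemetery is isolated.
\<close>

abbreviation cemetery_top :: "'s::topological_space option topology" where
  "cemetery_top \<equiv> Alexandroff_compactification euclidean"

definition cemetery_borel :: "'s::topological_space option measure" where
  "cemetery_borel = sigma UNIV {U. openin cemetery_top U}"

definition cemetery_ext :: "('s \<Rightarrow> ennreal) \<Rightarrow> 's option \<Rightarrow> ennreal" where
  "cemetery_ext f z = (case z of None \<Rightarrow> 0 | Some y \<Rightarrow> f y)"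


section \<open>Notions attached to a process\<close>

text \<open>
  A process is given by a measurable space \<open>M\<close> (only \<^term>\<open>space M\<close> and \<^term>\<open>sets M\<close> matter),
  coordinates \<open>X t\<close> for \<open>t\<close> in \<open>[0, \<infinity>]\<close> (type \<^typ>\<open>ennreal\<close>), laws \<open>P z\<close> on \<open>M\<close> for \<open>z\<close> in the
  compactified state space, and shifts \<open>\<theta> t\<close>.
\<close>

definition lifetime :: "(ennreal \<Rightarrow> 'w \<Rightarrow> 's option) \<Rightarrow> 'w \<Rightarrow> ennreal" where
  "lifetime X \<omega> = Inf {t. X t \<omega> = None}"

definition hitting_time :: "(ennreal \<Rightarrow> 'w \<Rightarrow> 's option) \<Rightarrow> 's set \<Rightarrow> 'w \<Rightarrow> ennreal" where
  "hitting_time X E \<omega> = Inf {t. 0 < t \<and> t < \<infinity> \<and> X t \<omega> \<in> Some ` E}"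

definition raw_filtration ::
  "'w measure \<Rightarrow> (ennreal \<Rightarrow> 'w \<Rightarrow> 's::topological_space option) \<Rightarrow> ennreal \<Rightarrow> 'w measure" where
  "raw_filtration M X t =
     sigma (space M) {X s -` B \<inter> space M | s B. s \<le> t \<and> B \<in> sets cemetery_borel}"

text \<open>
  Null sets of the law with initial distribution \<open>\<nu>\<close>, which gives an event \<open>N\<close> of the raw
  sigma-algebra at infinity the mass \<open>\<integral> P z N \<nu>(dz)\<close>; subsets of such events count as null.
\<close>

definition init_null ::
  "'w measure \<Rightarrow> (ennreal \<Rightarrow> 'w \<Rightarrow> 's::topological_space option) \<Rightarrow> ('s option \<Rightarrow> 'w measure)
    \<Rightarrow> 's option measure \<Rightarrow> 'w set \<Rightarrow> bool" where
  "init_null M X P \<nu> N \<longleftrightarrow>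
     (\<exists>N'\<in>sets (raw_filtration M X \<infinity>). N \<subseteq> N' \<and> (\<integral>\<^sup>+z. emeasure (P z) N' \<partial>\<nu>) = 0)"

definition initial_laws :: "'s::topological_space option measure set" where
  "initial_laws = {\<nu>. prob_space \<nu> \<and> sets \<nu> = sets cemetery_borel}"

text \<open>
  The minimum augmented admissible filtration: for every initial distribution \<open>\<nu>\<close> the raw
  sigma-algebra at time \<open>t\<close> is augmented by the null sets, and the results are intersected over
  all \<open>\<nu>\<close>.
\<close>

definition augmented_filtration ::
  "'w measure \<Rightarrow> (ennreal \<Rightarrow> 'w \<Rightarrow> 's::topological_space option) \<Rightarrow> ('s option \<Rightarrow> 'w measure)
    \<Rightarrow> ennreal \<Rightarrow> 'w measure" where
  "augmented_filtration M X P t =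
     sigma (space M) {A. A \<subseteq> space M \<and> (\<forall>\<nu>\<in>initial_laws. \<exists>B\<in>sets (raw_filtration M X t).
       init_null M X P \<nu> ((A - B) \<union> (B - A)))}"

lemma space_raw_filtration [simp]: "space (raw_filtration M X t) = space M"
  unfolding raw_filtration_def by (rule space_measure_of) auto

lemma sets_raw_filtration_mono:
  assumes "s \<le> t"
  shows "sets (raw_filtration M X s) \<subseteq> sets (raw_filtration M X t)"
proof -
  have "sigma_sets (space M) {X r -` B \<inter> space M | r B. r \<le> s \<and> B \<in> sets cemetery_borel}
      \<subseteq> sigma_sets (space M) {X r -` B \<inter> space M | r B. r \<le> t \<and> B \<in> sets cemetery_borel}"
    using assms by (intro sigma_sets_mono') (auto intro: order_trans)
  then show ?thesis
    unfolding raw_filtration_def by (subst (1 2) sets_measure_of) auto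
qed

lemma filtration_augmented_filtration: "filtration (space M) (augmented_filtration M X P)"
proof
  show "space (augmented_filtration M X P t) = space M" for t
    unfolding augmented_filtration_def by (rule space_measure_of) auto
next
  fix s t :: ennreal assume st: "s \<le> t"
  show "sets (augmented_filtration M X P s) \<subseteq> sets (augmented_filtration M X P t)"
    unfolding augmented_filtration_def
  proof (subst (1 2) sets_measure_of, blast, blast, rule sigma_sets_mono', safe)
    fix A x and \<nu> :: "'b option measure"
    assume "\<nu> \<in> initial_laws"
      and "\<forall>\<nu>\<in>initial_laws. \<exists>B\<in>sets (raw_filtration M X s). init_null M X P \<nu> (A - B \<union> (B - A))"
    then show "\<exists>B\<in>sets (raw_filtration M X t). init_null M X P \<nu> (A - B \<union> (B - A))"
      using sets_raw_filtration_mono[OF st, of M X] by blast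
  qed
qed

definition nearly_Borel ::
  "'w measure \<Rightarrow> (ennreal \<Rightarrow> 'w \<Rightarrow> 's::topological_space option) \<Rightarrow> ('s option \<Rightarrow> 'w measure)
    \<Rightarrow> 's set \<Rightarrow> bool" where
  "nearly_Borel M X P B \<longleftrightarrow>
     (\<forall>\<nu>\<in>initial_laws. \<exists>B1\<in>sets borel. \<exists>B2\<in>sets borel. B1 \<subseteq> B \<and> B \<subseteq> B2 \<and>
       init_null M X P \<nu> {\<omega>\<in>space M. \<exists>t<\<infinity>. X t \<omega> \<in> Some ` (B2 - B1)})"

definition thin ::
  "'w measure \<Rightarrow> (ennreal \<Rightarrow> 'w \<Rightarrow> 's::topological_space option) \<Rightarrow> ('s option \<Rightarrow> 'w measure)
    \<Rightarrow> 's set \<Rightarrow> bool" where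
  "thin M X P N \<longleftrightarrow>
     (\<exists>B. N \<subseteq> B \<and> nearly_Borel M X P B \<and> (\<forall>x. AE \<omega> in P (Some x). hitting_time X B \<omega> \<noteq> 0))"

definition semipolar ::
  "'w measure \<Rightarrow> (ennreal \<Rightarrow> 'w \<Rightarrow> 's::topological_space option) \<Rightarrow> ('s option \<Rightarrow> 'w measure)
    \<Rightarrow> 's set \<Rightarrow> bool" where
  "semipolar M X P N \<longleftrightarrow> (\<exists>B :: nat \<Rightarrow> 's set. (\<forall>k. thin M X P (B k)) \<and> N \<subseteq> (\<Union>k. B k))"


section \<open>Standard processes\<close>

text \<open>
  Events of the augmented filtration need not lie in \<open>M\<close>, but they are measurable for the
  completion of each \<open>P z\<close>; hence probabilities and expectations of such events are taken under
  \<^const>\<open>completion\<close>. The Markov property is the strong Markov property at constant times.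
  On \<open>[0, \<zeta>)\<close> the left limits are only asked for in the compactified space; that they lie in \<open>S\<close>
  follows from quasi-left-continuity.
\<close>

locale standard_process =
  fixes M :: "'w measure"
    and X :: "ennreal \<Rightarrow> 'w \<Rightarrow> 's::{metric_space, second_countable_topology} option"
    and P :: "'s option \<Rightarrow> 'w measure"
    and \<theta> :: "ennreal \<Rightarrow> 'w \<Rightarrow> 'w"
  assumes prob_P: "prob_space (P z)"
    and sets_P: "sets (P z) = sets M"
    and measurable_X: "X t \<in> M \<rightarrow>\<^sub>M cemetery_borel"
    and measurable_P: "E \<in> sets cemetery_borel \<Longrightarrow>
      (\<lambda>z. emeasure (P z) {\<omega>\<in>space M. X t \<omega> \<in> E}) \<in> borel_measurable cemetery_borel"
    and normal: "AE \<omega> in P z. X 0 \<omega> = z"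
    and X_infinity: "\<omega> \<in> space M \<Longrightarrow> X \<infinity> \<omega> = None"
    and absorbing: "\<lbrakk>\<omega> \<in> space M; X s \<omega> = None; s \<le> t\<rbrakk> \<Longrightarrow> X t \<omega> = None"
    and shift_space: "\<omega> \<in> space M \<Longrightarrow> \<theta> t \<omega> \<in> space M"
    and shift: "\<omega> \<in> space M \<Longrightarrow> X s (\<theta> t \<omega>) = X (s + t) \<omega>"
    and right_continuous: "\<lbrakk>\<omega> \<in> space M; t < \<infinity>\<rbrakk> \<Longrightarrow>
      limitin cemetery_top (\<lambda>s. X s \<omega>) (X t \<omega>) (at_right t)"
    and left_limits: "AE \<omega> in P z. \<forall>t. 0 < t \<and> t < lifetime X \<omega> \<longrightarrow>
      (\<exists>l. limitin cemetery_top (\<lambda>s. X s \<omega>) l (at_left t))"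
    and filtration_right_continuous: "t < \<infinity> \<Longrightarrow>
      sets (augmented_filtration M X P t) = (\<Inter>s\<in>{t<..}. sets (augmented_filtration M X P s))"
    and strong_Markov:
      "\<lbrakk>stopping_time (augmented_filtration M X P) T;
        \<Lambda> \<in> sets (filtration.pre_sigma (space M) (augmented_filtration M X P) T);
        s < \<infinity>; E \<in> sets cemetery_borel\<rbrakk> \<Longrightarrow>
      emeasure (completion (P z)) {\<omega>\<in>\<Lambda>. X (T \<omega> + s) \<omega> \<in> E} =
        (\<integral>\<^sup>+\<omega>\<in>\<Lambda>. emeasure (P (X (T \<omega>) \<omega>)) {\<omega>'\<in>space M. X s \<omega>' \<in> E} \<partial>completion (P z))"
    and quasi_left_continuous:
      "\<lbrakk>\<And>n. stopping_time (augmented_filtration M X P) (S n);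
        \<And>n \<omega>. \<omega> \<in> space M \<Longrightarrow> S n \<omega> \<le> S (Suc n) \<omega>\<rbrakk> \<Longrightarrow>
      AE \<omega> in P z. (SUP n. S n \<omega>) < lifetime X \<omega> \<longrightarrow>
        limitin cemetery_top (\<lambda>n. X (S n \<omega>) \<omega>) (X (SUP n. S n \<omega>) \<omega>) sequentially"

locale standard_processes_in_duality =
  standard_process M X P \<theta> + dual: standard_process M' X' P' \<theta>'
  for M :: "'w measure"
    and X :: "ennreal \<Rightarrow> 'w \<Rightarrow> 's::{metric_space, second_countable_topology} option"
    and P :: "'s option \<Rightarrow> 'w measure"
    and \<theta> :: "ennreal \<Rightarrow> 'w \<Rightarrow> 'w"
    and M' :: "'v measure"
    and X' :: "ennreal \<Rightarrow> 'v \<Rightarrow> 's option"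
    and P' :: "'s option \<Rightarrow> 'v measure"
    and \<theta>' :: "ennreal \<Rightarrow> 'v \<Rightarrow> 'v" +
  fixes m :: "'s measure"
    and p :: "real \<Rightarrow> 's \<Rightarrow> 's \<Rightarrow> ennreal"
  assumes sigma_finite_m: "sigma_finite_measure m"
    and sets_m: "sets m = sets borel"
    and measurable_p: "(\<lambda>(t, x, y). p t x y) \<in>
      borel_measurable (restrict_space borel {0<..} \<Otimes>\<^sub>M borel \<Otimes>\<^sub>M borel)"
    and transition_density: "\<lbrakk>0 < t; B \<in> sets borel\<rbrakk> \<Longrightarrow>
      emeasure (P (Some x)) {\<omega>\<in>space M. X (ennreal t) \<omega> \<in> Some ` B} = (\<integral>\<^sup>+y\<in>B. p t x y \<partial>m)"
    and dual_transition_density: "\<lbrakk>0 < t; B \<in> sets borel\<rbrakk> \<Longrightarrow>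
      emeasure (P' (Some y)) {\<omega>\<in>space M'. X' (ennreal t) \<omega> \<in> Some ` B} = (\<integral>\<^sup>+x\<in>B. p t x y \<partial>m)"
    and Chapman_Kolmogorov: "\<lbrakk>0 < s; 0 < t\<rbrakk> \<Longrightarrow>
      p (t + s) x y = (\<integral>\<^sup>+z. p t x z * p s z y \<partial>m)"


section \<open>Potentials and measures charging no semipolar set\<close>

definition resolvent_density ::
  "(real \<Rightarrow> 's \<Rightarrow> 's \<Rightarrow> ennreal) \<Rightarrow> real \<Rightarrow> 's \<Rightarrow> 's \<Rightarrow> ennreal" where
  "resolvent_density p \<alpha> x y = (\<integral>\<^sup>+t\<in>{0<..}. ennreal (exp (- \<alpha> * t)) * p t x y \<partial>lborel)"

definition potential ::
  "(real \<Rightarrow> 's \<Rightarrow> 's \<Rightarrow> ennreal) \<Rightarrow> real \<Rightarrow> 's measure \<Rightarrow> 's \<Rightarrow> ennreal" where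
  "potential p \<alpha> \<mu> x = (\<integral>\<^sup>+y. resolvent_density p \<alpha> x y \<partial>\<mu>)"

text \<open>
  A semipolar set need not be Borel; charging no semipolar set means that each of them is null
  for the completed measure.
\<close>

definition S00 ::
  "'w measure \<Rightarrow> (ennreal \<Rightarrow> 'w \<Rightarrow> 's::topological_space option) \<Rightarrow> ('s option \<Rightarrow> 'w measure)
    \<Rightarrow> (real \<Rightarrow> 's \<Rightarrow> 's \<Rightarrow> ennreal) \<Rightarrow> 's measure set" where
  "S00 M X P p = {\<mu>. sets \<mu> = sets borel \<and> finite_measure \<mu> \<and>
     (\<forall>N. semipolar M X P N \<longrightarrow> N \<in> null_sets (completion \<mu>)) \<and>
     (SUP x. potential p 1 \<mu> x) < \<infinity>}"

definition add_measure :: "'a measure \<Rightarrow> 'a measure \<Rightarrow> 'a measure" where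
  "add_measure \<mu> \<nu> = measure_of (space \<mu>) (sets \<mu>) (\<lambda>B. emeasure \<mu> B + emeasure \<nu> B)"

definition absdiff :: "ennreal \<Rightarrow> ennreal \<Rightarrow> ennreal" where
  "absdiff a b = e2ennreal \<bar>enn2ereal a - enn2ereal b\<bar>"

text \<open>The argument \<open>f\<close> is the absolute value of the function whose norm is taken.\<close>

definition Linfty_norm :: "'a measure \<Rightarrow> ('a \<Rightarrow> ennreal) \<Rightarrow> ennreal" where
  "Linfty_norm \<nu> f = Inf {ennreal C | C. 0 < C \<and> (AE x in \<nu>. f x \<le> ennreal C)}"


section \<open>Positive continuous additive functionals and the Revuz correspondence\<close>

definition PCAF ::
  "'w measure \<Rightarrow> (ennreal \<Rightarrow> 'w \<Rightarrow> 's::topological_space option) \<Rightarrow> ('s option \<Rightarrow> 'w measure)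
    \<Rightarrow> (ennreal \<Rightarrow> 'w \<Rightarrow> 'w) \<Rightarrow> (real \<Rightarrow> 'w \<Rightarrow> ennreal) \<Rightarrow> bool" where
  "PCAF M X P \<theta> A \<longleftrightarrow>
     (\<forall>t\<ge>0. A t \<in> borel_measurable (augmented_filtration M X P (ennreal t))) \<and>
     (\<exists>\<Lambda>\<in>sets (augmented_filtration M X P \<infinity>).
        (\<forall>x. emeasure (completion (P (Some x))) \<Lambda> = 1) \<and>
        (\<forall>t\<ge>0. \<theta> (ennreal t) ` \<Lambda> \<subseteq> \<Lambda>) \<and>
        (\<forall>\<omega>\<in>\<Lambda>.
           A 0 \<omega> = 0 \<and>
           continuous_on {0..} (\<lambda>t. A t \<omega>) \<and>
           (\<forall>t\<ge>0. ennreal t < lifetime X \<omega> \<longrightarrow> A t \<omega> < \<infinity>) \<and>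
           (\<forall>t\<ge>0. lifetime X \<omega> \<le> ennreal t \<longrightarrow> A t \<omega> = A (enn2real (lifetime X \<omega>)) \<omega>) \<and>
           (\<forall>s\<ge>0. \<forall>t\<ge>0. A (t + s) \<omega> = A t \<omega> + A s (\<theta> (ennreal t) \<omega>))))"

text \<open>
  The integral of \<open>g\<close> over \<open>[0, \<infinity>)\<close> against \<open>da\<close>, for continuous nondecreasing
  \<open>a\<close> from \<open>[0, \<infinity>)\<close> to \<open>[0, \<infinity>]\<close> with \<open>a 0 = 0\<close>. As \<open>a\<close> may reach \<open>\<infinity>\<close>
  in finite time, \<open>da\<close> (carried by \<open>{t. a t < \<infinity>}\<close>) is the increasing limit of the
  Lebesgue-Stieltjes measures of the bounded functions \<open>min (a t) n\<close>.
\<close>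

definition Stieltjes_integral :: "(real \<Rightarrow> ennreal) \<Rightarrow> (real \<Rightarrow> ennreal) \<Rightarrow> ennreal" where
  "Stieltjes_integral g a = (SUP n::nat.
     \<integral>\<^sup>+t\<in>{0..}. g t \<partial>interval_measure (\<lambda>t. enn2real (min (a (max 0 t)) (of_nat n))))"

definition Revuz_corresponds ::
  "(ennreal \<Rightarrow> 'w \<Rightarrow> 's::topological_space option) \<Rightarrow> ('s option \<Rightarrow> 'w measure)
    \<Rightarrow> (real \<Rightarrow> 's \<Rightarrow> 's \<Rightarrow> ennreal) \<Rightarrow> (real \<Rightarrow> 'w \<Rightarrow> ennreal) \<Rightarrow> 's measure \<Rightarrow> bool" where
  "Revuz_corresponds X P p A \<mu> \<longleftrightarrow>
     (\<forall>\<alpha>>0. \<forall>x. \<forall>f\<in>borel_measurable borel.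
        (\<integral>\<^sup>+\<omega>. Stieltjes_integral
            (\<lambda>t. ennreal (exp (- \<alpha> * t)) * cemetery_ext f (X (ennreal t) \<omega>)) (\<lambda>t. A t \<omega>)
          \<partial>completion (P (Some x)))
        = (\<integral>\<^sup>+y. resolvent_density p \<alpha> x y * f y \<partial>\<mu>))"

end

theory Submission
  imports Defs
begin

text \<open>
  Write \<open>G\<^sub>n = \<integral> e\<^sup>-\<^sup>t dA\<^sub>n\<close> and \<open>G = \<integral> e\<^sup>-\<^sup>t dA\<close>, so that
  \<open>E\<^sub>x G\<^sub>n = R\<^sub>1\<mu>\<^sub>n(x)\<close> and \<open>E\<^sub>x G = R\<^sub>1\<mu>(x)\<close>. Splitting the square
  \<open>[0,\<infinity>)\<^sup>2\<close> along its diagonal and using the strong Markov property gives the energy identity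
  \<open>E\<^sub>x (G\<^sub>n G) = \<integral> r\<^sub>2(x,y) (R\<^sub>1\<mu>\<^sub>n(y) \<mu>(dy) + R\<^sub>1\<mu>(y) \<mu>\<^sub>n(dy))\<close>. If \<open>h = R\<^sub>1\<mu>\<^sub>n - R\<^sub>1\<mu>\<close> is at most \<open>\<epsilon>\<close> in
  absolute value almost everywhere for \<open>\<mu>\<^sub>n + \<mu>\<close>, it follows that
  \<open>E\<^sub>x (G\<^sub>n - G)\<^sup>2 \<le> 2 \<epsilon> (R\<^sub>1\<mu>\<^sub>n + R\<^sub>1\<mu>)(x)\<close>; applied to \<open>G\<^sub>n\<close> alone, the identity bounds \<open>R\<^sub>1\<mu>\<^sub>n\<close>
  uniformly, so \<open>E\<^sub>x (G\<^sub>n - G)\<^sup>2\<close>, and with it \<open>\<bar>h\<bar>\<^sup>2\<close>, tends to 0 uniformly in \<open>x\<close>.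
  The difference \<open>D\<^sub>t\<close> of the discounted functionals satisfies
  \<open>D\<^sub>t + e\<^sup>-\<^sup>t h(X\<^sub>t) = E\<^sub>x (G\<^sub>n - G | F\<^sub>t)\<close>, so Doob's inequality controls \<open>sup\<^sub>t \<bar>D\<^sub>t\<bar>\<close>, and
  \<open>A\<^sub>n - A\<close> is recovered from \<open>D\<close> by integration by parts.

  Integrals against \<open>dA\<close> are rewritten as Lebesgue integrals along the right inverse of \<open>A\<close>, whose
  values are stopping times. The strong Markov property is then needed only at these and at constant times, and the
  right continuity of \<open>t \<mapsto> R\<^sub>1\<mu>(X\<^sub>t)\<close> is never used.
\<close>

section \<open>Measurability in the compactified state space\<close>

text \<open>Two obstacles shape the development. The strong Markov property is assumed for one
  coordinate at a time, whereas it is applied to \<open>discounted_total\<close>, a functional of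
  the whole path that is only known to be measurable for the augmented sigma-algebra. The gap is
  closed by passing to finitely many coordinates, to raw path functionals, and finally by changing
  the functional on a null set of the path law whose initial distribution is the law of the process
  at the stopping time. The other obstacle is that the hypothesis compares the potentials only
  almost everywhere, while the conclusion is uniform over all starting points. The energy identity
  bridges this: its right side sees the potentials only through the two measures, its left side is
  an expectation from an arbitrary point x. Cauchy-Schwarz bounds the square of the potential at x
  by that expectation, and one factor can be divided out. Doob's inequality is applied on finite
  dyadic grids with a constant free of the grid; once the potential term has been split off, the
  continuity of the functionals fills the gaps.\<close>

lemma space_cemetery_borel [simp]: "space cemetery_borel = UNIV"
  by (simp add: cemetery_borel_def)

lemma sets_cemetery_borel: "sets cemetery_borel = sigma_sets UNIV {U. openin cemetery_top U}"
  by (simp add: cemetery_borel_def)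

lemma Some_image_cemetery_borel:
  assumes "E \<in> sets borel" shows "Some ` E \<in> sets cemetery_borel"
proof -
  have op: "Some ` U \<in> sets cemetery_borel" if "open U" for U :: "'a set"
    using that by (auto simp: sets_cemetery_borel)
  have "E \<in> sigma_sets UNIV {S. open S}" using assms by (simp add: borel_def)
  then show ?thesis
  proof induction
    case (Basic a) then show ?case using op by auto
  next
    case (Compl a)
    have "Some ` (UNIV - a) = Some ` UNIV - Some ` a" by auto
    then show ?case using Compl op[of UNIV] by (metis open_UNIV sets.Diff)
  next
    case (Union a)
    then show ?case by (metis image_UN sets.countable_nat_UN image_subsetI rangeI)
  qed simp
qed

lemma None_cemetery_borel: "{None} \<in> sets (cemetery_borel :: 'a::topological_space option measure)"
proof -
  have "{None} = (space cemetery_borel :: 'a option set) - Some ` UNIV"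
    by (auto simp: image_iff)
  also have "\<dots> \<in> sets cemetery_borel"
    by (intro sets.Diff sets.top Some_image_cemetery_borel) auto
  finally show ?thesis .
qed

text \<open>An open set of the compactification that contains the cemetery is the complement of the
  image of a closed set, so its preimage is the complement of an event that is already under
  control. Testing the open subsets of S therefore suffices.\<close>

lemma measurable_cemeteryI:
  fixes Y :: "'w \<Rightarrow> 's::topological_space option"
  assumes Y: "\<And>U. open U \<Longrightarrow> {\<omega>\<in>space N. Y \<omega> \<in> Some ` U} \<in> sets N"
  shows "Y \<in> N \<rightarrow>\<^sub>M cemetery_borel"
proof -
  have b: "{\<omega>\<in>space N. Y \<omega> \<in> Some ` E} \<in> sets N" if "E \<in> sets borel" for E
  proof -
    have "E \<in> sigma_sets UNIV {S. open S}" using that by (simp add: borel_def)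
    then show ?thesis
    proof induction
      case (Basic a) then show ?case using Y by auto
    next
      case (Compl a)
      have "{\<omega>\<in>space N. Y \<omega> \<in> Some ` (UNIV - a)} = {\<omega>\<in>space N. Y \<omega> \<in> Some ` UNIV} - {\<omega>\<in>space N. Y \<omega> \<in> Some ` a}"
        by auto
      then show ?case using Compl Y[of UNIV] by auto
    next
      case (Union a)
      have "{\<omega>\<in>space N. Y \<omega> \<in> Some ` (\<Union>i. a i)} = (\<Union>i. {\<omega>\<in>space N. Y \<omega> \<in> Some ` (a i)})"
        by auto
      then show ?case using Union by auto
    qed simp
  qed
  show ?thesis
    unfolding cemetery_borel_def
  proof (rule measurable_measure_of)
    fix U :: "'s option set" assume "U \<in> {U. openin cemetery_top U}"
    then consider V where "open V" "U = Some ` V"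
      | C where "closed C" "U = insert None (Some ` (- C))"
      by (auto simp: openin_Alexandroff_compactification Compl_eq_Diff_UNIV)
    then show "Y -` U \<inter> space N \<in> sets N"
    proof cases
      case 1
      then have "Y -` U \<inter> space N = {\<omega>\<in>space N. Y \<omega> \<in> Some ` V}" by auto
      with 1 show ?thesis using Y by simp
    next
      case 2
      then have "Y -` U \<inter> space N = space N - {\<omega>\<in>space N. Y \<omega> \<in> Some ` C}"
        by (intro set_eqI, rename_tac \<omega>, case_tac "Y \<omega>") auto
      with 2 b[of C] show ?thesis by auto
    qed
  qed auto
qed

lemma measurable_cemetery_ext:
  assumes f: "f \<in> borel_measurable borel"
  shows "cemetery_ext f \<in> borel_measurable cemetery_borel"
proof (rule measurableI)
  fix B :: "ennreal set" assume B: "B \<in> sets borel"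
  have 1: "Some ` (f -` B) \<in> sets cemetery_borel"
    using measurable_sets[OF f B] by (intro Some_image_cemetery_borel) auto
  have "cemetery_ext f -` B \<inter> space cemetery_borel = Some ` (f -` B) \<union> (if 0 \<in> B then {None} else {})"
    by (auto simp: cemetery_ext_def split: option.splits)
  also have "\<dots> \<in> sets cemetery_borel" using sets.Un[OF 1 None_cemetery_borel] 1 by simp
  finally show "cemetery_ext f -` B \<inter> space cemetery_borel \<in> sets cemetery_borel" .
qed auto

text \<open>The limit lies in \<open>U\<close> exactly when the sequence is eventually in one of
  countably many basic sets with compact closure inside \<open>U\<close>. Local compactness supplies
  such a basic set around every point of \<open>U\<close>.\<close>

lemma measurable_limitin_cemetery:
  fixes Y :: "'w \<Rightarrow> 's::{metric_space, second_countable_topology} option"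
  assumes lc: "locally_compact_space (euclidean :: 's topology)"
    and Yn: "\<And>n::nat. Yn n \<in> N \<rightarrow>\<^sub>M cemetery_borel"
    and lim: "\<And>\<omega>. \<omega> \<in> space N \<Longrightarrow> limitin cemetery_top (\<lambda>n. Yn n \<omega>) (Y \<omega>) sequentially"
  shows "Y \<in> N \<rightarrow>\<^sub>M cemetery_borel"
proof (rule measurable_cemeteryI)
  fix U :: "'s set" assume U: "open U"
  obtain \<B> :: "'s set set" where \<B>: "countable \<B>" "topological_basis \<B>"
    using ex_countable_basis by auto
  define \<V> where "\<V> = {V\<in>\<B>. compact (closure V) \<and> closure V \<subseteq> U}"
  have cV: "countable \<V>" using \<B> by (auto simp: \<V>_def)
  have oV: "open V" if "V \<in> \<V>" for V using that \<B> by (auto simp: \<V>_def topological_basis_open)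
  have "\<exists>V\<in>\<V>. x \<in> V" if "x \<in> U" for x
  proof -
    have "neighbourhood_base_of (compactin euclidean) (euclidean :: 's topology)"
      using lc locally_compact_space_neighbourhood_base[of "euclidean::'s topology"] by simp
    then have "\<exists>W K. open W \<and> compact K \<and> x \<in> W \<and> W \<subseteq> K \<and> K \<subseteq> U"
      using U that unfolding neighbourhood_base_of by simp
    then obtain W K where "open W" "compact K" "x \<in> W" "W \<subseteq> K" "K \<subseteq> U" by blast
    moreover from this obtain V where V: "V \<in> \<B>" "x \<in> V" "V \<subseteq> W"
      using \<B>(2) topological_basisE by metis
    ultimately have K: "closure V \<subseteq> K"
      by (intro closure_minimal compact_imp_closed) auto
    have "compact (K \<inter> closure V)" using \<open>compact K\<close> by (rule compact_Int_closed) simp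
    moreover have "K \<inter> closure V = closure V" using K by auto
    ultimately show ?thesis using V order_trans[OF K \<open>K \<subseteq> U\<close>] unfolding \<V>_def by auto
  qed
  note cover = this
  have eq: "{\<omega>\<in>space N. Y \<omega> \<in> Some ` U} =
    (\<Union>V\<in>\<V>. \<Union>k. \<Inter>n\<in>{k..}. {\<omega>\<in>space N. Yn n \<omega> \<in> Some ` V})" (is "?L = ?R")
  proof safe
    fix \<omega> x assume \<omega>: "\<omega> \<in> space N" "Y \<omega> = Some x" "x \<in> U"
    then obtain V where V: "V \<in> \<V>" "x \<in> V" using cover by blast
    have "openin cemetery_top (Some ` V)" using oV[OF V(1)] by simp
    then have "\<forall>\<^sub>F n in sequentially. Yn n \<omega> \<in> Some ` V"
      using lim[OF \<omega>(1)] \<omega> V unfolding limitin_def by auto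
    then obtain k where "\<forall>n\<ge>k. Yn n \<omega> \<in> Some ` V" by (auto simp: eventually_sequentially)
    with V \<omega> show "\<omega> \<in> ?R" by (intro UN_I[of V] UN_I[of k]) auto
  next
    fix \<omega> V k assume V: "V \<in> \<V>" and *: "\<omega> \<in> (\<Inter>n\<in>{k..}. {\<omega>\<in>space N. Yn n \<omega> \<in> Some ` V})"
    then have \<omega>: "\<omega> \<in> space N" by auto
    then show "\<omega> \<in> space N" .
    \<comment> \<open>Compactness of \<open>closure V\<close> makes its image closed in the
      compactification, so a sequence staying in it can neither leave \<open>U\<close> in the limit
      nor converge to the cemetery.\<close>
    have "closedin cemetery_top (Some ` closure V)"
      using V unfolding closedin_Alexandroff_compactification by (auto simp: \<V>_def)
    moreover have "\<forall>\<^sub>F n in sequentially. Yn n \<omega> \<in> Some ` closure V"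
      using * closure_subset[of V] unfolding eventually_sequentially by (intro exI[of _ k]) auto
    ultimately have "Y \<omega> \<in> Some ` closure V"
      by (rule limitin_closedin[OF lim[OF \<omega>]]) simp
    then show "Y \<omega> \<in> Some ` U" using V by (auto simp: \<V>_def)
  qed
  have m: "{\<omega>\<in>space N. Yn n \<omega> \<in> Some ` V} \<in> sets N" if "V \<in> \<V>" for V n
    using measurable_sets[OF Yn, of "Some ` V" n] Some_image_cemetery_borel[of V] oV[OF that]
    by (auto simp: vimage_def Int_def conj_commute)
  show "{\<omega>\<in>space N. Y \<omega> \<in> Some ` U} \<in> sets N"
    unfolding eq by (intro sets.countable_UN' cV sets.countable_UN sets.countable_INT' image_subsetI) (use m in auto)
qed

section \<open>The strong Markov property for functionals of the path\<close>

text \<open>The image under \<open>Z\<close> of the measure restricted to \<open>\<Lambda>\<close>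
  and the mixture of \<open>K\<close> over the image under \<open>Y\<close> agree on the pi-system
  \<open>G\<close>, hence are equal; integrating \<open>f\<close> gives the claim. It serves for a
  single coordinate, with all measurable sets as \<open>G\<close>, and for the shifted path, with
  cylinders as \<open>G\<close>.\<close>

lemma nn_integral_kernel:
  assumes Q: "finite_measure Q" and \<Lambda>: "\<Lambda> \<in> sets Q"
    and Y: "Y \<in> Q \<rightarrow>\<^sub>M L" and Z: "Z \<in> Q \<rightarrow>\<^sub>M N" and K: "K \<in> L \<rightarrow>\<^sub>M subprob_algebra N"
    and G: "sets N = sigma_sets (space N) G" "Int_stable G" "space N \<in> G" and L: "space L \<noteq> {}"
    and eq: "\<And>E. E \<in> G \<Longrightarrow> emeasure Q {\<omega>\<in>\<Lambda>. Z \<omega> \<in> E} = (\<integral>\<^sup>+\<omega>\<in>\<Lambda>. emeasure (K (Y \<omega>)) E \<partial>Q)"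
    and f: "f \<in> borel_measurable N"
  shows "(\<integral>\<^sup>+\<omega>\<in>\<Lambda>. f (Z \<omega>) \<partial>Q) = (\<integral>\<^sup>+\<omega>\<in>\<Lambda>. (\<integral>\<^sup>+z. f z \<partial>K (Y \<omega>)) \<partial>Q)"
proof -
  interpret finite_measure Q by fact
  let ?D = "density Q (indicator \<Lambda>)"
  have D: "Y \<in> ?D \<rightarrow>\<^sub>M L" "Z \<in> ?D \<rightarrow>\<^sub>M N" using Y Z by simp_all
  have GN: "E \<in> sets N" if "E \<in> G" for E unfolding G(1) using that by (rule sigma_sets.Basic)
  have dens: "(\<integral>\<^sup>+\<omega>. h \<omega> \<partial>?D) = (\<integral>\<^sup>+\<omega>\<in>\<Lambda>. h \<omega> \<partial>Q)" if "h \<in> borel_measurable Q" for h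
    using \<Lambda> that by (subst nn_integral_density) (auto simp: mult.commute)
  have Z_eq: "emeasure (distr ?D N Z) E = emeasure Q {\<omega>\<in>\<Lambda>. Z \<omega> \<in> E}" if E: "E \<in> sets N" for E
  proof -
    have B: "Z -` E \<inter> space Q \<in> sets Q" by (rule measurable_sets[OF Z E])
    have "emeasure (distr ?D N Z) E = (\<integral>\<^sup>+\<omega>. indicator \<Lambda> \<omega> * indicator (Z -` E \<inter> space Q) \<omega> \<partial>Q)"
      using \<Lambda> B by (simp add: emeasure_distr[OF D(2) E] emeasure_density)
    also have "\<dots> = (\<integral>\<^sup>+\<omega>. indicator (\<Lambda> \<inter> (Z -` E \<inter> space Q)) \<omega> \<partial>Q)"
      by (intro nn_integral_cong) (auto split: split_indicator)
    also have "\<dots> = emeasure Q (\<Lambda> \<inter> (Z -` E \<inter> space Q))" using \<Lambda> B by (intro nn_integral_indicator) auto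
    also have "\<Lambda> \<inter> (Z -` E \<inter> space Q) = {\<omega>\<in>\<Lambda>. Z \<omega> \<in> E}" using sets.sets_into_space[OF \<Lambda>] by auto
    finally show ?thesis .
  qed
  have "distr ?D N Z = distr ?D L Y \<bind> K"
  proof (rule measure_eqI_generator_eq[where E=G and \<Omega>="space N" and A="\<lambda>_. space N"])
    show "G \<subseteq> Pow (space N)" using GN sets.sets_into_space by blast
    show "sets (distr ?D L Y \<bind> K) = sigma_sets (space N) G"
      unfolding G(1)[symmetric] using measurable_space[OF K] L by (subst sets_bind[of _ _ N]) (auto simp: sets_kernel[OF K])
    show "emeasure (distr ?D N Z) (space N) \<noteq> \<infinity>"
      using Z_eq[of "space N"] by (simp add: emeasure_eq_measure)
    fix E assume E: "E \<in> G"
    have mE: "(\<lambda>y. emeasure (K y) E) \<in> borel_measurable L"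
      by (rule measurable_compose[OF K measurable_emeasure_subprob_algebra[OF GN[OF E]]])
    have "emeasure (distr ?D N Z) E = (\<integral>\<^sup>+\<omega>. emeasure (K (Y \<omega>)) E \<partial>?D)"
      unfolding Z_eq[OF GN[OF E]] eq[OF E] by (rule dens[symmetric]) (rule measurable_compose[OF Y mE])
    also have "\<dots> = (\<integral>\<^sup>+y. emeasure (K y) E \<partial>distr ?D L Y)" using mE by (subst nn_integral_distr[OF D(1)]) auto
    also have "\<dots> = emeasure (distr ?D L Y \<bind> K) E"
      using K GN[OF E] L by (subst emeasure_bind[of _ _ N]) auto
    finally show "emeasure (distr ?D N Z) E = emeasure (distr ?D L Y \<bind> K) E" .
  qed (use G in auto)
  then have "(\<integral>\<^sup>+z. f z \<partial>distr ?D N Z) = (\<integral>\<^sup>+y. \<integral>\<^sup>+z. f z \<partial>K y \<partial>distr ?D L Y)"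
    using nn_integral_bind[OF f, of K "distr ?D L Y"] K by simp
  moreover have mf: "(\<lambda>y. \<integral>\<^sup>+z. f z \<partial>K y) \<in> borel_measurable L"
    by (rule nn_integral_measurable_subprob_algebra2[OF _ K]) (use f in measurable)
  ultimately have "(\<integral>\<^sup>+\<omega>. f (Z \<omega>) \<partial>?D) = (\<integral>\<^sup>+\<omega>. (\<integral>\<^sup>+z. f z \<partial>K (Y \<omega>)) \<partial>?D)"
    using f by (simp add: nn_integral_distr[OF D(1)] nn_integral_distr[OF D(2)])
  then show ?thesis using measurable_compose[OF Z f] measurable_compose[OF Y mf] by (simp add: dens)
qed

context standard_process
begin

abbreviation F where "F \<equiv> augmented_filtration M X P"
abbreviation raw where "raw \<equiv> raw_filtration M X \<infinity>"
abbreviation C where "C z \<equiv> completion (P z)"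

sublocale aug: filtration "space M" F by (rule filtration_augmented_filtration)

lemma space_P [simp]: "space (P z) = space M"
  using sets_P by (rule sets_eq_imp_space_eq)

lemma prob_space_completion: "prob_space (C z)"
  using prob_P by (rule prob_space.prob_space_completion)

lemma sets_raw: "sets (raw_filtration M X t) =
    sigma_sets (space M) {X s -` B \<inter> space M | s B. s \<le> t \<and> B \<in> sets cemetery_borel}"
  unfolding raw_filtration_def by (subst sets_measure_of) auto

lemma raw_coordinate: "s \<le> t \<Longrightarrow> B \<in> sets cemetery_borel \<Longrightarrow> {\<omega>\<in>space M. X s \<omega> \<in> B} \<in> sets (raw_filtration M X t)"
  unfolding sets_raw by (intro sigma_sets.Basic) auto

lemma raw_subset_M: "sets (raw_filtration M X t) \<subseteq> sets M"
  unfolding sets_raw using measurable_sets[OF measurable_X] by (intro sets.sigma_sets_subset) auto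

lemma raw_subset_augmented: "sets (raw_filtration M X t) \<subseteq> sets (F t)"
proof
  fix A assume A: "A \<in> sets (raw_filtration M X t)"
  moreover have "A \<subseteq> space M" using sets.sets_into_space[OF A] by simp
  moreover have "init_null M X P \<nu> {}" for \<nu>
    unfolding init_null_def by (intro bexI[of _ "{}"]) auto
  ultimately show "A \<in> sets (F t)"
    unfolding augmented_filtration_def by (subst sets_measure_of) (auto intro!: sigma_sets.Basic bexI[of _ A])
qed

lemma raw_subset_completion: "sets (raw_filtration M X t) \<subseteq> sets (C z)"
  using raw_subset_M[of t] sets_P[of z] by (auto intro: sets_completionI_sets)

lemma measurable_X_completion [measurable]: "X t \<in> C z \<rightarrow>\<^sub>M cemetery_borel"
  by (rule measurable_completion) (simp add: measurable_X measurable_cong_sets[OF sets_P refl])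

lemma measurable_transition:
  shows "f \<in> borel_measurable cemetery_borel \<Longrightarrow>
      (\<lambda>y. \<integral>\<^sup>+\<omega>. f (X s \<omega>) \<partial>P y) \<in> borel_measurable cemetery_borel"
    and "(\<lambda>y. distr (P y) cemetery_borel (X s)) \<in> cemetery_borel \<rightarrow>\<^sub>M subprob_algebra cemetery_borel"
proof -
  have X: "X s \<in> P y \<rightarrow>\<^sub>M cemetery_borel" for y
    by (simp add: measurable_X measurable_cong_sets[OF sets_P refl])
  show K: "(\<lambda>y. distr (P y) cemetery_borel (X s)) \<in> cemetery_borel \<rightarrow>\<^sub>M subprob_algebra cemetery_borel"
  proof (rule measurable_subprob_algebra)
    fix y show "subprob_space (distr (P y) cemetery_borel (X s))"
      by (intro prob_space_imp_subprob_space prob_space.prob_space_distr prob_P X)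
  next
    fix E assume E: "E \<in> sets (cemetery_borel :: 's option measure)"
    have "emeasure (distr (P y) cemetery_borel (X s)) E = emeasure (P y) {\<omega>\<in>space M. X s \<omega> \<in> E}" for y
      by (subst emeasure_distr[OF X E]) (auto intro!: arg_cong2[where f=emeasure])
    then show "(\<lambda>y. emeasure (distr (P y) cemetery_borel (X s)) E) \<in> borel_measurable cemetery_borel"
      using measurable_P[OF E] by simp
  qed simp
  assume f: "f \<in> borel_measurable cemetery_borel"
  have "(\<lambda>y. \<integral>\<^sup>+z. f z \<partial>distr (P y) cemetery_borel (X s)) \<in> borel_measurable cemetery_borel"
    by (rule nn_integral_measurable_subprob_algebra2[OF _ K]) (use f in measurable)
  then show "(\<lambda>y. \<integral>\<^sup>+\<omega>. f (X s \<omega>) \<partial>P y) \<in> borel_measurable cemetery_borel"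
    by (simp add: nn_integral_distr[OF X] f)
qed

section \<open>The Markov property for finitely many coordinates\<close>

definition cylinder :: "ennreal set \<Rightarrow> (ennreal \<Rightarrow> 's option set) \<Rightarrow> 'w set" where
  "cylinder J E = {\<omega>\<in>space M. \<forall>s\<in>J. X s \<omega> \<in> E s}"

lemma cylinder_raw:
  assumes "finite J" "\<And>s. E s \<in> sets cemetery_borel"
  shows "cylinder J E \<in> sets raw"
proof -
  have "{\<omega>\<in>space raw. \<forall>s\<in>J. X s \<omega> \<in> E s} \<in> sets raw"
    by (intro sets.sets_Collect_finite_All) (use assms raw_coordinate in auto)
  then show ?thesis by (simp add: cylinder_def)
qed

text \<open>Passes from events to functions of one coordinate. The induction over several times
  needs this, because there the integrand is the probability of a later cylinder.\<close>

lemma Markov_function: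
  assumes \<Lambda>: "\<Lambda> \<in> sets (C z)" and YT: "Y \<in> C z \<rightarrow>\<^sub>M cemetery_borel" and Y': "Y' \<in> C z \<rightarrow>\<^sub>M cemetery_borel"
    and markov: "\<And>E. E \<in> sets cemetery_borel \<Longrightarrow> emeasure (C z) {\<omega>\<in>\<Lambda>. Y' \<omega> \<in> E} =
        (\<integral>\<^sup>+\<omega>\<in>\<Lambda>. emeasure (P (Y \<omega>)) {\<omega>'\<in>space M. X s \<omega>' \<in> E} \<partial>C z)"
    and f: "f \<in> borel_measurable cemetery_borel"
  shows "(\<integral>\<^sup>+\<omega>\<in>\<Lambda>. f (Y' \<omega>) \<partial>C z) = (\<integral>\<^sup>+\<omega>\<in>\<Lambda>. (\<integral>\<^sup>+\<omega>'. f (X s \<omega>') \<partial>P (Y \<omega>)) \<partial>C z)"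
proof -
  have X: "X s \<in> P y \<rightarrow>\<^sub>M cemetery_borel" for y
    by (simp add: measurable_X measurable_cong_sets[OF sets_P refl])
  have "(\<integral>\<^sup>+\<omega>\<in>\<Lambda>. f (Y' \<omega>) \<partial>C z) = (\<integral>\<^sup>+\<omega>\<in>\<Lambda>. (\<integral>\<^sup>+w. f w \<partial>distr (P (Y \<omega>)) cemetery_borel (X s)) \<partial>C z)"
  proof (rule nn_integral_kernel[OF _ \<Lambda> YT Y' measurable_transition(2) sets.sigma_sets_eq[symmetric] sets.Int_stable sets.top _ _ f])
    show "finite_measure (C z)" using prob_space_completion by (rule prob_space.finite_measure)
    fix E assume E: "E \<in> sets (cemetery_borel :: 's option measure)"
    show "emeasure (C z) {\<omega>\<in>\<Lambda>. Y' \<omega> \<in> E} = (\<integral>\<^sup>+\<omega>\<in>\<Lambda>. emeasure (distr (P (Y \<omega>)) cemetery_borel (X s)) E \<partial>C z)"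
      unfolding markov[OF E]
      by (intro nn_integral_cong) (simp add: emeasure_distr[OF X E] vimage_def Int_def conj_commute)
  qed simp
  then show ?thesis using f by (simp add: nn_integral_distr[OF X])
qed

text \<open>Induction on the number of times. The class \<open>adm\<close> of pairs of a time and a
  past event is left abstract because the argument runs twice: with constant times, which yields the
  measurability of the path laws, and with all stopping times, where that measurability is already
  required.\<close>

lemma Markov_cylinder:
  fixes adm :: "('w \<Rightarrow> ennreal) \<Rightarrow> 'w set \<Rightarrow> bool"
  assumes adm_sets: "\<And>T \<Lambda> z. adm T \<Lambda> \<Longrightarrow> \<Lambda> \<in> sets (C z)"
    and adm_X: "\<And>T \<Lambda> z. adm T \<Lambda> \<Longrightarrow> (\<lambda>\<omega>. X (T \<omega>) \<omega>) \<in> C z \<rightarrow>\<^sub>M cemetery_borel"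
    and adm_closed: "\<And>T \<Lambda> s E. adm T \<Lambda> \<Longrightarrow> s < \<infinity> \<Longrightarrow> E \<in> sets cemetery_borel \<Longrightarrow>
      adm (\<lambda>\<omega>. T \<omega> + s) {\<omega>\<in>\<Lambda>. X (T \<omega> + s) \<omega> \<in> E}"
    and markov: "\<And>T \<Lambda> s E z. adm T \<Lambda> \<Longrightarrow> s < \<infinity> \<Longrightarrow> E \<in> sets cemetery_borel \<Longrightarrow>
      emeasure (C z) {\<omega>\<in>\<Lambda>. X (T \<omega> + s) \<omega> \<in> E} =
        (\<integral>\<^sup>+\<omega>\<in>\<Lambda>. emeasure (P (X (T \<omega>) \<omega>)) {\<omega>'\<in>space M. X s \<omega>' \<in> E} \<partial>C z)"
    and adm0: "adm (\<lambda>_. 0) (space M)"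
    and J: "finite J" "\<And>s. s \<in> J \<Longrightarrow> s < \<infinity>" and E: "\<And>s. E s \<in> sets cemetery_borel"
  shows "(\<lambda>y. emeasure (P y) (cylinder J E)) \<in> borel_measurable cemetery_borel \<and>
    (\<forall>T \<Lambda> z. adm T \<Lambda> \<longrightarrow> emeasure (C z) {\<omega>\<in>\<Lambda>. \<forall>s\<in>J. X (T \<omega> + s) \<omega> \<in> E s} =
      (\<integral>\<^sup>+\<omega>\<in>\<Lambda>. emeasure (P (X (T \<omega>) \<omega>)) (cylinder J E) \<partial>C z))"
  using J E
proof (induction "card J" arbitrary: J E rule: less_induct)
  case less
  show ?case
  proof (cases "J = {}")
    case True
    have "emeasure (P y) (cylinder J E) = 1" for y
      using prob_space.emeasure_space_1[OF prob_P, of y] by (simp add: True cylinder_def)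
    then show ?thesis using adm_sets by (simp add: True)
  next
    case False
    \<comment> \<open>Splitting off the smallest time makes truncated subtraction harmless:
      \<open>s - t + t = s\<close> for the remaining times. The coordinate at \<open>t\<close> joins
      the past event and \<open>T + t\<close> becomes the new time, as \<open>adm_closed\<close>
      permits.\<close>
    define t where "t = Min J"
    have t: "t \<in> J" "\<And>s. s \<in> J \<Longrightarrow> t \<le> s" "t < \<infinity>" using False less.prems by (auto simp: t_def)
    define J' where "J' = (\<lambda>s. s - t) ` (J - {t})"
    define E' where "E' s = E (s + t)" for s
    have "card J' < card J"
      using t less.prems(1) unfolding J'_def
      by (metis card_Diff1_less card_image_le finite_Diff order_le_less_trans)
    moreover have "finite J'" "s \<in> J' \<Longrightarrow> s < \<infinity>" for s
      using less.prems t by (auto simp: J'_def less_top[symmetric])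
    moreover have "E' s \<in> sets cemetery_borel" for s using less.prems by (simp add: E'_def)
    ultimately have IH: "(\<lambda>y. emeasure (P y) (cylinder J' E')) \<in> borel_measurable cemetery_borel"
      "\<And>T \<Lambda> z. adm T \<Lambda> \<Longrightarrow> emeasure (C z) {\<omega>\<in>\<Lambda>. \<forall>s\<in>J'. X (T \<omega> + s) \<omega> \<in> E' s} =
        (\<integral>\<^sup>+\<omega>\<in>\<Lambda>. emeasure (P (X (T \<omega>) \<omega>)) (cylinder J' E') \<partial>C z)"
      using less.hyps[of J' E'] by blast+
    define f where "f y = emeasure (P y) (cylinder J' E') * indicator (E t) y" for y
    have f: "f \<in> borel_measurable cemetery_borel" unfolding f_def using IH(1) less.prems by auto
    have Jeq: "(\<forall>s\<in>J. X (r + s) \<omega> \<in> E s) \<longleftrightarrow> X (r + t) \<omega> \<in> E t \<and> (\<forall>s\<in>J'. X (r + t + s) \<omega> \<in> E' s)" for r \<omega>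
    proof -
      have 1: "s - t + t = s" if "s \<in> J" for s using t that by (simp add: diff_add_self_ennreal)
      have 2: "r + t + (s - t) = r + s" if "s \<in> J" for s
        using 1[OF that] by (metis add.assoc add.commute)
      have "(\<forall>s\<in>J'. X (r + t + s) \<omega> \<in> E' s) \<longleftrightarrow>
          (\<forall>s\<in>J - {t}. X (r + t + (s - t)) \<omega> \<in> E (s - t + t))"
        unfolding J'_def E'_def by blast
      also have "\<dots> \<longleftrightarrow> (\<forall>s\<in>J - {t}. X (r + s) \<omega> \<in> E s)"
        by (intro ball_cong refl) (metis 1 2 DiffD1)
      finally have "(\<forall>s\<in>J'. X (r + t + s) \<omega> \<in> E' s) \<longleftrightarrow> (\<forall>s\<in>J - {t}. X (r + s) \<omega> \<in> E s)" .
      then show ?thesis using t(1) by auto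
    qed
    have step: "emeasure (C z) {\<omega>\<in>\<Lambda>. \<forall>s\<in>J. X (T \<omega> + s) \<omega> \<in> E s} = (\<integral>\<^sup>+\<omega>\<in>\<Lambda>. f (X (T \<omega> + t) \<omega>) \<partial>C z)"
      if a: "adm T \<Lambda>" for T \<Lambda> z
    proof -
      let ?\<Lambda> = "{\<omega>\<in>\<Lambda>. X (T \<omega> + t) \<omega> \<in> E t}"
      have "{\<omega>\<in>\<Lambda>. \<forall>s\<in>J. X (T \<omega> + s) \<omega> \<in> E s} = {\<omega>\<in>?\<Lambda>. \<forall>s\<in>J'. X (T \<omega> + t + s) \<omega> \<in> E' s}"
        unfolding Jeq by auto
      then have "emeasure (C z) {\<omega>\<in>\<Lambda>. \<forall>s\<in>J. X (T \<omega> + s) \<omega> \<in> E s} =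
          (\<integral>\<^sup>+\<omega>\<in>?\<Lambda>. emeasure (P (X (T \<omega> + t) \<omega>)) (cylinder J' E') \<partial>C z)"
        using IH(2)[OF adm_closed[OF a t(3) less.prems(3)], of z t] by simp
      also have "\<dots> = (\<integral>\<^sup>+\<omega>\<in>\<Lambda>. f (X (T \<omega> + t) \<omega>) \<partial>C z)"
        unfolding f_def by (intro nn_integral_cong) (auto split: split_indicator)
      finally show ?thesis .
    qed
    \<comment> \<open>With time 0 and the whole space as past event, the cylinder probability
      becomes a transition integral of \<open>f\<close>; measurability in the starting point thus
      comes out of the same induction.\<close>
    have Peq: "emeasure (P y) (cylinder J E) = (\<integral>\<^sup>+\<omega>. f (X t \<omega>) \<partial>P y)" for y
    proof -
      have "emeasure (P y) (cylinder J E) = emeasure (C y) (cylinder J E)"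
        using cylinder_raw[OF less.prems(1,3), of id] cylinder_raw[OF less.prems(1), of E] less.prems raw_subset_M[of \<infinity>] sets_P[of y]
        by (subst emeasure_completion) auto
      also have "\<dots> = (\<integral>\<^sup>+\<omega>\<in>space M. f (X t \<omega>) \<partial>C y)"
        using step[OF adm0, of y] by (simp add: cylinder_def)
      also have "\<dots> = (\<integral>\<^sup>+\<omega>. f (X t \<omega>) \<partial>C y)"
        by (intro nn_integral_cong) auto
      finally show ?thesis by (simp add: nn_integral_completion)
    qed
    have "emeasure (C z) {\<omega>\<in>\<Lambda>. \<forall>s\<in>J. X (T \<omega> + s) \<omega> \<in> E s} =
        (\<integral>\<^sup>+\<omega>\<in>\<Lambda>. emeasure (P (X (T \<omega>) \<omega>)) (cylinder J E) \<partial>C z)" if a: "adm T \<Lambda>" for T \<Lambda> z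
      unfolding step[OF a] Peq
      by (rule Markov_function[OF adm_sets[OF a] adm_X[OF a] adm_X[OF adm_closed[OF a t(3), of UNIV]] markov[OF a t(3)] f])
         (use sets.top[of cemetery_borel] in auto)
    moreover have "(\<lambda>y. emeasure (P y) (cylinder J E)) \<in> borel_measurable cemetery_borel"
      unfolding Peq by (rule measurable_transition(1)[OF f])
    ultimately show ?thesis by blast
  qed
qed

text \<open>The run with constant times and raw past events, whose measurability for the completed
  laws is immediate. For augmented events that measurability is derived later, from the result
  obtained here.\<close>

lemma measurable_emeasure_cylinder:
  assumes J: "finite J" "\<And>s. s \<in> J \<Longrightarrow> s < \<infinity>" and E: "\<And>s. E s \<in> sets cemetery_borel"
  shows "(\<lambda>y. emeasure (P y) (cylinder J E)) \<in> borel_measurable cemetery_borel"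
proof -
  define adm where "adm T \<Lambda> \<longleftrightarrow> (\<exists>t. T = (\<lambda>_. t) \<and> \<Lambda> \<in> sets (raw_filtration M X t))" for T :: "'w \<Rightarrow> ennreal" and \<Lambda>
  have "(\<lambda>y. emeasure (P y) (cylinder J E)) \<in> borel_measurable cemetery_borel \<and>
    (\<forall>T \<Lambda> z. adm T \<Lambda> \<longrightarrow> emeasure (C z) {\<omega>\<in>\<Lambda>. \<forall>s\<in>J. X (T \<omega> + s) \<omega> \<in> E s} =
      (\<integral>\<^sup>+\<omega>\<in>\<Lambda>. emeasure (P (X (T \<omega>) \<omega>)) (cylinder J E) \<partial>C z))"
  proof (rule Markov_cylinder[OF _ _ _ _ _ J E])
    fix T \<Lambda> z assume a: "adm T \<Lambda>"
    then obtain t where t: "T = (\<lambda>_. t)" "\<Lambda> \<in> sets (raw_filtration M X t)" by (auto simp: adm_def)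
    show "\<Lambda> \<in> sets (C z)" using t raw_subset_completion by blast
    show "(\<lambda>\<omega>. X (T \<omega>) \<omega>) \<in> C z \<rightarrow>\<^sub>M cemetery_borel" using t measurable_X_completion by simp
  next
    fix T \<Lambda> and s :: ennreal and E :: "'s option set" assume a: "adm T \<Lambda>" "s < \<infinity>" "E \<in> sets cemetery_borel"
    then obtain t where t: "T = (\<lambda>_. t)" "\<Lambda> \<in> sets (raw_filtration M X t)" by (auto simp: adm_def)
    have "\<Lambda> \<in> sets (raw_filtration M X (t + s))"
      using t sets_raw_filtration_mono[of t "t + s" M X] by auto
    moreover have "{\<omega>\<in>space M. X (t + s) \<omega> \<in> E} \<in> sets (raw_filtration M X (t + s))"
      using a by (intro raw_coordinate) auto
    ultimately have "\<Lambda> \<inter> {\<omega>\<in>space M. X (t + s) \<omega> \<in> E} \<in> sets (raw_filtration M X (t + s))" by blast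
    also have "\<Lambda> \<inter> {\<omega>\<in>space M. X (t + s) \<omega> \<in> E} = {\<omega>\<in>\<Lambda>. X (t + s) \<omega> \<in> E}"
      using sets.sets_into_space[OF t(2)] by auto
    finally show "adm (\<lambda>\<omega>. T \<omega> + s) {\<omega>\<in>\<Lambda>. X (T \<omega> + s) \<omega> \<in> E}"
      unfolding adm_def t by blast
    fix z
    have "\<Lambda> \<in> sets (aug.pre_sigma T)"
    proof (rule aug.sets_pre_sigmaI)
      show "stopping_time F T" unfolding t by (rule stopping_time_const)
      fix t' show "{\<omega> \<in> \<Lambda>. T \<omega> \<le> t'} \<in> sets (F t')"
        using t raw_subset_augmented[of t] aug.sets_F_mono[of t t'] by (cases "t \<le> t'") auto
    qed
    then show "emeasure (C z) {\<omega>\<in>\<Lambda>. X (T \<omega> + s) \<omega> \<in> E} =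
        (\<integral>\<^sup>+\<omega>\<in>\<Lambda>. emeasure (P (X (T \<omega>) \<omega>)) {\<omega>'\<in>space M. X s \<omega>' \<in> E} \<partial>C z)"
      using a by (intro strong_Markov) (auto simp: t stopping_time_const)
  next
    show "adm (\<lambda>_. 0) (space M)" unfolding adm_def using sets.top[of "raw_filtration M X 0"] by auto
  qed
  then show ?thesis by blast
qed

section \<open>The path law as a kernel on the raw sigma-algebra\<close>

definition cylinders :: "'w set set" where
  "cylinders = {cylinder J E | J E. finite J \<and> (\<forall>s\<in>J. s < \<infinity>) \<and> (\<forall>s. E s \<in> sets cemetery_borel)}"

lemma cylinders_subset_raw: "cylinders \<subseteq> sets raw"
  using cylinder_raw by (auto simp: cylinders_def)

lemma space_cylinders: "space M \<in> cylinders"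
  unfolding cylinders_def by (auto intro!: exI[of _ "{}"] exI[of _ "\<lambda>_. UNIV"] simp: cylinder_def sets.top[of cemetery_borel, simplified])

lemma sets_raw_cylinders: "sets raw = sigma_sets (space M) cylinders"
proof
  show "sigma_sets (space M) cylinders \<subseteq> sets raw"
    using cylinders_subset_raw sets.sigma_sets_subset[of cylinders raw] by simp
  show "sets raw \<subseteq> sigma_sets (space M) cylinders"
    unfolding sets_raw
  proof (rule sigma_sets_mono, safe)
    fix s B assume B: "B \<in> sets (cemetery_borel :: 's option measure)"
    show "X s -` B \<inter> space M \<in> sigma_sets (space M) cylinders"
    proof (cases "s = \<infinity>")
      case True
      then have "X s -` B \<inter> space M = (if None \<in> B then space M else {})"
        using X_infinity by auto
      then show ?thesis using space_cylinders by (auto intro: sigma_sets.Basic sigma_sets.Empty)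
    next
      case False
      have "X s -` B \<inter> space M = cylinder {s} (\<lambda>_. B)" by (auto simp: cylinder_def)
      then show ?thesis using False B
        unfolding cylinders_def by (intro sigma_sets.Basic) (auto simp: less_top[symmetric])
    qed
  qed
qed

lemma Int_stable_cylinders: "Int_stable cylinders"
proof (rule Int_stableI)
  fix A B assume "A \<in> cylinders" "B \<in> cylinders"
  then obtain J E J' E' where A: "A = cylinder J E" "finite J" "\<forall>s\<in>J. s < \<infinity>" "\<forall>s. E s \<in> sets cemetery_borel"
    and B: "B = cylinder J' E'" "finite J'" "\<forall>s\<in>J'. s < \<infinity>" "\<forall>s. E' s \<in> sets cemetery_borel"
    by (auto simp: cylinders_def)
  have U: "UNIV \<in> sets (cemetery_borel :: 's option measure)" using sets.top[of cemetery_borel] by simp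
  define E'' where "E'' s = (if s \<in> J then E s else UNIV) \<inter> (if s \<in> J' then E' s else UNIV)" for s
  have "A \<inter> B = cylinder (J \<union> J') E''"
    by (auto simp: A B cylinder_def E''_def)
  moreover have "E'' s \<in> sets cemetery_borel" for s
    unfolding E''_def using A B U by (intro sets.Int) auto
  ultimately show "A \<inter> B \<in> cylinders" unfolding cylinders_def using A B
    by (intro CollectI exI[of _ "J \<union> J'"] exI[of _ E''] conjI) auto
qed

text \<open>\<open>M\<close> may be larger than the sigma-algebra generated by the coordinates, and
  on it nothing is known about the dependence of \<open>P z\<close> on z. The image under the
  identity restricts the law to \<open>raw\<close>, where it is a kernel.\<close>

definition path_law :: "'s option \<Rightarrow> 'w measure" where
  "path_law z = distr (P z) raw (\<lambda>\<omega>. \<omega>)"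

lemma id_raw: "(\<lambda>\<omega>. \<omega>) \<in> P z \<rightarrow>\<^sub>M raw"
  using raw_subset_M[of \<infinity>] by (intro measurableI) (auto simp: sets_P dest: sets.sets_into_space)

lemma sets_path_law [simp, measurable_cong]: "sets (path_law z) = sets raw"
  by (simp add: path_law_def)

lemma emeasure_path_law: "B \<in> sets raw \<Longrightarrow> emeasure (path_law z) B = emeasure (P z) B"
  unfolding path_law_def using sets.sets_into_space[of B raw]
  by (subst emeasure_distr[OF id_raw]) (auto intro!: arg_cong2[where f=emeasure])

lemma prob_space_path_law: "prob_space (path_law z)"
  unfolding path_law_def by (intro prob_space.prob_space_distr prob_P id_raw)

lemma measurable_path_law: "path_law \<in> cemetery_borel \<rightarrow>\<^sub>M subprob_algebra raw"
proof (rule measurable_subprob_algebra_generated[OF sets_raw_cylinders Int_stable_cylinders])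
  show "cylinders \<subseteq> Pow (space M)" by (auto simp: cylinders_def cylinder_def)
  show "subprob_space (path_law a)" for a
    by (intro prob_space_imp_subprob_space prob_space_path_law)
  have *: "(\<lambda>a. emeasure (path_law a) A) \<in> borel_measurable cemetery_borel" if "A \<in> cylinders" for A
    using that cylinders_subset_raw measurable_emeasure_cylinder
    by (subst emeasure_path_law) (auto simp: cylinders_def)
  show "A \<in> cylinders \<Longrightarrow> (\<lambda>a. emeasure (path_law a) A) \<in> borel_measurable cemetery_borel" for A by (rule *)
  show "(\<lambda>a. emeasure (path_law a) (space M)) \<in> borel_measurable cemetery_borel"
    by (rule *[OF space_cylinders])
qed simp

lemma measurable_emeasure_raw: "B \<in> sets raw \<Longrightarrow> (\<lambda>y. emeasure (P y) B) \<in> borel_measurable cemetery_borel"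
  using measurable_emeasure_subprob_algebra[of B raw] measurable_path_law
  by (subst emeasure_path_law[symmetric]) (auto intro: measurable_compose)

section \<open>Augmented events under mixtures of path laws\<close>

lemma augmented_generator:
  "sets (F t) = sigma_sets (space M) {A. A \<subseteq> space M \<and> (\<forall>\<nu>\<in>initial_laws. \<exists>B\<in>sets (raw_filtration M X t).
       init_null M X P \<nu> ((A - B) \<union> (B - A)))}"
  unfolding augmented_filtration_def by (subst sets_measure_of) auto

text \<open>An augmented event differs from a raw event by a subset of a raw set that is null for
  the initial distribution \<open>\<nu>\<close>. A measure that gives no mass to these null sets has
  the augmented event in its completion.\<close>

lemma augmented_subset_completion_of:
  fixes Q :: "'w measure"
  assumes \<nu>: "\<nu> \<in> initial_laws" and Q: "sets raw \<subseteq> sets Q" "space Q = space M"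
    and null: "\<And>N. N \<in> sets raw \<Longrightarrow> (\<integral>\<^sup>+z. emeasure (P z) N \<partial>\<nu>) = 0 \<Longrightarrow> emeasure Q N = 0"
  shows "sets (F t) \<subseteq> sets (completion Q)"
proof -
  have "A \<in> sets (completion Q)" if A: "A \<subseteq> space M"
    and H: "\<forall>\<nu>\<in>initial_laws. \<exists>B\<in>sets (raw_filtration M X t). init_null M X P \<nu> ((A - B) \<union> (B - A))" for A
  proof -
    obtain B N where B: "B \<in> sets (raw_filtration M X t)" "N \<in> sets raw" "(A - B) \<union> (B - A) \<subseteq> N"
      "(\<integral>\<^sup>+z. emeasure (P z) N \<partial>\<nu>) = 0"
      using bspec[OF H \<nu>] unfolding init_null_def by blast
    then have "N \<in> null_sets Q" using null Q by auto
    then have "A - B \<in> sets (completion Q)" "B - A \<in> sets (completion Q)"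
      using B(3) by (auto intro: null_sets_completion)
    moreover have "B \<in> sets (completion Q)"
      using B(1) sets_raw_filtration_mono[of t \<infinity> M X] Q(1) by (auto intro: sets_completionI_sets)
    moreover have "A = (B - (B - A)) \<union> (A - B)" by auto
    ultimately show ?thesis by (metis sets.Diff sets.Un)
  qed
  then have "sigma_sets (space (completion Q)) {A. A \<subseteq> space M \<and> (\<forall>\<nu>\<in>initial_laws. \<exists>B\<in>sets (raw_filtration M X t).
       init_null M X P \<nu> ((A - B) \<union> (B - A)))} \<subseteq> sets (completion Q)"
    by (intro sets.sigma_sets_subset) auto
  then show ?thesis using Q(2) by (simp add: augmented_generator)
qed

lemma augmented_subset_completion: "sets (F t) \<subseteq> sets (C z)"
proof (rule augmented_subset_completion_of)
  show "return cemetery_borel z \<in> initial_laws"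
    by (auto simp: initial_laws_def intro!: prob_space_return)
  fix N assume N: "N \<in> sets raw" "(\<integral>\<^sup>+y. emeasure (P y) N \<partial>return cemetery_borel z) = 0"
  then show "emeasure (P z) N = 0"
    using nn_integral_return[OF _ measurable_emeasure_raw[OF N(1)], of z] by simp
qed (use raw_subset_M sets_P in auto)

text \<open>The mixture is the path law with initial distribution \<open>\<nu>\<close>. It will be
  used with \<open>\<nu>\<close> the law of the process at a stopping time; this is where the
  augmentation over all initial distributions, beyond point masses, enters.\<close>

lemma augmented_subset_completion_bind:
  assumes \<nu>: "prob_space \<nu>" "sets \<nu> = sets cemetery_borel"
  shows "sets (F t) \<subseteq> sets (completion (\<nu> \<bind> path_law))"
proof (rule augmented_subset_completion_of)
  have ne: "space \<nu> \<noteq> {}" using prob_space.not_empty[OF \<nu>(1)] .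
  have k: "path_law \<in> \<nu> \<rightarrow>\<^sub>M subprob_algebra raw"
    using measurable_path_law by (simp add: measurable_cong_sets[OF \<nu>(2) refl])
  have s: "sets (\<nu> \<bind> path_law) = sets raw"
    using ne by (subst sets_bind[of _ _ raw]) auto
  show "\<nu> \<in> initial_laws" using \<nu> by (simp add: initial_laws_def)
  show "sets raw \<subseteq> sets (\<nu> \<bind> path_law)" using s by simp
  show "space (\<nu> \<bind> path_law) = space M" using sets_eq_imp_space_eq[OF s] by simp
  fix N assume N: "N \<in> sets raw" "(\<integral>\<^sup>+y. emeasure (P y) N \<partial>\<nu>) = 0"
  then show "emeasure (\<nu> \<bind> path_law) N = 0"
    by (simp add: emeasure_bind[OF ne k] emeasure_path_law)
qed

end

text \<open>The random time is approximated from above by dyadic times, which take countably many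
  values, and right continuity carries the limit. Infinite times, which have no dyadic above them,
  get the value \<open>None\<close> directly.\<close>

lemma measurable_right_continuous_at_random_time:
  fixes Z :: "ennreal \<Rightarrow> 'n \<Rightarrow> 's::{metric_space, second_countable_topology} option"
  assumes lc: "locally_compact_space (euclidean :: 's topology)"
    and Z: "\<And>r. r < \<infinity> \<Longrightarrow> Z r \<in> N \<rightarrow>\<^sub>M cemetery_borel"
    and rc: "\<And>r n. n \<in> space N \<Longrightarrow> r < \<infinity> \<Longrightarrow> limitin cemetery_top (\<lambda>s. Z s n) (Z r n) (at_right r)"
    and inf: "\<And>n. n \<in> space N \<Longrightarrow> Z \<infinity> n = None"
    and \<rho>: "\<rho> \<in> borel_measurable N"
  shows "(\<lambda>n. Z (\<rho> n) n) \<in> N \<rightarrow>\<^sub>M cemetery_borel"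
proof (rule measurable_limitin_cemetery[OF lc])
  \<comment> \<open>The added 1 places the dyadic time strictly to the right of \<open>r\<close>
    even if \<open>r\<close> is itself dyadic, as convergence along \<open>at_right\<close>
    demands.\<close>
  define k where "k j r = nat \<lfloor>2 ^ j * enn2real r\<rfloor> + 1" for j :: nat and r
  define d where "d j r = ennreal (real (k j r) / 2 ^ j)" for j :: nat and r
  let ?Y = "\<lambda>j n. if \<rho> n = \<infinity> then None else Z (d j (\<rho> n)) n"
  show "?Y j \<in> N \<rightarrow>\<^sub>M cemetery_borel" for j
  proof -
    have m: "(\<lambda>n. k j (\<rho> n)) \<in> N \<rightarrow>\<^sub>M count_space UNIV" unfolding k_def using \<rho> by measurable
    have "(\<lambda>n. (\<lambda>i n. if \<rho> n = \<infinity> then None else Z (ennreal (real i / 2 ^ j)) n) (k j (\<rho> n)) n) \<in> N \<rightarrow>\<^sub>M cemetery_borel"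
      by (rule measurable_compose_countable[OF _ m])
         (intro measurable_If Z, use \<rho> in \<open>auto\<close>)
    then show ?thesis unfolding d_def .
  qed
  fix n assume n: "n \<in> space N"
  show "limitin cemetery_top (\<lambda>j. ?Y j n) (Z (\<rho> n) n) sequentially"
  proof (cases "\<rho> n = \<infinity>")
    case True
    then show ?thesis using inf[OF n] by simp
  next
    case False
    define r where "r = enn2real (\<rho> n)"
    have r: "\<rho> n = ennreal r" "r \<ge> 0" using False by (auto simp: r_def less_top)
    define e where "e j = real (k j (\<rho> n)) / 2 ^ j" for j
    have e: "r < e j" "e j \<le> r + (1/2) ^ j" for j
    proof -
      have "real (nat \<lfloor>2 ^ j * r\<rfloor>) = real_of_int \<lfloor>2 ^ j * r\<rfloor>" using r by simp
      then have "2 ^ j * r < real (k j (\<rho> n))" "real (k j (\<rho> n)) \<le> 2 ^ j * r + 1"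
        unfolding k_def r(1) using r(2) by (simp_all, linarith+)
      then show "r < e j" "e j \<le> r + (1/2) ^ j"
        unfolding e_def by (simp_all add: field_simps power_one_over)
    qed
    have "e \<longlonglongrightarrow> r"
    proof (rule tendsto_sandwich[of "\<lambda>_. r" e _ "\<lambda>j. r + (1/2) ^ j"])
      show "(\<lambda>j. r + (1/2) ^ j) \<longlonglongrightarrow> r"
        using tendsto_add[OF tendsto_const[of r] LIMSEQ_realpow_zero[of "1/2::real"]] by simp
      show "\<forall>\<^sub>F j in sequentially. r \<le> e j" using e(1) by (intro always_eventually allI less_imp_le)
      show "\<forall>\<^sub>F j in sequentially. e j \<le> r + (1/2) ^ j" using e(2) by (intro always_eventually allI)
    qed simp
    then have "(\<lambda>j. ennreal (e j)) \<longlonglongrightarrow> ennreal r" by (rule tendsto_ennrealI)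
    moreover have "ennreal r < ennreal (e j)" for j using e(1)[of j] r(2) by (simp add: ennreal_less_iff)
    ultimately have fl: "filterlim (\<lambda>j. ennreal (e j)) (at_right (ennreal r)) sequentially"
      unfolding filterlim_at by (metis (mono_tags, lifting) always_eventually greaterThan_iff UNIV_I less_irrefl)
    have "limitin cemetery_top (\<lambda>s. Z s n) (Z (\<rho> n) n) (at_right (ennreal r))"
      using rc[OF n, of "\<rho> n"] False r by (simp add: less_top)
    then have "limitin cemetery_top (\<lambda>j. Z (ennreal (e j)) n) (Z (\<rho> n) n) sequentially"
      unfolding limitin_def by (auto intro: eventually_compose_filterlim[OF _ fl])
    then show ?thesis using False by (simp add: d_def e_def)
  qed
qed

section \<open>The process at stopping times\<close>

locale locally_compact_process = standard_process M X P \<theta>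
  for M :: "'w measure"
    and X :: "ennreal \<Rightarrow> 'w \<Rightarrow> 's::{metric_space, second_countable_topology} option"
    and P :: "'s option \<Rightarrow> 'w measure"
    and \<theta> :: "ennreal \<Rightarrow> 'w \<Rightarrow> 'w" +
  assumes lc: "locally_compact_space (euclidean :: 's topology)"
begin

lemma measurable_X_random_time:
  assumes W: "W \<in> N \<rightarrow>\<^sub>M C z" and \<rho>: "\<rho> \<in> borel_measurable N"
  shows "(\<lambda>n. X (\<rho> n) (W n)) \<in> N \<rightarrow>\<^sub>M cemetery_borel"
proof (rule measurable_right_continuous_at_random_time[OF lc _ _ _ \<rho>])
  have W': "n \<in> space N \<Longrightarrow> W n \<in> space M" for n using measurable_space[OF W] by simp
  show "(\<lambda>n. X r (W n)) \<in> N \<rightarrow>\<^sub>M cemetery_borel" for r by (rule measurable_compose[OF W measurable_X_completion])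
  show "n \<in> space N \<Longrightarrow> r < \<infinity> \<Longrightarrow> limitin cemetery_top (\<lambda>s. X s (W n)) (X r (W n)) (at_right r)" for n r
    by (rule right_continuous[OF W'])
  show "n \<in> space N \<Longrightarrow> X \<infinity> (W n) = None" for n using X_infinity W' by blast
qed

lemma measurable_X_augmented: "r \<le> t \<Longrightarrow> X r \<in> F t \<rightarrow>\<^sub>M cemetery_borel"
proof (rule measurableI)
  fix E :: "'s option set" assume "r \<le> t" "E \<in> sets cemetery_borel"
  then have "{\<omega>\<in>space M. X r \<omega> \<in> E} \<in> sets (F t)" using raw_coordinate raw_subset_augmented by blast
  then show "X r -` E \<inter> space (F t) \<in> sets (F t)" by (simp add: aug.space_F vimage_def Int_def conj_commute)
qed auto

lemma measurable_min_stopping_time: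
  assumes T: "stopping_time F T"
  shows "(\<lambda>\<omega>. min (T \<omega>) t) \<in> borel_measurable (F t)"
proof (rule borel_measurableI_le)
  fix s show "{\<omega> \<in> space (F t). min (T \<omega>) t \<le> s} \<in> sets (F t)"
  proof (cases "t \<le> s")
    case False
    then have "{\<omega> \<in> space (F t). min (T \<omega>) t \<le> s} = {\<omega> \<in> space (F t). T \<omega> \<le> s}" by (auto simp: min_le_iff_disj)
    then show ?thesis using aug.stopping_time_le_const[OF T, of s t] False by (simp add: pred_def)
  qed (simp add: min.coboundedI2)
qed

text \<open>For the past up to \<open>t\<close> the position must be found from coordinates up to
  \<open>t\<close> only, whereas the approximation from the right looks beyond the random
  time.\<close>

lemma measurable_X_stopping_time:
  assumes T: "stopping_time F T"
  shows "(\<lambda>\<omega>. X (T \<omega>) \<omega>) \<in> aug.pre_sigma T \<rightarrow>\<^sub>M cemetery_borel"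
proof (rule measurable_cemeteryI, rule aug.sets_pre_sigmaI[OF T])
  fix U :: "'s set" and t assume U: "open U"
  have SU: "Some ` U \<in> sets cemetery_borel" using U by (intro Some_image_cemetery_borel) auto
  \<comment> \<open>The process killed at \<open>t\<close> is still right-continuous, and each of
    its coordinates, even a late one, is measurable for \<open>F t\<close>. Evaluated at
    \<open>min (T \<omega>) t\<close> it settles the case \<open>T \<omega> < t\<close>; the case
    \<open>T \<omega> = t\<close> only involves \<open>X t\<close>.\<close>
  define Z where "Z r \<omega> = (if r < t then X r \<omega> else None)" for r \<omega>
  have "(\<lambda>\<omega>. Z (min (T \<omega>) t) \<omega>) \<in> F t \<rightarrow>\<^sub>M cemetery_borel"
  proof (rule measurable_right_continuous_at_random_time[OF lc])
    show "(\<lambda>\<omega>. min (T \<omega>) t) \<in> borel_measurable (F t)" by (rule measurable_min_stopping_time[OF T])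
    show "Z r \<in> F t \<rightarrow>\<^sub>M cemetery_borel" for r
      using measurable_X_augmented[of r t] by (cases "r < t") (simp_all add: Z_def[abs_def])
    show "\<omega> \<in> space (F t) \<Longrightarrow> Z \<infinity> \<omega> = None" for \<omega>
      by (simp add: Z_def)
    show "limitin cemetery_top (\<lambda>s. Z s \<omega>) (Z r \<omega>) (at_right r)" if "\<omega> \<in> space (F t)" "r < \<infinity>" for r \<omega>
    proof (cases "r < t")
      case True
      have "\<forall>\<^sub>F s in at_right r. s < t" using True eventually_at_right[OF that(2)[unfolded infinity_ennreal_def]] by blast
      then have "\<forall>\<^sub>F s in at_right r. X s \<omega> = Z s \<omega>" by eventually_elim (simp add: Z_def)
      moreover have "limitin cemetery_top (\<lambda>s. X s \<omega>) (X r \<omega>) (at_right r)"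
        using right_continuous[of \<omega> r] that by (simp add: aug.space_F)
      ultimately have "limitin cemetery_top (\<lambda>s. Z s \<omega>) (X r \<omega>) (at_right r)" by (rule limitin_transform_eventually)
      then show ?thesis using True by (simp add: Z_def[of r])
    next
      case False
      have "\<forall>\<^sub>F s in at_right r. r < s" by (simp add: eventually_at_filter)
      then have "\<forall>\<^sub>F s in at_right r. None = Z s \<omega>" by eventually_elim (use False in \<open>auto simp: Z_def\<close>)
      moreover have "limitin cemetery_top (\<lambda>s. None) None (at_right r)" by simp
      ultimately have "limitin cemetery_top (\<lambda>s. Z s \<omega>) None (at_right r)" by (rule limitin_transform_eventually)
      then show ?thesis using False by (simp add: Z_def[of r])
    qed
  qed
  from measurable_sets[OF this SU]
  have 1: "{\<omega>\<in>space M. T \<omega> < t \<and> X (T \<omega>) \<omega> \<in> Some ` U} \<in> sets (F t)"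
  proof (rule back_subst[of "\<lambda>A. A \<in> sets (F t)"])
    show "(\<lambda>\<omega>. Z (min (T \<omega>) t) \<omega>) -` (Some ` U) \<inter> space (F t) = {\<omega>\<in>space M. T \<omega> < t \<and> X (T \<omega>) \<omega> \<in> Some ` U}"
      by (auto simp: Z_def aug.space_F min_def split: if_splits)
  qed
  have "{\<omega>\<in>space M. T \<omega> = t} \<in> sets (F t)"
    using aug.stopping_time_eq_const[OF T, of t] by (simp add: pred_def aug.space_F)
  moreover have "{\<omega>\<in>space M. X t \<omega> \<in> Some ` U} \<in> sets (F t)"
    using raw_coordinate[OF order_refl SU, of t] raw_subset_augmented by blast
  ultimately have 2: "{\<omega>\<in>space M. T \<omega> = t} \<inter> {\<omega>\<in>space M. X t \<omega> \<in> Some ` U} \<in> sets (F t)" by blast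
  have "{\<omega> \<in> {\<omega> \<in> space (aug.pre_sigma T). X (T \<omega>) \<omega> \<in> Some ` U}. T \<omega> \<le> t} =
     {\<omega>\<in>space M. T \<omega> < t \<and> X (T \<omega>) \<omega> \<in> Some ` U} \<union> ({\<omega>\<in>space M. T \<omega> = t} \<inter> {\<omega>\<in>space M. X t \<omega> \<in> Some ` U})"
    by (auto simp: aug.space_pre_sigma order_le_less)
  then show "{\<omega> \<in> {\<omega> \<in> space (aug.pre_sigma T). X (T \<omega>) \<omega> \<in> Some ` U}. T \<omega> \<le> t} \<in> sets (F t)"
    using sets.Un[OF 1 2] by (simp only:)
qed

lemma stopping_time_add_const:
  assumes T: "stopping_time F T"
  shows "stopping_time F (\<lambda>\<omega>. T \<omega> + s)"
proof
  fix t
  show "Measurable.pred (F t) (\<lambda>\<omega>. T \<omega> + s \<le> t)"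
  proof (cases "s \<le> t")
    case True
    show ?thesis
    proof (cases "t = \<infinity>")
      case False
      then have "T \<omega> + s \<le> t \<longleftrightarrow> T \<omega> \<le> t - s" for \<omega>
        using True by (metis add.commute ennreal_add_diff_cancel_right ennreal_minus_mono diff_add_self_ennreal add_right_mono top.not_eq_extremum infinity_ennreal_def le_less_trans less_irrefl order_refl)
      moreover have "Measurable.pred (F t) (\<lambda>\<omega>. T \<omega> \<le> t - s)"
        by (rule aug.stopping_time_le_const[OF T]) (rule diff_le_self_ennreal)
      ultimately show ?thesis by simp
    qed simp
  next
    case False
    then have "\<not> T \<omega> + s \<le> t" for \<omega> by (metis add.commute add_increasing2 order_trans le_iff_add)
    then show ?thesis by simp
  qed
qed

lemma pre_sigma_subset_augmented:
  assumes T: "stopping_time F T" shows "sets (aug.pre_sigma T) \<subseteq> sets (F \<infinity>)"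
proof
  fix A assume "A \<in> sets (aug.pre_sigma T)"
  from aug.sets_pre_sigmaD[OF T this, of \<infinity>] show "A \<in> sets (F \<infinity>)" by simp
qed

lemma measurable_augmented_completion: "f \<in> F t \<rightarrow>\<^sub>M N \<Longrightarrow> f \<in> C z \<rightarrow>\<^sub>M N"
  using augmented_subset_completion[of t z]
  by (rule_tac measurable_from_subalg) (auto simp: subalgebra_def aug.space_F)

lemma measurable_pre_sigma_completion:
  "stopping_time F T \<Longrightarrow> f \<in> aug.pre_sigma T \<rightarrow>\<^sub>M N \<Longrightarrow> f \<in> C z \<rightarrow>\<^sub>M N"
  using augmented_subset_completion[of \<infinity> z] pre_sigma_subset_augmented[of T]
  by (rule_tac measurable_from_subalg) (auto simp: subalgebra_def aug.space_pre_sigma)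

text \<open>The run of \<open>Markov_cylinder\<close> with all stopping times. It becomes a
  statement on the shifted path because \<open>shift\<close> holds for each single
  \<open>\<omega>\<close>, so that the random time \<open>T \<omega>\<close> may be
  inserted.\<close>

lemma strong_Markov_cylinder:
  assumes J: "finite J" "\<And>s. s \<in> J \<Longrightarrow> s < \<infinity>" and E: "\<And>s. E s \<in> sets cemetery_borel"
    and T: "stopping_time F T" and \<Lambda>: "\<Lambda> \<in> sets (aug.pre_sigma T)"
  shows "emeasure (C z) {\<omega>\<in>\<Lambda>. \<theta> (T \<omega>) \<omega> \<in> cylinder J E} =
      (\<integral>\<^sup>+\<omega>\<in>\<Lambda>. emeasure (P (X (T \<omega>) \<omega>)) (cylinder J E) \<partial>C z)"
proof -
  define adm where "adm T \<Lambda> \<longleftrightarrow> stopping_time F T \<and> \<Lambda> \<in> sets (aug.pre_sigma T)" for T \<Lambda>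
  have "(\<lambda>y. emeasure (P y) (cylinder J E)) \<in> borel_measurable cemetery_borel \<and>
    (\<forall>T \<Lambda> z. adm T \<Lambda> \<longrightarrow> emeasure (C z) {\<omega>\<in>\<Lambda>. \<forall>s\<in>J. X (T \<omega> + s) \<omega> \<in> E s} =
      (\<integral>\<^sup>+\<omega>\<in>\<Lambda>. emeasure (P (X (T \<omega>) \<omega>)) (cylinder J E) \<partial>C z))"
  proof (rule Markov_cylinder[OF _ _ _ _ _ J E])
    fix T \<Lambda> z assume a: "adm T \<Lambda>"
    show "\<Lambda> \<in> sets (C z)"
      using a pre_sigma_subset_augmented[of T] augmented_subset_completion[of \<infinity> z] unfolding adm_def by blast
    show "(\<lambda>\<omega>. X (T \<omega>) \<omega>) \<in> C z \<rightarrow>\<^sub>M cemetery_borel"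
      using a measurable_X_stopping_time[of T] unfolding adm_def by (blast intro: measurable_pre_sigma_completion)
  next
    fix T \<Lambda> and s :: ennreal and E :: "'s option set" assume a: "adm T \<Lambda>" "s < \<infinity>" "E \<in> sets cemetery_borel"
    have st: "stopping_time F (\<lambda>\<omega>. T \<omega> + s)" using a stopping_time_add_const unfolding adm_def by blast
    have \<Lambda>: "\<Lambda> \<in> sets (aug.pre_sigma (\<lambda>\<omega>. T \<omega> + s))"
      using aug.mono_pre_sigma[of T, OF _ st] a unfolding adm_def by auto
    have "\<Lambda> \<inter> ((\<lambda>\<omega>. X (T \<omega> + s) \<omega>) -` E \<inter> space (aug.pre_sigma (\<lambda>\<omega>. T \<omega> + s))) \<in> sets (aug.pre_sigma (\<lambda>\<omega>. T \<omega> + s))"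
      using \<Lambda> measurable_sets[OF measurable_X_stopping_time[OF st] a(3)] by blast
    also have "\<Lambda> \<inter> ((\<lambda>\<omega>. X (T \<omega> + s) \<omega>) -` E \<inter> space (aug.pre_sigma (\<lambda>\<omega>. T \<omega> + s))) = {\<omega>\<in>\<Lambda>. X (T \<omega> + s) \<omega> \<in> E}"
      using sets.sets_into_space[OF \<Lambda>] by auto
    finally show "adm (\<lambda>\<omega>. T \<omega> + s) {\<omega>\<in>\<Lambda>. X (T \<omega> + s) \<omega> \<in> E}"
      using st unfolding adm_def by blast
    show "emeasure (C z) {\<omega>\<in>\<Lambda>. X (T \<omega> + s) \<omega> \<in> E} =
        (\<integral>\<^sup>+\<omega>\<in>\<Lambda>. emeasure (P (X (T \<omega>) \<omega>)) {\<omega>'\<in>space M. X s \<omega>' \<in> E} \<partial>C z)" for z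
      using a unfolding adm_def by (intro strong_Markov) auto
  next
    have "stopping_time F (\<lambda>_. 0)" by (rule stopping_time_const)
    then show "adm (\<lambda>_. 0) (space M)" unfolding adm_def
      using sets.top[of "aug.pre_sigma (\<lambda>_. 0)"] by (simp add: aug.space_pre_sigma)
  qed
  then have "emeasure (C z) {\<omega>\<in>\<Lambda>. \<forall>s\<in>J. X (T \<omega> + s) \<omega> \<in> E s} =
      (\<integral>\<^sup>+\<omega>\<in>\<Lambda>. emeasure (P (X (T \<omega>) \<omega>)) (cylinder J E) \<partial>C z)"
    using T \<Lambda> unfolding adm_def by blast
  also have "{\<omega>\<in>\<Lambda>. \<forall>s\<in>J. X (T \<omega> + s) \<omega> \<in> E s} = {\<omega>\<in>\<Lambda>. \<theta> (T \<omega>) \<omega> \<in> cylinder J E}"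
    using sets.sets_into_space[OF \<Lambda>] shift_space shift
    by (auto simp: aug.space_pre_sigma cylinder_def add.commute subset_iff)
  finally show ?thesis .
qed

section \<open>The strong Markov property of the shifted path\<close>

lemma measurable_stopping_time_completion:
  "stopping_time F T \<Longrightarrow> T \<in> borel_measurable (C z)"
  by (rule measurable_pre_sigma_completion) (auto intro: aug.measurable_stopping_time_pre_sigma)

lemma measurable_shift_stopping_time:
  assumes T: "stopping_time F T"
  shows "(\<lambda>\<omega>. \<theta> (T \<omega>) \<omega>) \<in> C z \<rightarrow>\<^sub>M raw"
proof (rule measurable_sigma_sets[OF sets_raw_cylinders])
  show "cylinders \<subseteq> Pow (space M)" by (auto simp: cylinders_def cylinder_def)
  show "(\<lambda>\<omega>. \<theta> (T \<omega>) \<omega>) \<in> space (C z) \<rightarrow> space M" using shift_space by auto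
  fix A assume "A \<in> cylinders"
  then obtain J E where A: "A = cylinder J E" "finite J" "\<And>s. E s \<in> sets cemetery_borel"
    by (auto simp: cylinders_def)
  have "{\<omega>\<in>space (C z). \<forall>s\<in>J. X (T \<omega> + s) \<omega> \<in> E s} \<in> sets (C z)"
  proof (rule sets.sets_Collect_finite_All[OF _ A(2)])
    fix s :: ennreal
    have "(\<lambda>\<omega>. X (T \<omega> + s) \<omega>) \<in> C z \<rightarrow>\<^sub>M cemetery_borel"
      by (rule measurable_X_random_time[of "\<lambda>\<omega>. \<omega>" _ z])
         (auto intro!: borel_measurable_add measurable_stopping_time_completion[OF T])
    from measurable_sets[OF this A(3)[of s]] show "{\<omega>\<in>space (C z). X (T \<omega> + s) \<omega> \<in> E s} \<in> sets (C z)"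
      by (simp add: vimage_def Int_def conj_commute)
  qed
  also have "{\<omega>\<in>space (C z). \<forall>s\<in>J. X (T \<omega> + s) \<omega> \<in> E s} = (\<lambda>\<omega>. \<theta> (T \<omega>) \<omega>) -` A \<inter> space (C z)"
    using shift_space shift by (auto simp: A cylinder_def add.commute)
  finally show "(\<lambda>\<omega>. \<theta> (T \<omega>) \<omega>) -` A \<inter> space (C z) \<in> sets (C z)" .
qed

lemma nn_integral_path_law: "f \<in> borel_measurable raw \<Longrightarrow> (\<integral>\<^sup>+\<omega>. f \<omega> \<partial>path_law y) = (\<integral>\<^sup>+\<omega>. f \<omega> \<partial>P y)"
  unfolding path_law_def by (subst nn_integral_distr[OF id_raw]) auto

lemma measurable_nn_integral_raw:
  assumes f: "f \<in> borel_measurable raw"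
  shows "(\<lambda>y. \<integral>\<^sup>+\<omega>. f \<omega> \<partial>P y) \<in> borel_measurable cemetery_borel"
  using nn_integral_measurable_subprob_algebra2[OF _ measurable_path_law, of "\<lambda>_. f"] f
  by (simp add: nn_integral_path_law[OF f] split_def)

text \<open>For an indicator \<open>W\<close> this is \<open>nn_integral_kernel\<close> with the
  shifted path and the path laws. The general case follows since both sides are linear in
  \<open>W\<close> and compatible with increasing limits.\<close>

lemma strong_Markov_raw:
  assumes T: "stopping_time F T"
    and G: "G \<in> borel_measurable raw" and W: "W \<in> borel_measurable (aug.pre_sigma T)"
  shows "(\<integral>\<^sup>+\<omega>. W \<omega> * G (\<theta> (T \<omega>) \<omega>) \<partial>C z) = (\<integral>\<^sup>+\<omega>. W \<omega> * (\<integral>\<^sup>+\<omega>'. G \<omega>' \<partial>P (X (T \<omega>) \<omega>)) \<partial>C z)"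
proof -
  have mG: "(\<lambda>\<omega>. G (\<theta> (T \<omega>) \<omega>)) \<in> borel_measurable (C z)"
    by (rule measurable_compose[OF measurable_shift_stopping_time[OF T] G])
  have XC: "(\<lambda>\<omega>. X (T \<omega>) \<omega>) \<in> C z \<rightarrow>\<^sub>M cemetery_borel"
    by (rule measurable_pre_sigma_completion[OF T measurable_X_stopping_time[OF T]])
  have mP: "(\<lambda>\<omega>. \<integral>\<^sup>+\<omega>'. G \<omega>' \<partial>P (X (T \<omega>) \<omega>)) \<in> borel_measurable (C z)"
    by (rule measurable_compose[OF XC measurable_nn_integral_raw[OF G]])
  note mW = measurable_pre_sigma_completion[OF T]
  show ?thesis using W
  proof (induction rule: borel_measurable_induct)
    case (cong f g)
    then have "f \<omega> = g \<omega>" if "\<omega> \<in> space (C z)" for \<omega> using that by (simp add: aug.space_pre_sigma)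
    then have "(\<integral>\<^sup>+\<omega>. f \<omega> * H \<omega> \<partial>C z) = (\<integral>\<^sup>+\<omega>. g \<omega> * H \<omega> \<partial>C z)" for H
      by (intro nn_integral_cong) simp
    then show ?case using cong(4) by simp
  next
    case (set \<Lambda>)
    have \<Lambda>: "\<Lambda> \<in> sets (C z)"
      using set pre_sigma_subset_augmented[OF T] augmented_subset_completion[of \<infinity> z] by blast
    have "(\<integral>\<^sup>+\<omega>\<in>\<Lambda>. G (\<theta> (T \<omega>) \<omega>) \<partial>C z) = (\<integral>\<^sup>+\<omega>\<in>\<Lambda>. (\<integral>\<^sup>+\<omega>'. G \<omega>' \<partial>path_law (X (T \<omega>) \<omega>)) \<partial>C z)"
    proof (rule nn_integral_kernel[OF _ \<Lambda> XC measurable_shift_stopping_time[OF T] measurable_path_law _ Int_stable_cylinders _ _ _ G])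
      show "finite_measure (C z)" using prob_space_completion by (rule prob_space.finite_measure)
      show "sets raw = sigma_sets (space raw) cylinders" unfolding space_raw_filtration by (rule sets_raw_cylinders)
      show "space raw \<in> cylinders" unfolding space_raw_filtration by (rule space_cylinders)
      fix A assume "A \<in> cylinders"
      then obtain J E where A: "A = cylinder J E" "finite J" "\<And>s. s \<in> J \<Longrightarrow> s < \<infinity>" "\<And>s. E s \<in> sets cemetery_borel"
        by (auto simp: cylinders_def)
      have Ar: "A \<in> sets raw" using \<open>A \<in> cylinders\<close> cylinders_subset_raw by blast
      show "emeasure (C z) {\<omega>\<in>\<Lambda>. \<theta> (T \<omega>) \<omega> \<in> A} = (\<integral>\<^sup>+\<omega>\<in>\<Lambda>. emeasure (path_law (X (T \<omega>) \<omega>)) A \<partial>C z)"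
        unfolding emeasure_path_law[OF Ar] unfolding A(1) by (rule strong_Markov_cylinder[OF A(2-4) T set])
    qed simp
    then show ?case by (simp add: nn_integral_path_law[OF G] mult.commute)
  next
    case (mult u c)
    have "(\<integral>\<^sup>+\<omega>. c * u \<omega> * H \<omega> \<partial>C z) = c * (\<integral>\<^sup>+\<omega>. u \<omega> * H \<omega> \<partial>C z)"
      if "H \<in> borel_measurable (C z)" for H
      unfolding mult.assoc by (rule nn_integral_cmult) (intro borel_measurable_times_ennreal mW[OF mult(2)] that)
    from this[OF mG] this[OF mP] mult(4) show ?case by simp
  next
    case (add u v)
    have "(\<integral>\<^sup>+\<omega>. (v \<omega> + u \<omega>) * H \<omega> \<partial>C z) = (\<integral>\<^sup>+\<omega>. v \<omega> * H \<omega> \<partial>C z) + (\<integral>\<^sup>+\<omega>. u \<omega> * H \<omega> \<partial>C z)"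
      if "H \<in> borel_measurable (C z)" for H
      unfolding distrib_right
      by (rule nn_integral_add) (intro borel_measurable_times_ennreal mW[OF add(1)] mW[OF add(3)] that)+
    from this[OF mG] this[OF mP] add show ?case by simp
  next
    case (seq U)
    have sup: "(\<integral>\<^sup>+\<omega>. (SUP i. U i) \<omega> * H \<omega> \<partial>C z) = (SUP i. \<integral>\<^sup>+\<omega>. U i \<omega> * H \<omega> \<partial>C z)"
      if "H \<in> borel_measurable (C z)" for H
    proof -
      have "(\<integral>\<^sup>+\<omega>. (SUP i. U i) \<omega> * H \<omega> \<partial>C z) = (\<integral>\<^sup>+\<omega>. (SUP i. U i \<omega> * H \<omega>) \<partial>C z)"
        by (simp add: SUP_mult_right_ennreal image_comp)
      also have "\<dots> = (SUP i. \<integral>\<^sup>+\<omega>. U i \<omega> * H \<omega> \<partial>C z)"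
      proof (rule nn_integral_monotone_convergence_SUP)
        show "incseq (\<lambda>i \<omega>. U i \<omega> * H \<omega>)"
          using seq(3) by (auto simp: incseq_def le_fun_def intro!: mult_right_mono)
        show "(\<lambda>\<omega>. U i \<omega> * H \<omega>) \<in> borel_measurable (C z)" for i
          by (intro borel_measurable_times_ennreal mW[OF seq(1)] that)
      qed
      finally show ?thesis .
    qed
    show ?case unfolding sup[OF mG] sup[OF mP] using seq by simp
  qed
qed

text \<open>Let \<open>\<nu>\<close> be the law of the process at \<open>T\<close>. Under the path
  law with initial distribution \<open>\<nu>\<close>, \<open>G\<close> agrees with a raw function
  \<open>G'\<close> off a raw null set \<open>N\<close>; it remains to see that \<open>N\<close> is
  negligible both for the shifted path and for almost every law of the process restarted at
  \<open>T\<close>.\<close>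

theorem strong_Markov_functional:
  assumes T: "stopping_time F T"
    and G: "G \<in> borel_measurable (F \<infinity>)" and W: "W \<in> borel_measurable (aug.pre_sigma T)"
  shows "(\<integral>\<^sup>+\<omega>. W \<omega> * G (\<theta> (T \<omega>) \<omega>) \<partial>C z) = (\<integral>\<^sup>+\<omega>. W \<omega> * (\<integral>\<^sup>+\<omega>'. G \<omega>' \<partial>C (X (T \<omega>) \<omega>)) \<partial>C z)"
proof -
  interpret prob_space "C z" by (rule prob_space_completion)
  have XC: "(\<lambda>\<omega>. X (T \<omega>) \<omega>) \<in> C z \<rightarrow>\<^sub>M cemetery_borel"
    by (rule measurable_pre_sigma_completion[OF T measurable_X_stopping_time[OF T]])
  define \<nu> where "\<nu> = distr (C z) cemetery_borel (\<lambda>\<omega>. X (T \<omega>) \<omega>)"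
  have \<nu>: "prob_space \<nu>" "sets \<nu> = sets cemetery_borel"
    unfolding \<nu>_def by (auto intro: prob_space_distr XC)
  have k: "path_law \<in> \<nu> \<rightarrow>\<^sub>M subprob_algebra raw"
    using measurable_path_law by (simp add: measurable_cong_sets[OF \<nu>(2) refl])
  have ne: "space \<nu> \<noteq> {}" using prob_space.not_empty[OF \<nu>(1)] .
  have s: "sets (\<nu> \<bind> path_law) = sets raw" using ne by (subst sets_bind[of _ _ raw]) auto
  have sp: "space (\<nu> \<bind> path_law) = space M" using sets_eq_imp_space_eq[OF s] by simp
  have "G \<in> borel_measurable (completion (\<nu> \<bind> path_law))"
    by (rule measurable_from_subalg[OF _ G])
       (simp add: subalgebra_def aug.space_F sp augmented_subset_completion_bind[OF \<nu>])
  from completion_ex_borel_measurable[OF this] obtain G' where G': "G' \<in> borel_measurable (\<nu> \<bind> path_law)"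
    "AE \<omega> in \<nu> \<bind> path_law. G \<omega> = G' \<omega>" by auto
  have G'r: "G' \<in> borel_measurable raw" using G'(1) by (simp add: measurable_cong_sets[OF s refl])
  obtain N where N: "N \<in> null_sets (\<nu> \<bind> path_law)" "{\<omega>\<in>space M. G \<omega> \<noteq> G' \<omega>} \<subseteq> N"
    using G'(2) unfolding eventually_ae_filter sp by auto
  have Nr: "N \<in> sets raw" using N(1) s by auto
  have "(\<integral>\<^sup>+y. emeasure (path_law y) N \<partial>\<nu>) = 0"
    using N(1) emeasure_bind[OF ne k Nr] by (simp add: null_sets_def)
  then have "AE y in \<nu>. emeasure (path_law y) N = 0"
    by (subst (asm) nn_integral_0_iff_AE) (auto intro!: measurable_compose[OF k] measurable_emeasure_subprob_algebra Nr)
  from AE_distrD[OF XC this[unfolded \<nu>_def]]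
  have AE2: "AE \<omega> in C z. emeasure (path_law (X (T \<omega>) \<omega>)) N = 0" .
  \<comment> \<open>Restarted laws almost surely give \<open>N\<close> no mass. Applied to the
    indicator of \<open>N\<close>, the raw strong Markov property then shows that the shifted path
    almost surely avoids \<open>N\<close>.\<close>
  have N_emeasure: "(\<integral>\<^sup>+\<omega>'. indicator N \<omega>' \<partial>P y) = emeasure (path_law y) N" for y
    using Nr raw_subset_M sets_P[of y] by (subst nn_integral_indicator) (auto simp: emeasure_path_law[OF Nr])
  have "(\<integral>\<^sup>+\<omega>. 1 * indicator N (\<theta> (T \<omega>) \<omega>) \<partial>C z) = (\<integral>\<^sup>+\<omega>. 1 * (\<integral>\<^sup>+\<omega>'. indicator N \<omega>' \<partial>P (X (T \<omega>) \<omega>)) \<partial>C z)"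
    by (rule strong_Markov_raw[OF T]) (use Nr in auto)
  also have "\<dots> = (\<integral>\<^sup>+\<omega>. 0 \<partial>C z)"
    by (rule nn_integral_cong_AE, use AE2 in eventually_elim) (simp add: N_emeasure)
  finally have N0: "(\<integral>\<^sup>+\<omega>. indicator N (\<theta> (T \<omega>) \<omega>) \<partial>C z) = 0" by simp
  have "(\<lambda>\<omega>. indicator N (\<theta> (T \<omega>) \<omega>) :: ennreal) \<in> borel_measurable (C z)"
    by (rule measurable_compose[OF measurable_shift_stopping_time[OF T] borel_measurable_indicator[OF Nr]])
  from N0[unfolded nn_integral_0_iff_AE[OF this]]
  have "AE \<omega> in C z. indicator N (\<theta> (T \<omega>) \<omega>) = (0 :: ennreal)" .
  then have AE1: "AE \<omega> in C z. G (\<theta> (T \<omega>) \<omega>) = G' (\<theta> (T \<omega>) \<omega>)"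
    by (elim AE_mp, intro AE_I2) (use N(2) shift_space in \<open>auto simp: indicator_eq_0_iff subset_iff\<close>)
  have "(\<integral>\<^sup>+\<omega>. W \<omega> * G (\<theta> (T \<omega>) \<omega>) \<partial>C z) = (\<integral>\<^sup>+\<omega>. W \<omega> * G' (\<theta> (T \<omega>) \<omega>) \<partial>C z)"
    by (rule nn_integral_cong_AE) (use AE1 in auto)
  also have "\<dots> = (\<integral>\<^sup>+\<omega>. W \<omega> * (\<integral>\<^sup>+\<omega>'. G' \<omega>' \<partial>P (X (T \<omega>) \<omega>)) \<partial>C z)"
    by (rule strong_Markov_raw[OF T G'r W])
  also have "\<dots> = (\<integral>\<^sup>+\<omega>. W \<omega> * (\<integral>\<^sup>+\<omega>'. G \<omega>' \<partial>C (X (T \<omega>) \<omega>)) \<partial>C z)"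
  proof (rule nn_integral_cong_AE)
    show "AE \<omega> in C z. W \<omega> * (\<integral>\<^sup>+\<omega>'. G' \<omega>' \<partial>P (X (T \<omega>) \<omega>)) = W \<omega> * (\<integral>\<^sup>+\<omega>'. G \<omega>' \<partial>C (X (T \<omega>) \<omega>))"
      using AE2
    proof eventually_elim
      case (elim \<omega>)
      have "N \<in> sets M" using Nr raw_subset_M by auto
      then have "N \<in> null_sets (P (X (T \<omega>) \<omega>))"
        using elim by (auto simp: emeasure_path_law[OF Nr] sets_P)
      then have "AE \<omega>' in P (X (T \<omega>) \<omega>). G' \<omega>' = G \<omega>'"
        by (rule AE_I') (use N(2) in auto)
      then have "(\<integral>\<^sup>+\<omega>'. G' \<omega>' \<partial>P (X (T \<omega>) \<omega>)) = (\<integral>\<^sup>+\<omega>'. G \<omega>' \<partial>P (X (T \<omega>) \<omega>))"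
        by (rule nn_integral_cong_AE)
      then show ?case by (simp add: nn_integral_completion)
    qed
  qed
  finally show ?thesis .
qed

end

section \<open>Right inverses of continuous increasing functions\<close>

text \<open>The value 0 at infinity removes the levels that an increasing function never
  reaches.\<close>

definition exp_neg :: "ennreal \<Rightarrow> ennreal" where
  "exp_neg t = (if t = \<infinity> then 0 else ennreal (exp (- enn2real t)))"

text \<open>
  The infimum runs over rational times so that the right inverse of a PCAF is a stopping time on the
  whole sample space, not only on a defining set.
\<close>

definition inverse_time :: "(real \<Rightarrow> ennreal) \<Rightarrow> real \<Rightarrow> ennreal" where
  "inverse_time a r = (INF q\<in>\<rat> \<inter> {0..}. if ennreal r < a q then ennreal q else \<infinity>)"

text \<open>After the substitution s = \<open>inverse_time a r\<close> this is the integral of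
  exp(-s) da(s) over s < t. In Lebesgue form it makes sense for every function \<open>a\<close>, and
  joint measurability in the sample point is accessible.\<close>

definition discounted :: "(real \<Rightarrow> ennreal) \<Rightarrow> ennreal \<Rightarrow> ennreal" where
  "discounted a t = (\<integral>\<^sup>+r\<in>{0<..}. exp_neg (inverse_time a r) * indicator {..<t} (inverse_time a r) \<partial>lborel)"

lemma exp_neg_ennreal [simp]: "t \<ge> 0 \<Longrightarrow> exp_neg (ennreal t) = ennreal (exp (- t))"
  by (simp add: exp_neg_def)

lemma exp_neg_top [simp]: "exp_neg \<infinity> = 0" "exp_neg top = 0"
  by (simp_all add: exp_neg_def)

lemma exp_neg_add: "exp_neg (s + t) = exp_neg s * exp_neg t"
  by (cases s; cases t) (auto simp flip: ennreal_plus ennreal_mult exp_add)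

lemma borel_measurable_exp_neg [measurable]: "exp_neg \<in> borel_measurable borel"
  unfolding exp_neg_def by measurable

lemma measurable_inverse_time:
  assumes A: "\<And>q. q \<ge> 0 \<Longrightarrow> A q \<in> borel_measurable N" and g: "g \<in> borel_measurable N"
  shows "(\<lambda>n. inverse_time (\<lambda>t. A t n) (g n)) \<in> borel_measurable N"
  unfolding inverse_time_def
proof (rule borel_measurable_INF)
  show "countable (\<rat> \<inter> {0..} :: real set)" by (simp add: countable_rat)
  fix q :: real assume "q \<in> \<rat> \<inter> {0..}"
  then have [measurable]: "A q \<in> borel_measurable N" using A by simp
  note [measurable] = g
  show "(\<lambda>n. if ennreal (g n) < A q n then ennreal q else \<infinity>) \<in> borel_measurable N" by measurable
qed

lemma borel_measurable_inverse_time [measurable]: "inverse_time a \<in> borel_measurable borel"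
  using measurable_inverse_time[of "\<lambda>q _. a q" borel "\<lambda>r. r"] by simp

locale clock =
  fixes a :: "real \<Rightarrow> ennreal"
  assumes cont: "continuous_on {0..} a" and mono: "0 \<le> s \<Longrightarrow> s \<le> t \<Longrightarrow> a s \<le> a t" and zero: "a 0 = 0"
begin

text \<open>If \<open>a\<close> exceeds \<open>r\<close> at \<open>q\<close>, then by continuity it
  does so at a rational time slightly before \<open>q\<close>; this yields the strict inequality
  although the right inverse is an infimum.\<close>

lemma inverse_time_less_iff:
  assumes "0 \<le> q" "0 \<le> r"
  shows "inverse_time a r < ennreal q \<longleftrightarrow> ennreal r < a q"
proof
  assume "inverse_time a r < ennreal q"
  then obtain q' where q': "q' \<in> \<rat>" "0 \<le> q'" "(if ennreal r < a q' then ennreal q' else \<infinity>) < ennreal q"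
    unfolding inverse_time_def INF_less_iff by auto
  then have "ennreal r < a q'" "q' < q" by (auto simp: ennreal_less_iff split: if_splits)
  then show "ennreal r < a q" using mono[of q' q] q'(2) by (auto intro: less_le_trans)
next
  assume r: "ennreal r < a q"
  with zero have "q \<noteq> 0" by auto
  with assms have q: "0 < q" by simp
  have "open {ennreal r<..}" by simp
  then obtain U where U: "open U" "U \<inter> {0..} = a -` {ennreal r<..} \<inter> {0..}"
    using cont unfolding continuous_on_open_invariant by blast
  then have "q \<in> U" using r assms by auto
  then obtain e where e: "e > 0" "\<And>x. dist x q < e \<Longrightarrow> x \<in> U" using U(1) unfolding open_dist by blast
  have "max 0 (q - e) < q" using q e by auto
  then obtain q' where q': "q' \<in> \<rat>" "max 0 (q - e) < q'" "q' < q" using Rats_dense_in_real by blast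
  then have "q' \<in> U \<inter> {0..}" using e(2)[of q'] by (auto simp: dist_real_def)
  then have "ennreal r < a q'" using U(2) by auto
  then have "inverse_time a r \<le> ennreal q'"
    unfolding inverse_time_def using q' by (intro INF_lower2[of q']) auto
  also have "\<dots> < ennreal q" using q' by (simp add: ennreal_less_iff)
  finally show "inverse_time a r < ennreal q" .
qed

text \<open>By continuity \<open>a\<close> stays below \<open>r\<close> for a while after
  \<open>s\<close>. Only the level \<open>r = a s\<close> is left undecided by this lemma and the
  previous one, and a single level is Lebesgue null.\<close>

lemma less_inverse_time:
  assumes s: "0 \<le> s" and r: "a s < ennreal r"
  shows "ennreal s < inverse_time a r"
proof -
  have r0: "0 \<le> r" using r by (cases "r \<ge> 0") (auto simp: ennreal_neg)
  have "open {..<ennreal r}" by simp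
  then obtain U where U: "open U" "U \<inter> {0..} = a -` {..<ennreal r} \<inter> {0..}"
    using cont unfolding continuous_on_open_invariant by blast
  then have "s \<in> U" using r s by auto
  then obtain e where e: "e > 0" "\<And>x. dist x s < e \<Longrightarrow> x \<in> U" using U(1) unfolding open_dist by blast
  have "s + e/2 \<in> U \<inter> {0..}" using e(1) s by (auto intro!: e(2) simp: dist_real_def)
  then have "a (s + e/2) < ennreal r" using U(2) by auto
  then have "\<not> inverse_time a r < ennreal (s + e/2)"
    using inverse_time_less_iff[of "s + e/2" r] s e r0 by auto
  moreover have "ennreal s < ennreal (s + e/2)" using s e by (simp add: ennreal_less_iff)
  ultimately show ?thesis by (meson not_le less_le_trans)
qed

text \<open>A Stieltjes measure is the image of Lebesgue measure on the levels under the right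
  inverse. Levels never reached must be left out of \<open>S\<close>, since \<open>enn2real\<close>
  sends infinity to 0 and would create an atom there.\<close>

lemma interval_measure_eq:
  fixes n :: nat
  defines "Fn \<equiv> \<lambda>t. enn2real (min (a (max 0 t)) (of_nat n))"
    and "S \<equiv> {r. 0 < r \<and> r < real n \<and> inverse_time a r < \<infinity>}"
  shows "interval_measure Fn = distr (density lborel (indicator S)) borel (\<lambda>r. enn2real (inverse_time a r))"
proof -
  have S [measurable]: "S \<in> sets borel" unfolding S_def by measurable
  have fin: "min (a (max 0 t)) (of_nat n) < \<infinity>" for t
    by (metis ennreal_of_nat_neq_top infinity_ennreal_def less_top min.strict_coboundedI2)
  have Fn_ennreal: "ennreal (Fn t) = min (a (max 0 t)) (of_nat n)" for t
    using fin[of t] by (simp add: Fn_def less_top[symmetric])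
  have Fmono: "Fn s \<le> Fn t" if "s \<le> t" for s t
    unfolding Fn_def using that fin[of t] mono[of "max 0 s" "max 0 t"] by (intro enn2real_mono) (auto simp: min_le_iff_disj)
  have F0: "0 \<le> Fn t" for t by (simp add: Fn_def)
  have "continuous_on UNIV (\<lambda>t. min (a (max 0 t)) (of_nat n :: ennreal))"
    by (intro continuous_intros continuous_on_compose2[OF cont]) auto
  then have "isCont (\<lambda>t. min (a (max 0 t)) (of_nat n :: ennreal)) t" for t
    by (simp add: continuous_on_eq_continuous_at)
  then have "isCont Fn t" for t
    unfolding Fn_def isCont_def using fin[of t] by (intro tendsto_enn2real) auto
  then have Fcont: "continuous (at_right t) Fn" for t
    by (rule continuous_at_imp_continuous_at_within)
  \<comment> \<open>The levels whose inverse lies in the interval from \<open>s\<close> to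
    \<open>t\<close> are squeezed between the open and the closed interval from \<open>Fn s\<close>
    to \<open>Fn t\<close>, which have the same length; the endpoints need not be decided.\<close>
  have key: "emeasure lborel {r\<in>S. s < enn2real (inverse_time a r) \<and> enn2real (inverse_time a r) \<le> t} = ennreal (Fn t - Fn s)"
    (is "emeasure lborel ?B = _") if st: "s \<le> t" for s t
  proof (cases "t < 0")
    case True
    then have e: "?B = {}" by (auto simp: not_le intro: less_le_trans[OF _ enn2real_nonneg])
    show ?thesis unfolding e using True st by (simp add: Fn_def)
  next
    case False
    then have t: "0 \<le> t" by simp
    have 1: "{Fn s<..<Fn t} \<subseteq> ?B"
    proof
      fix r assume r: "r \<in> {Fn s<..<Fn t}"
      then have r0: "0 < r" using F0[of s] by simp
      have "ennreal r < ennreal (Fn t)" using r r0 by (simp add: ennreal_less_iff)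
      then have rt: "ennreal r < a t" "ennreal r < of_nat n" using t by (auto simp: Fn_ennreal)
      then have "r < real n" using r0 by (simp add: ennreal_of_nat_eq_real_of_nat ennreal_less_iff)
      have lt: "inverse_time a r < ennreal t" using rt inverse_time_less_iff t r0 by simp
      then have fi: "inverse_time a r < \<infinity>" by (metis ennreal_less_top infinity_ennreal_def less_trans)
      have e: "ennreal (enn2real (inverse_time a r)) = inverse_time a r" using fi by simp
      have "s < enn2real (inverse_time a r)"
      proof (cases "s < 0")
        case False
        have "ennreal (Fn s) < ennreal r" using r F0 by (simp add: ennreal_less_iff)
        then have "a s < ennreal r" using False rt(2) by (auto simp: Fn_ennreal min_less_iff_disj)
        then have "ennreal s < inverse_time a r" using less_inverse_time False by simp
        then show ?thesis using e False by (metis ennreal_less_iff not_le)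
      qed (auto intro: less_le_trans[OF _ enn2real_nonneg])
      moreover have "enn2real (inverse_time a r) \<le> t"
        using lt by (simp add: enn2real_leI less_imp_le t)
      ultimately show "r \<in> ?B" using r0 \<open>r < real n\<close> fi by (simp add: S_def)
    qed
    have 2: "?B \<subseteq> {Fn s..Fn t}"
    proof
      fix r assume r: "r \<in> ?B"
      then have r0: "0 < r" "r < real n" "inverse_time a r < \<infinity>" by (auto simp: S_def)
      have e: "ennreal (enn2real (inverse_time a r)) = inverse_time a r" using r0 by simp
      have "inverse_time a r \<le> ennreal t" using r e by (metis (mono_tags, lifting) ennreal_leI mem_Collect_eq)
      then have "ennreal r \<le> a t" using less_inverse_time[OF t, of r] by (meson not_le)
      moreover have "ennreal r \<le> of_nat n" using r0 by (simp add: ennreal_of_nat_eq_real_of_nat ennreal_leI)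
      ultimately have "ennreal r \<le> ennreal (Fn t)" using t by (simp add: Fn_ennreal)
      then have "r \<le> Fn t" using F0 by (simp add: ennreal_le_iff)
      moreover have "Fn s \<le> r"
      proof (cases "s < 0")
        case True
        then have "Fn s = 0" by (simp add: Fn_def zero)
        then show ?thesis using r0 by simp
      next
        case False
        have "\<not> inverse_time a r < ennreal s"
          using r e False by (metis (no_types, lifting) ennreal_less_iff enn2real_nonneg less_asym mem_Collect_eq)
        then have "\<not> ennreal r < a s" using inverse_time_less_iff[of s r] False r0 by simp
        then have "ennreal (Fn s) \<le> ennreal r" using False by (auto simp: Fn_ennreal min_le_iff_disj)
        then show ?thesis using r0 by (simp add: ennreal_le_iff)
      qed
      ultimately show "r \<in> {Fn s..Fn t}" by simp
    qed
    have B: "?B \<in> sets lborel" by measurable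
    have "emeasure lborel {Fn s<..<Fn t} \<le> emeasure lborel ?B" by (rule emeasure_mono[OF 1 B])
    moreover have "emeasure lborel ?B \<le> emeasure lborel {Fn s..Fn t}" by (rule emeasure_mono[OF 2]) simp
    ultimately show ?thesis using Fmono[OF st] by (simp add: antisym)
  qed
  let ?E = "range (\<lambda>(a, b). {a<..b::real})"
  show ?thesis
  proof (rule measure_eqI_generator_eq[where E="?E" and \<Omega>=UNIV and A="\<lambda>i. {- real i<..real i}"])
    show "Int_stable ?E"
    proof (rule Int_stableI)
      fix A B assume "A \<in> ?E" "B \<in> ?E"
      then obtain a b c d where "A = {a<..b}" "B = {c<..d}" by auto
      then have "A \<inter> B = (\<lambda>(a, b). {a<..b}) (max a c, min b d)" by auto
      then show "A \<inter> B \<in> ?E" by blast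
    qed
    show "sets (interval_measure Fn) = sigma_sets UNIV ?E"
      by (simp add: borel_sigma_sets_Ioc)
    show "sets (distr (density lborel (indicator S)) borel (\<lambda>r. enn2real (inverse_time a r))) = sigma_sets UNIV ?E"
      by (simp add: borel_sigma_sets_Ioc)
    show "range (\<lambda>i. {- real i<..real i}) \<subseteq> ?E" by auto
    show "(\<Union>i. {- real i<..real i}) = UNIV"
    proof (safe; simp)
      fix x :: real
      obtain i where "\<bar>x\<bar> < real i" using reals_Archimedean2 by blast
      then show "\<exists>i. - real i < x \<and> x \<le> real i" by (intro exI[of _ i]) auto
    qed
    show "emeasure (interval_measure Fn) {- real i<..real i} \<noteq> \<infinity>" for i
      by (subst emeasure_interval_measure_Ioc[OF _ Fmono Fcont]) auto
    fix A assume "A \<in> ?E"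
    then obtain s t where A: "A = {s<..t}" by auto
    have "emeasure (distr (density lborel (indicator S)) borel (\<lambda>r. enn2real (inverse_time a r))) A =
      emeasure (density lborel (indicator S)) {r. s < enn2real (inverse_time a r) \<and> enn2real (inverse_time a r) \<le> t}"
      unfolding A by (subst emeasure_distr) (auto intro!: arg_cong2[where f=emeasure])
    also have "\<dots> = emeasure lborel {r\<in>S. s < enn2real (inverse_time a r) \<and> enn2real (inverse_time a r) \<le> t}"
    proof -
      have "(\<integral>\<^sup>+ x. indicator S x * indicator {r. s < enn2real (inverse_time a r) \<and> enn2real (inverse_time a r) \<le> t} x \<partial>lborel)
        = (\<integral>\<^sup>+ x. indicator {r\<in>S. s < enn2real (inverse_time a r) \<and> enn2real (inverse_time a r) \<le> t} x \<partial>lborel)"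
        by (intro nn_integral_cong) (auto split: split_indicator)
      then show ?thesis by (subst emeasure_density) auto
    qed
    also have "\<dots> = emeasure (interval_measure Fn) A"
    proof (cases "s \<le> t")
      case True
      then show ?thesis unfolding A key[OF True] by (subst emeasure_interval_measure_Ioc[OF _ Fmono Fcont]) auto
    next
      case False
      then have e: "{r\<in>S. s < enn2real (inverse_time a r) \<and> enn2real (inverse_time a r) \<le> t} = {}" "A = {}" by (auto simp: A)
      show ?thesis unfolding e by simp
    qed
    finally show "emeasure (interval_measure Fn) A =
        emeasure (distr (density lborel (indicator S)) borel (\<lambda>r. enn2real (inverse_time a r))) A" ..
  qed auto
qed

text \<open>Truncation of \<open>a\<close> at n corresponds to truncation of the levels at n, so the
  supremum in the definition is a monotone limit of integrals over the increasing sets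
  \<open>S n\<close>.\<close>

lemma Stieltjes_integral_eq:
  assumes g [measurable]: "g \<in> borel_measurable borel"
  shows "Stieltjes_integral g a =
    (\<integral>\<^sup>+r\<in>{0<..}. (if inverse_time a r < \<infinity> then g (enn2real (inverse_time a r)) else 0) \<partial>lborel)"
proof -
  define S where "S n = {r. 0 < r \<and> r < real n \<and> inverse_time a r < \<infinity>}" for n :: nat
  have S [measurable]: "S n \<in> sets borel" for n unfolding S_def by measurable
  have "(\<integral>\<^sup>+t\<in>{0..}. g t \<partial>interval_measure (\<lambda>t. enn2real (min (a (max 0 t)) (of_nat n))))
      = (\<integral>\<^sup>+r. g (enn2real (inverse_time a r)) * indicator (S n) r \<partial>lborel)" for n
    unfolding interval_measure_eq S_def[symmetric]
    by (simp add: nn_integral_distr nn_integral_density mult.commute)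
  then have "Stieltjes_integral g a = (SUP n. \<integral>\<^sup>+r. g (enn2real (inverse_time a r)) * indicator (S n) r \<partial>lborel)"
    unfolding Stieltjes_integral_def by simp
  also have "\<dots> = (\<integral>\<^sup>+r. (SUP n. g (enn2real (inverse_time a r)) * indicator (S n) r) \<partial>lborel)"
    by (rule nn_integral_monotone_convergence_SUP[symmetric])
       (auto simp: incseq_def le_fun_def S_def intro!: mult_left_mono split: split_indicator)
  also have "\<dots> = (\<integral>\<^sup>+r\<in>{0<..}. (if inverse_time a r < \<infinity> then g (enn2real (inverse_time a r)) else 0) \<partial>lborel)"
  proof (rule nn_integral_cong)
    fix r :: real
    have "(SUP n. g (enn2real (inverse_time a r)) * indicator (S n) r) =
       g (enn2real (inverse_time a r)) * (SUP n. indicator (S n) r)"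
      by (simp add: SUP_mult_left_ennreal)
    also have "(SUP n. indicator (S n) r :: ennreal) = (if 0 < r \<and> inverse_time a r < \<infinity> then 1 else 0)"
    proof (cases "0 < r \<and> inverse_time a r < \<infinity>")
      case True
      obtain n where "r < real n" using reals_Archimedean2 by blast
      then have "indicator (S n) r = (1::ennreal)" using True by (simp add: S_def)
      then have "1 \<le> (SUP n. indicator (S n) r :: ennreal)" by (metis SUP_upper UNIV_I)
      moreover have "(SUP n. indicator (S n) r :: ennreal) \<le> 1" by (intro SUP_least) (auto split: split_indicator)
      ultimately have "(SUP n. indicator (S n) r :: ennreal) = 1" by (intro antisym)
      then show ?thesis unfolding if_P[OF True] .
    qed (auto simp: S_def indicator_def)
    finally show "(SUP n. g (enn2real (inverse_time a r)) * indicator (S n) r) =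
       (if inverse_time a r < \<infinity> then g (enn2real (inverse_time a r)) else 0) * indicator {0<..} r" by (auto split: split_indicator)
  qed
  finally show ?thesis .
qed

end

section \<open>Discounted mass: integration by parts and splitting at a time\<close>

lemma ennreal_eq_if_less_iff:
  fixes x y :: ennreal
  assumes "\<And>q. 0 \<le> q \<Longrightarrow> x < ennreal q \<longleftrightarrow> y < ennreal q"
  shows "x = y"
proof -
  have "\<not> u < v" if "\<And>q. 0 \<le> q \<Longrightarrow> u < ennreal q \<longleftrightarrow> v < ennreal q" for u v :: ennreal
  proof
    assume "u < v"
    then obtain w where w: "u < w" "w < v" using dense by blast
    then have "w < top" using top.not_eq_extremum by fastforce
    then have "w = ennreal (enn2real w)" by simp
    then show False using that[of "enn2real w"] w by (metis enn2real_nonneg less_asym)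
  qed
  from this[of x y] this[of y x] assms show ?thesis by (meson linorder_neqE)
qed

lemma exp_neg_not_finite [simp]: "\<not> x < top \<Longrightarrow> exp_neg x = 0"
  by (metis exp_neg_top(2) top.not_eq_extremum)

lemma discounted_top: "discounted a \<infinity> = (\<integral>\<^sup>+r\<in>{0<..}. exp_neg (inverse_time a r) \<partial>lborel)"
  unfolding discounted_def
  by (intro nn_integral_cong) (auto split: split_indicator)

text \<open>Pointwise form of integration by parts: exp(-x) = exp(-t) plus the integral of exp(-q)
  over q from x to t. Only indicators of sublevel sets of x remain, and these are easily integrated
  over the levels.\<close>

lemma nn_integral_exp_tail:
  assumes t: "0 \<le> t"
  shows "exp_neg x * indicator {..<ennreal t} x =
    ennreal (exp (- t)) * indicator {..<ennreal t} x +
    (\<integral>\<^sup>+q\<in>{0..t}. ennreal (exp (- q)) * indicator {..<ennreal q} x \<partial>lborel)"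
proof (cases "x < ennreal t")
  case False
  have "ennreal (exp (- q)) * indicator {..<ennreal q} x * indicator {0..t} q = (0 :: ennreal)" for q
    using False ennreal_leI[of q t] by (auto split: split_indicator dest: less_le_trans)
  then have "(\<integral>\<^sup>+q\<in>{0..t}. ennreal (exp (- q)) * indicator {..<ennreal q} x \<partial>lborel) = (\<integral>\<^sup>+q. 0 \<partial>(lborel :: real measure))"
    by (intro nn_integral_cong)
  then show ?thesis using False by simp
next
  case True
  then obtain y where y: "x = ennreal y" "0 \<le> y" by (cases x) auto
  then have yt: "y < t" using True by (simp add: ennreal_less_iff)
  have "((\<lambda>q. exp (- q)) has_integral (- exp (- t) - (- exp (- y)))) {y..t}"
    using yt by (intro fundamental_theorem_of_calculus)
      (auto intro!: derivative_eq_intros simp flip: has_real_derivative_iff_has_vector_derivative)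
  from nn_integral_has_integral_lebesgue[OF _ this]
  have I: "(\<integral>\<^sup>+q. ennreal (indicator {y..t} q * exp (- q)) \<partial>lborel) = ennreal (exp (- y) - exp (- t))" by simp
  have "(\<integral>\<^sup>+q\<in>{0..t}. ennreal (exp (- q)) * indicator {..<ennreal q} x \<partial>lborel) =
      (\<integral>\<^sup>+q. ennreal (indicator {y..t} q * exp (- q)) \<partial>lborel)"
    \<comment> \<open>The strict inequality x < q misses the endpoint q = y of the closed interval;
      one point is null.\<close>
    using AE_lborel_singleton[of y]
    by (intro nn_integral_cong_AE, elim AE_mp, intro AE_I2)
       (use y(2) in \<open>auto simp: y(1) ennreal_less_iff split: split_indicator\<close>)
  then show ?thesis using y(2) yt by (simp add: y(1) I ennreal_less_iff flip: ennreal_plus)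
qed

context clock
begin

lemma nn_integral_inverse_time_less:
  assumes q: "0 \<le> q"
  shows "(\<integral>\<^sup>+r\<in>{0<..}. indicator {..<ennreal q} (inverse_time a r) \<partial>lborel) = a q"
proof -
  have "(\<integral>\<^sup>+r\<in>{0<..}. indicator {..<ennreal q} (inverse_time a r) \<partial>lborel) =
      (\<integral>\<^sup>+r. indicator {r. 0 < r \<and> ennreal r < a q} r \<partial>lborel)"
    using inverse_time_less_iff[OF q] by (intro nn_integral_cong) (auto split: split_indicator)
  also have "\<dots> = emeasure lborel {r. 0 < r \<and> ennreal r < a q}" by simp
  also have "\<dots> = a q"
  proof (cases "a q")
    case (real c)
    then have "{r. 0 < r \<and> ennreal r < a q} = {0<..<c}" by (auto simp: ennreal_less_iff)
    then show ?thesis using real by simp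
  next
    case top
    have "ennreal (real n) \<le> emeasure lborel {0::real<..}" for n :: nat
      using emeasure_mono[of "{0<..<real n}" "{0<..}" lborel] by (simp add: subset_eq)
    then have "emeasure lborel {0::real<..} = top"
      by (metis ennreal_Ex_less_of_nat ennreal_of_nat_eq_real_of_nat not_le top.not_eq_extremum)
    then show ?thesis using top by (simp add: greaterThan_def)
  qed
  finally show ?thesis .
qed

text \<open>\<open>nn_integral_exp_tail\<close> at x = \<open>inverse_time a r\<close>, integrated
  over the levels r with Fubini; each sublevel set at time q contributes its length
  \<open>a q\<close>.\<close>

lemma discounted_eq:
  assumes t: "0 \<le> t"
  shows "discounted a (ennreal t) = ennreal (exp (- t)) * a t + (\<integral>\<^sup>+q\<in>{0..t}. ennreal (exp (- q)) * a q \<partial>lborel)"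
proof -
  let ?I = "\<lambda>q r. indicator {..<ennreal q} (inverse_time a r) :: ennreal"
  let ?f = "\<lambda>r q. (ennreal (exp (- q)) * ?I q r * indicator {0..t} q) * indicator {0<..} r"
  have mf: "(\<lambda>(r, q). ?f r q) \<in> borel_measurable (lborel \<Otimes>\<^sub>M lborel)"
    unfolding indicator_def lessThan_iff by measurable
  have mf1: "(\<lambda>r. \<integral>\<^sup>+q. ?f r q \<partial>lborel) \<in> borel_measurable lborel"
    using lborel.borel_measurable_nn_integral[OF mf] by simp
  have "discounted a (ennreal t) = (\<integral>\<^sup>+r. ennreal (exp (- t)) * (?I t r * indicator {0<..} r) +
      (\<integral>\<^sup>+q. (ennreal (exp (- q)) * ?I q r * indicator {0..t} q) * indicator {0<..} r \<partial>lborel) \<partial>lborel)"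
    unfolding discounted_def nn_integral_exp_tail[OF t]
    by (intro nn_integral_cong) (auto split: split_indicator)
  also have "\<dots> = ennreal (exp (- t)) * a t +
      (\<integral>\<^sup>+r. (\<integral>\<^sup>+q. (ennreal (exp (- q)) * ?I q r * indicator {0..t} q) * indicator {0<..} r \<partial>lborel) \<partial>lborel)"
    by (subst nn_integral_add[OF _ mf1]) (auto simp: nn_integral_cmult nn_integral_inverse_time_less[OF t])
  also have "(\<integral>\<^sup>+r. (\<integral>\<^sup>+q. (ennreal (exp (- q)) * ?I q r * indicator {0..t} q) * indicator {0<..} r \<partial>lborel) \<partial>lborel) =
      (\<integral>\<^sup>+q. (\<integral>\<^sup>+r. (ennreal (exp (- q)) * indicator {0..t} q) * (?I q r * indicator {0<..} r) \<partial>lborel) \<partial>lborel)"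
    using lborel_pair.Fubini'[OF mf] by (simp add: ac_simps)
  also have "\<dots> = (\<integral>\<^sup>+q. (ennreal (exp (- q)) * indicator {0..t} q) * a q \<partial>lborel)"
  proof (rule nn_integral_cong)
    fix q :: real
    show "(\<integral>\<^sup>+r. (ennreal (exp (- q)) * indicator {0..t} q) * (?I q r * indicator {0<..} r) \<partial>lborel)
        = (ennreal (exp (- q)) * indicator {0..t} q) * a q"
      by (cases "0 \<le> q") (auto simp: nn_integral_cmult nn_integral_inverse_time_less)
  qed
  finally show ?thesis by (simp add: ac_simps)
qed

text \<open>At time \<open>t\<close> the level \<open>c\<close> has been reached, and the remaining
  climb by \<open>r\<close> is made by \<open>b\<close>. Equality follows by comparing which times
  \<open>q\<close> exceed either side; finiteness of \<open>a t\<close> permits cancelling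
  \<open>c\<close>.\<close>

lemma inverse_time_shift:
  assumes t: "0 \<le> t" "a t = ennreal c" "0 \<le> c" and r: "0 \<le> r" and b: "clock b"
    and ab: "\<And>s. 0 \<le> s \<Longrightarrow> a (t + s) = a t + b s"
  shows "inverse_time a (c + r) = ennreal t + inverse_time b r"
proof (rule ennreal_eq_if_less_iff)
  interpret b: clock b by (rule b)
  fix q :: real assume q: "0 \<le> q"
  show "inverse_time a (c + r) < ennreal q \<longleftrightarrow> ennreal t + inverse_time b r < ennreal q"
  proof (cases "t \<le> q")
    case False
    then have "a q \<le> ennreal (c + r)" using mono[of q t] q t r by (auto intro: order_trans ennreal_leI)
    then have "\<not> inverse_time a (c + r) < ennreal q" using inverse_time_less_iff[of q "c + r"] q t r by auto
    moreover have "ennreal q \<le> ennreal t + inverse_time b r"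
      using False by (intro add_increasing2) (auto intro: ennreal_leI)
    ultimately show ?thesis by auto
  next
    case True
    define s where "s = q - t"
    have s: "q = t + s" "0 \<le> s" using True by (auto simp: s_def)
    have "inverse_time a (c + r) < ennreal q \<longleftrightarrow> ennreal c + ennreal r < ennreal c + b s"
      using inverse_time_less_iff[of q "c + r"] q t r ab[OF s(2)] s by simp
    also have "\<dots> \<longleftrightarrow> ennreal r < b s" by (simp add: ennreal_add_left_cancel_less)
    also have "\<dots> \<longleftrightarrow> inverse_time b r < ennreal s" using b.inverse_time_less_iff s r by simp
    also have "\<dots> \<longleftrightarrow> ennreal t + inverse_time b r < ennreal t + ennreal s" by (simp add: ennreal_add_left_cancel_less)
    finally show ?thesis using s t by simp
  qed
qed

text \<open>Levels below \<open>a t\<close> are reached before \<open>t\<close>, levels above it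
  after \<open>t\<close>. The level \<open>a t\<close> itself is null, so closed and open half-lines
  give the same value; the splitting of a product along the diagonal produces one of each.\<close>

lemma nn_integral_tail_shift:
  assumes t: "0 \<le> t" "a t < \<infinity>" and b: "clock b"
    and ab: "\<And>s. 0 \<le> s \<Longrightarrow> a (t + s) = a t + b s"
    and S: "S = {ennreal t..} \<or> S = {ennreal t<..}"
  shows "(\<integral>\<^sup>+r\<in>{0<..}. exp_neg (inverse_time a r) * indicator S (inverse_time a r) \<partial>lborel) =
    ennreal (exp (- t)) * discounted b \<infinity>"
proof -
  obtain c where c: "a t = ennreal c" "0 \<le> c" using t by (cases "a t") auto
  have "(\<integral>\<^sup>+r\<in>{0<..}. exp_neg (inverse_time a r) * indicator S (inverse_time a r) \<partial>lborel) =
      (\<integral>\<^sup>+r. exp_neg (inverse_time a r) * indicator {c<..} r \<partial>lborel)"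
  proof (rule nn_integral_cong_AE, use AE_lborel_singleton[of c] in eventually_elim)
    case (elim r)
    show ?case
    proof (cases "c < r")
      case True
      then have "ennreal t < inverse_time a r" using less_inverse_time[OF t(1), of r] c by (simp add: ennreal_less_iff)
      then show ?thesis using True c S by auto
    next
      case False
      then have "r < c" using elim by simp
      then have "inverse_time a r < ennreal t" if "0 < r"
        using inverse_time_less_iff[OF t(1), of r] c that by (simp add: ennreal_less_iff)
      then show ?thesis using False S by (auto split: split_indicator)
    qed
  qed
  also have "\<dots> = (\<integral>\<^sup>+r. exp_neg (inverse_time a (c + r)) * indicator {0<..} r \<partial>lborel)"
    by (subst nn_integral_real_affine[where c=1 and t=c]) (auto intro!: nn_integral_cong split: split_indicator)
  also have "\<dots> = (\<integral>\<^sup>+r. ennreal (exp (- t)) * (exp_neg (inverse_time b r) * indicator {0<..} r) \<partial>lborel)"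
    using t by (intro nn_integral_cong)
      (auto split: split_indicator simp: inverse_time_shift[OF t(1) c _ b ab] exp_neg_add)
  also have "\<dots> = ennreal (exp (- t)) * discounted b \<infinity>"
    unfolding discounted_top by (rule nn_integral_cmult) measurable
  finally show ?thesis .
qed

lemma discounted_split:
  assumes t: "0 \<le> t" "a t < \<infinity>" and b: "clock b"
    and ab: "\<And>s. 0 \<le> s \<Longrightarrow> a (t + s) = a t + b s"
  shows "discounted a \<infinity> = discounted a (ennreal t) + ennreal (exp (- t)) * discounted b \<infinity>"
proof -
  have "discounted a \<infinity> = (\<integral>\<^sup>+r. exp_neg (inverse_time a r) * indicator {..<ennreal t} (inverse_time a r) * indicator {0<..} r +
      exp_neg (inverse_time a r) * indicator {ennreal t..} (inverse_time a r) * indicator {0<..} r \<partial>lborel)"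
    unfolding discounted_top by (intro nn_integral_cong) (auto split: split_indicator)
  also have "\<dots> = discounted a (ennreal t) + ennreal (exp (- t)) * discounted b \<infinity>"
    unfolding discounted_def[of a "ennreal t"]
    by (subst nn_integral_add) (auto simp: nn_integral_tail_shift[OF t b ab])
  finally show ?thesis .
qed

lemma discounted_mono: "discounted a t \<le> discounted a \<infinity>"
  unfolding discounted_top discounted_def by (intro nn_integral_mono) (auto split: split_indicator)

lemma finite_if_discounted_finite:
  assumes "discounted a \<infinity> < \<infinity>" "0 \<le> t"
  shows "a t < \<infinity>"
proof -
  have "ennreal (exp (- t)) * a t \<le> discounted a (ennreal t)"
    unfolding discounted_eq[OF assms(2)] by simp
  also have "\<dots> \<le> discounted a \<infinity>" by (rule discounted_mono)
  finally have "ennreal (exp (- t)) * a t < \<infinity>" using assms by auto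
  then show ?thesis by (auto simp: ennreal_mult_less_top)
qed

text \<open>Real-valued form of \<open>discounted_eq\<close>. Finiteness at all times makes it
  possible to subtract the identities of two functionals.\<close>

lemma enn2real_discounted:
  assumes fin: "\<And>t. 0 \<le> t \<Longrightarrow> a t < \<infinity>" and t: "0 \<le> t"
  shows "enn2real (discounted a (ennreal t)) =
    exp (- t) * enn2real (a t) + integral {0..t} (\<lambda>q. exp (- q) * enn2real (a q))"
    and "continuous_on {0..} (\<lambda>t. enn2real (a t))"
proof -
  show c: "continuous_on {0..} (\<lambda>t. enn2real (a t))"
    unfolding continuous_on_def
  proof
    fix x :: real assume "x \<in> {0..}"
    then show "((\<lambda>t. enn2real (a t)) \<longlongrightarrow> enn2real (a x)) (at x within {0..})"
      using cont fin[of x] unfolding continuous_on_def by (intro tendsto_enn2real) auto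
  qed
  have "(\<lambda>q. exp (- q) * enn2real (a q)) integrable_on {0..t}"
    by (intro integrable_continuous_real continuous_intros continuous_on_subset[OF c]) auto
  then have "((\<lambda>q. exp (- q) * enn2real (a q)) has_integral integral {0..t} (\<lambda>q. exp (- q) * enn2real (a q))) {0..t}"
    by (rule integrable_integral)
  from nn_integral_has_integral_lebesgue[OF _ this]
  have "(\<integral>\<^sup>+q. ennreal (indicator {0..t} q * (exp (- q) * enn2real (a q))) \<partial>lborel) =
      ennreal (integral {0..t} (\<lambda>q. exp (- q) * enn2real (a q)))" by simp
  also have "(\<integral>\<^sup>+q. ennreal (indicator {0..t} q * (exp (- q) * enn2real (a q))) \<partial>lborel) =
      (\<integral>\<^sup>+q\<in>{0..t}. ennreal (exp (- q)) * a q \<partial>lborel)"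
    using fin by (intro nn_integral_cong) (auto split: split_indicator simp: ennreal_mult less_top)
  finally have I: "(\<integral>\<^sup>+q\<in>{0..t}. ennreal (exp (- q)) * a q \<partial>lborel) =
     ennreal (integral {0..t} (\<lambda>q. exp (- q) * enn2real (a q)))" .
  have nn: "0 \<le> integral {0..t} (\<lambda>q. exp (- q) * enn2real (a q))"
    by (rule Henstock_Kurzweil_Integration.integral_nonneg) (use \<open>_ integrable_on _\<close> in auto)
  have "discounted a (ennreal t) = ennreal (exp (- t) * enn2real (a t) + integral {0..t} (\<lambda>q. exp (- q) * enn2real (a q)))"
    unfolding discounted_eq[OF t] I using fin[OF t] nn by (simp add: ennreal_mult less_top)
  then have "enn2real (discounted a (ennreal t)) =
      enn2real (ennreal (exp (- t) * enn2real (a t) + integral {0..t} (\<lambda>q. exp (- q) * enn2real (a q))))" by (rule arg_cong)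
  also have "\<dots> = exp (- t) * enn2real (a t) + integral {0..t} (\<lambda>q. exp (- q) * enn2real (a q))"
    using nn by (intro enn2real_ennreal add_nonneg_nonneg mult_nonneg_nonneg) auto
  finally show "enn2real (discounted a (ennreal t)) =
    exp (- t) * enn2real (a t) + integral {0..t} (\<lambda>q. exp (- q) * enn2real (a q))" .
qed

end

section \<open>Undoing the discount\<close>

lemma absdiff_ennreal: "0 \<le> x \<Longrightarrow> 0 \<le> y \<Longrightarrow> absdiff (ennreal x) (ennreal y) = ennreal \<bar>x - y\<bar>"
  by (simp add: absdiff_def)

lemma absdiff_enn2real: "u < \<infinity> \<Longrightarrow> v < \<infinity> \<Longrightarrow> absdiff u v = ennreal \<bar>enn2real u - enn2real v\<bar>"
  by (cases u; cases v) (auto simp: absdiff_ennreal)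

text \<open>Writing \<open>D\<close> = exp(-t) \<delta> + J, with J the integral of exp(-q)
  \<delta>, expresses \<delta> as exp(t) D - exp(t) J. The first term is at most exp(T) B, the
  second at most T exp(T) B, hence the constant. The bound on \<open>D\<close> is only asked for on
  dyadic grids, where Doob's inequality will deliver it.\<close>

lemma bound_from_discounted:
  fixes \<delta> D :: "real \<Rightarrow> real"
  assumes \<delta>: "continuous_on {0..T} \<delta>" and T: "0 < T"
    and D: "\<And>t. 0 \<le> t \<Longrightarrow> t \<le> T \<Longrightarrow> D t = exp (- t) * \<delta> t + integral {0..t} (\<lambda>q. exp (- q) * \<delta> q)"
    and B: "\<And>n k. k < (2::nat) ^ n \<Longrightarrow> \<bar>D (real k * T / 2 ^ n)\<bar> \<le> B"
    and t: "0 \<le> t" "t \<le> T"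
  shows "\<bar>\<delta> t\<bar> \<le> (1 + T) * exp T * B"
proof -
  define J where "J t = integral {0..t} (\<lambda>q. exp (- q) * \<delta> q)" for t
  have ce: "continuous_on {0..T} (\<lambda>q. exp (- q) * \<delta> q)" by (intro continuous_intros \<delta>)
  have dJ: "(J has_real_derivative exp (- t) * \<delta> t) (at t within {0..T})" if "t \<in> {0..T}" for t
    unfolding J_def[abs_def] by (rule integral_has_real_derivative[OF ce that])
  have cJ: "continuous_on {0..T} J" by (rule DERIV_continuous_on[OF dJ])
  have "continuous_on {0..T} (\<lambda>t. exp (- t) * \<delta> t + J t)" by (intro continuous_intros \<delta> cJ)
  then have cD: "continuous_on {0..T} D" by (rule continuous_on_eq) (auto simp: D J_def)
  have "\<bar>D 0\<bar> \<le> B" using B[of 0 0] by simp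
  then have B0: "0 \<le> B" by linarith
  have le: "\<bar>D s\<bar> \<le> B" if s: "0 \<le> s" "s \<le> T" for s
  proof -
    \<comment> \<open>Dyadic rationals are dense in the unit interval, so [0, T] is rescaled to it;
      the bound extends by continuity, also to the endpoint T, which is on no grid.\<close>
    let ?S = "{0<..<1} \<inter> (\<Union>n k. {real k / 2 ^ n})"
    have cl: "closure ?S = {0..1}" by (subst closure_dyadic_rationals_in_convex_set_pos_1) auto
    have "\<bar>D (T * (s / T))\<bar> \<le> B"
    proof (rule continuous_le_on_closure[where S="?S" and f="\<lambda>u. \<bar>D (T * u)\<bar>"])
      show "continuous_on (closure ?S) (\<lambda>u. \<bar>D (T * u)\<bar>)"
        unfolding cl by (intro continuous_intros continuous_on_compose2[OF cD]) (use T in \<open>auto simp: mult_left_le\<close>)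
      show "s / T \<in> closure ?S" unfolding cl using s T by simp
      fix u assume "u \<in> ?S"
      then obtain n k where u: "u = real k / 2 ^ n" "u < 1" by auto
      then have "real k < real (2 ^ n)" by simp
      then have "k < 2 ^ n" by (simp only: of_nat_less_iff)
      from B[OF this] show "\<bar>D (T * u)\<bar> \<le> B" by (simp add: u(1) mult.commute)
    qed
    then show ?thesis using T by simp
  qed
  \<comment> \<open>The derivative of exp(t) J is exp(t) (J + exp(-t) \<delta>) = exp(t) D, so no
    circular bound on \<delta> arises and the mean value inequality suffices.\<close>
  have "norm (exp t * J t - exp 0 * J 0) \<le> exp T * B * norm (t - 0)"
  proof (rule field_differentiable_bound[where S="{0..T}"])
    fix z assume z: "z \<in> {0..T}"
    show "((\<lambda>t. exp t * J t) has_field_derivative exp z * D z) (at z within {0..T})"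
      using z D[of z, folded J_def] by (auto intro!: derivative_eq_intros dJ simp: algebra_simps simp flip: exp_add)
    show "norm (exp z * D z) \<le> exp T * B"
      using z le[of z] B0 by (simp add: abs_mult) (intro mult_mono, auto)
  qed (use t T in auto)
  then have "\<bar>exp t * J t\<bar> \<le> exp T * B * t" using t by (simp add: J_def)
  also have "\<dots> \<le> exp T * B * T" using t B0 by (intro mult_left_mono) auto
  finally have 1: "\<bar>exp t * J t\<bar> \<le> exp T * B * T" .
  have "\<bar>exp t * D t\<bar> \<le> exp T * B"
    using t le[of t] B0 by (simp add: abs_mult) (intro mult_mono, auto)
  moreover have "\<delta> t = exp t * D t - exp t * J t"
    using D[OF t] by (simp add: J_def algebra_simps flip: exp_add)
  ultimately have "\<bar>\<delta> t\<bar> \<le> exp T * B + exp T * B * T" using 1 by linarith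
  then show ?thesis by (simp add: algebra_simps)
qed

section \<open>The energy identity\<close>

text \<open>Ties of the two inverse times are assigned to the first half. This makes the identity
  exact without any statement about the mass of the diagonal.\<close>

lemma discounted_product:
  "discounted a \<infinity> * discounted b \<infinity> =
    (\<integral>\<^sup>+s\<in>{0<..}. exp_neg (inverse_time b s) *
      (\<integral>\<^sup>+r\<in>{0<..}. exp_neg (inverse_time a r) * indicator {inverse_time b s..} (inverse_time a r) \<partial>lborel) \<partial>lborel) +
    (\<integral>\<^sup>+r\<in>{0<..}. exp_neg (inverse_time a r) *
      (\<integral>\<^sup>+s\<in>{0<..}. exp_neg (inverse_time b s) * indicator {inverse_time a r<..} (inverse_time b s) \<partial>lborel) \<partial>lborel)"
proof -
  let ?a = "inverse_time a" and ?b = "inverse_time b"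
  let ?w = "\<lambda>r s. exp_neg (?a r) * exp_neg (?b s) * indicator {0<..} r * indicator {0<..} s"
  have [measurable]: "(\<lambda>(s, r). ?w r s * indicator {?b s..} (?a r)) \<in> borel_measurable (lborel \<Otimes>\<^sub>M lborel)"
    unfolding indicator_def atLeast_iff greaterThan_iff by measurable
  have m2: "(\<lambda>(s, r). ?w r s * indicator {?a r<..} (?b s)) \<in> borel_measurable (lborel \<Otimes>\<^sub>M lborel)"
    unfolding indicator_def atLeast_iff greaterThan_iff by measurable
  have m3: "(\<lambda>s. \<integral>\<^sup>+r. ?w r s * indicator {?b s..} (?a r) \<partial>lborel) \<in> borel_measurable lborel"
    using lborel.borel_measurable_nn_integral[OF \<open>(\<lambda>(s, r). ?w r s * indicator {?b s..} (?a r)) \<in> _\<close>] by simp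
  have m4: "(\<lambda>s. \<integral>\<^sup>+r. ?w r s * indicator {?a r<..} (?b s) \<partial>lborel) \<in> borel_measurable lborel"
    using lborel.borel_measurable_nn_integral[OF m2] by simp
  have pull: "(\<integral>\<^sup>+q. f q \<partial>lborel) = x * (\<integral>\<^sup>+q\<in>{0<..}. h q \<partial>lborel) * i"
    if "\<And>q. f q = (x * i) * (h q * indicator {0<..} q)" "h \<in> borel_measurable lborel" for f h :: "real \<Rightarrow> ennreal" and x i
    unfolding that(1) using that(2) by (subst nn_integral_cmult) (auto simp: ac_simps)
  have "discounted a \<infinity> * discounted b \<infinity> =
      (\<integral>\<^sup>+s. discounted a \<infinity> * (exp_neg (?b s) * indicator {0<..} s) \<partial>lborel)"
    unfolding discounted_top[of b] by (subst nn_integral_cmult) auto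
  also have "\<dots> = (\<integral>\<^sup>+s. (\<integral>\<^sup>+r. ?w r s \<partial>lborel) \<partial>lborel)"
    unfolding discounted_top by (intro nn_integral_cong, subst nn_integral_multc[symmetric]) (auto simp: ac_simps)
  also have "\<dots> = (\<integral>\<^sup>+s. (\<integral>\<^sup>+r. ?w r s * indicator {?b s..} (?a r) + ?w r s * indicator {?a r<..} (?b s) \<partial>lborel) \<partial>lborel)"
    by (intro nn_integral_cong) (auto split: split_indicator)
  also have "\<dots> = (\<integral>\<^sup>+s. (\<integral>\<^sup>+r. ?w r s * indicator {?b s..} (?a r) \<partial>lborel) +
      (\<integral>\<^sup>+r. ?w r s * indicator {?a r<..} (?b s) \<partial>lborel) \<partial>lborel)"
    unfolding indicator_def atLeast_iff greaterThan_iff by (intro nn_integral_cong nn_integral_add) measurable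
  also have "\<dots> = (\<integral>\<^sup>+s. (\<integral>\<^sup>+r. ?w r s * indicator {?b s..} (?a r) \<partial>lborel) \<partial>lborel) +
      (\<integral>\<^sup>+s. (\<integral>\<^sup>+r. ?w r s * indicator {?a r<..} (?b s) \<partial>lborel) \<partial>lborel)"
    by (rule nn_integral_add[OF m3 m4])
  also have "(\<integral>\<^sup>+s. (\<integral>\<^sup>+r. ?w r s * indicator {?a r<..} (?b s) \<partial>lborel) \<partial>lborel) =
      (\<integral>\<^sup>+r. (\<integral>\<^sup>+s. ?w r s * indicator {?a r<..} (?b s) \<partial>lborel) \<partial>lborel)"
    using lborel_pair.Fubini'[OF m2] by simp
  also have "\<dots> = (\<integral>\<^sup>+r\<in>{0<..}. exp_neg (?a r) *
      (\<integral>\<^sup>+s\<in>{0<..}. exp_neg (?b s) * indicator {?a r<..} (?b s) \<partial>lborel) \<partial>lborel)"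
    by (intro nn_integral_cong pull) (auto simp: ac_simps)
  also have "(\<integral>\<^sup>+s. (\<integral>\<^sup>+r. ?w r s * indicator {?b s..} (?a r) \<partial>lborel) \<partial>lborel) =
      (\<integral>\<^sup>+s\<in>{0<..}. exp_neg (?b s) *
      (\<integral>\<^sup>+r\<in>{0<..}. exp_neg (?a r) * indicator {?b s..} (?a r) \<partial>lborel) \<partial>lborel)"
    by (intro nn_integral_cong pull) (auto simp: ac_simps)
  finally show ?thesis .
qed

lemma borel_measurable_alive:
  "indicator (- {None}) \<in> borel_measurable (cemetery_borel :: 's::topological_space option measure)"
  using sets.compl_sets[OF None_cemetery_borel] by (intro borel_measurable_indicator) (simp add: Compl_eq_Diff_UNIV)

section \<open>Additive functionals read through their right inverse\<close>

context locally_compact_process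
begin

lemma measurable_id_augmented: "(\<lambda>\<omega>. \<omega>) \<in> C z \<rightarrow>\<^sub>M F t"
proof (rule measurableI)
  fix E assume E: "E \<in> sets (F t)"
  then have "(\<lambda>\<omega>. \<omega>) -` E \<inter> space (C z) = E" using sets.sets_into_space[OF E] by (auto simp: aug.space_F)
  then show "(\<lambda>\<omega>. \<omega>) -` E \<inter> space (C z) \<in> sets (C z)" using E augmented_subset_completion by auto
qed (simp add: aug.space_F)

abbreviation rho :: "(real \<Rightarrow> 'w \<Rightarrow> ennreal) \<Rightarrow> real \<Rightarrow> 'w \<Rightarrow> ennreal" where
  "rho A r \<omega> \<equiv> inverse_time (\<lambda>t. A t \<omega>) r"

definition discounted_total :: "(real \<Rightarrow> 'w \<Rightarrow> ennreal) \<Rightarrow> 'w \<Rightarrow> ennreal" where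
  "discounted_total A \<omega> = discounted (\<lambda>t. A t \<omega>) \<infinity>"

text \<open>Collects what a path in a defining set offers, including the shifted clocks that come
  from the shift invariance of that set. The clauses on the lifetime are recast through
  \<open>X\<close> being at the cemetery, the form in which they meet the strong Markov
  property.\<close>

definition regular :: "(real \<Rightarrow> 'w \<Rightarrow> ennreal) \<Rightarrow> 'w \<Rightarrow> bool" where
  "regular A \<omega> \<longleftrightarrow> clock (\<lambda>t. A t \<omega>) \<and>
    (\<forall>t\<ge>0. clock (\<lambda>s. A s (\<theta> (ennreal t) \<omega>)) \<and> (\<forall>s\<ge>0. A (t + s) \<omega> = A t \<omega> + A s (\<theta> (ennreal t) \<omega>))) \<and>
    (\<forall>r\<ge>0. rho A r \<omega> < \<infinity> \<longrightarrow> X (rho A r \<omega>) \<omega> \<noteq> None) \<and>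
    (\<forall>t\<ge>0. X (ennreal t) \<omega> = None \<longrightarrow> (\<forall>s\<ge>0. A (t + s) \<omega> = A t \<omega>))"

lemma regularD:
  assumes "regular A \<omega>"
  shows "clock (\<lambda>t. A t \<omega>)"
    and "0 \<le> t \<Longrightarrow> clock (\<lambda>s. A s (\<theta> (ennreal t) \<omega>))"
    and "0 \<le> t \<Longrightarrow> 0 \<le> s \<Longrightarrow> A (t + s) \<omega> = A t \<omega> + A s (\<theta> (ennreal t) \<omega>)"
    and "0 \<le> r \<Longrightarrow> rho A r \<omega> < \<infinity> \<Longrightarrow> X (rho A r \<omega>) \<omega> \<noteq> None"
    and "0 \<le> t \<Longrightarrow> X (ennreal t) \<omega> = None \<Longrightarrow> 0 \<le> s \<Longrightarrow> A (t + s) \<omega> = A t \<omega>"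
  using assms unfolding regular_def by blast+

lemma PCAF_regular:
  assumes A: "PCAF M X P \<theta> A"
  shows "AE \<omega> in C (Some x). regular A \<omega>"
proof -
  obtain \<Lambda> where \<Lambda>1: "\<Lambda> \<in> sets (F \<infinity>)" "\<forall>x. emeasure (C (Some x)) \<Lambda> = 1"
      "\<forall>t\<ge>0. \<theta> (ennreal t) ` \<Lambda> \<subseteq> \<Lambda>"
    and \<Lambda>2: "\<forall>\<omega>\<in>\<Lambda>. A 0 \<omega> = 0 \<and> continuous_on {0..} (\<lambda>t. A t \<omega>) \<and>
      (\<forall>t\<ge>0. ennreal t < lifetime X \<omega> \<longrightarrow> A t \<omega> < \<infinity>) \<and>
      (\<forall>t\<ge>0. lifetime X \<omega> \<le> ennreal t \<longrightarrow> A t \<omega> = A (enn2real (lifetime X \<omega>)) \<omega>) \<and>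
      (\<forall>s\<ge>0. \<forall>t\<ge>0. A (t + s) \<omega> = A t \<omega> + A s (\<theta> (ennreal t) \<omega>))"
    using A unfolding PCAF_def by (elim conjE bexE that)
  have \<Lambda>: "\<Lambda> \<in> sets (F \<infinity>)" "emeasure (C (Some x)) \<Lambda> = 1"
    "\<And>t. t \<ge> 0 \<Longrightarrow> \<theta> (ennreal t) ` \<Lambda> \<subseteq> \<Lambda>"
    using \<Lambda>1 by simp_all
  note \<Lambda>3 = bspec[OF \<Lambda>2]
  have zero: "A 0 \<omega> = 0" and cont: "continuous_on {0..} (\<lambda>t. A t \<omega>)" if "\<omega> \<in> \<Lambda>" for \<omega>
    using \<Lambda>3[OF that] by simp_all
  have dead: "A t \<omega> = A (enn2real (lifetime X \<omega>)) \<omega>" if "\<omega> \<in> \<Lambda>" "0 \<le> t" "lifetime X \<omega> \<le> ennreal t" for \<omega> t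
    using \<Lambda>3[OF that(1)] that by simp
  have add: "A (t + s) \<omega> = A t \<omega> + A s (\<theta> (ennreal t) \<omega>)" if "\<omega> \<in> \<Lambda>" "0 \<le> s" "0 \<le> t" for \<omega> s t
    using \<Lambda>3[OF that(1)] that by simp
  have ck: "clock (\<lambda>t. A t \<omega>)" if "\<omega> \<in> \<Lambda>" for \<omega>
  proof
    fix s t :: real assume "0 \<le> s" "s \<le> t"
    then show "A s \<omega> \<le> A t \<omega>" using add[OF that, of "t - s" s] by simp
  qed (use that zero cont in auto)
  have "regular A \<omega>" if \<omega>: "\<omega> \<in> \<Lambda>" for \<omega>
    unfolding regular_def
  proof (intro conjI allI impI)
    interpret clock "\<lambda>t. A t \<omega>" by (rule ck[OF \<omega>])
    show "clock (\<lambda>t. A t \<omega>)" by (rule ck[OF \<omega>])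
    show "clock (\<lambda>s. A s (\<theta> (ennreal t) \<omega>))" if "0 \<le> t" for t
      using \<Lambda>(3)[OF that] \<omega> by (intro ck) auto
    show "A (t + s) \<omega> = A t \<omega> + A s (\<theta> (ennreal t) \<omega>)" if "0 \<le> t" "0 \<le> s" for s t
      using add[OF \<omega>] that by simp
    have life: "lifetime X \<omega> \<le> t" if "X t \<omega> = None" for t
      unfolding lifetime_def using that by (intro Inf_lower) auto
    show "A (t + s) \<omega> = A t \<omega>" if "0 \<le> t" "X (ennreal t) \<omega> = None" "0 \<le> s" for t s
    proof -
      have "lifetime X \<omega> \<le> ennreal t" by (rule life[OF that(2)])
      moreover have "ennreal t \<le> ennreal (t + s)" using that by (intro ennreal_leI) auto
      ultimately show ?thesis using dead[OF \<omega>, of t] dead[OF \<omega> _ order_trans, of "t + s" "ennreal t"] that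
        by (simp del: ennreal_plus)
    qed
    show "X (rho A r \<omega>) \<omega> \<noteq> None" if r: "0 \<le> r" "rho A r \<omega> < \<infinity>" for r
    proof
      assume "X (rho A r \<omega>) \<omega> = None"
      then have le: "lifetime X \<omega> \<le> rho A r \<omega>" by (rule life)
      define z where "z = enn2real (lifetime X \<omega>)"
      have z: "lifetime X \<omega> = ennreal z" "0 \<le> z" using le r(2) by (auto simp: z_def)
      obtain t where t: "rho A r \<omega> = ennreal t" "0 \<le> t" using r(2) by (cases "rho A r \<omega>") auto
      \<comment> \<open>Any time after \<open>rho A r\<close> would do: there the level
        \<open>r\<close> is exceeded. As \<open>A\<close> is constant from the lifetime
        \<open>z\<close> on, \<open>r\<close> is already exceeded at \<open>z\<close>, which forces
        \<open>rho A r\<close> to lie before \<open>z\<close>.\<close>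
      have "rho A r \<omega> < ennreal (t + 1)" using t by (simp add: ennreal_less_iff)
      then have "ennreal r < A (t + 1) \<omega>" using inverse_time_less_iff[of "t + 1" r] t r by simp
      also have "A (t + 1) \<omega> = A z \<omega>"
        unfolding z_def using t le by (intro dead[OF \<omega>]) (auto intro: order_trans ennreal_leI)
      finally have "rho A r \<omega> < ennreal z" using inverse_time_less_iff[of z r] z r by simp
      then show False using le z by simp
    qed
  qed
  moreover have "AE \<omega> in C (Some x). \<omega> \<in> \<Lambda>"
  proof -
    interpret prob_space "C (Some x)" by (rule prob_space_completion)
    have "prob \<Lambda> = 1" using \<Lambda>(2) by (simp add: emeasure_eq_measure)
    moreover have "\<Lambda> \<in> sets (C (Some x))" using \<Lambda>(1) augmented_subset_completion by blast
    ultimately show ?thesis using prob_eq_1 by blast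
  qed
  ultimately show ?thesis by auto
qed

lemma PCAF_measurable: "PCAF M X P \<theta> A \<Longrightarrow> 0 \<le> t \<Longrightarrow> A t \<in> borel_measurable (F (ennreal t))"
  unfolding PCAF_def by (drule conjunct1) simp

lemma PCAF_measurable_mono:
  assumes "PCAF M X P \<theta> A" "0 \<le> t" "ennreal t \<le> u"
  shows "A t \<in> borel_measurable (F u)"
  by (rule measurable_from_subalg[OF _ PCAF_measurable[OF assms(1,2)]])
     (simp add: subalgebra_def aug.space_F aug.sets_F_mono[OF assms(3)])

lemma measurable_rho:
  assumes A: "PCAF M X P \<theta> A" and W: "W \<in> N \<rightarrow>\<^sub>M F \<infinity>" and g: "g \<in> borel_measurable N"
  shows "(\<lambda>n. rho A (g n) (W n)) \<in> borel_measurable N"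
  by (rule measurable_inverse_time[OF _ g]) (rule measurable_compose[OF W PCAF_measurable_mono[OF A]], auto)

text \<open>Rational times beyond \<open>u\<close> enter the capped infimum only with the value
  \<open>u\<close>, so the functional is consulted at times up to \<open>u\<close> alone.\<close>

lemma measurable_min_rho:
  assumes A: "PCAF M X P \<theta> A" and W: "W \<in> N \<rightarrow>\<^sub>M F u" and g: "g \<in> borel_measurable N"
  shows "(\<lambda>n. min (rho A (g n) (W n)) u) \<in> borel_measurable N"
proof -
  have "(\<lambda>n. INF q\<in>\<rat> \<inter> {0..}. min (if ennreal (g n) < A q (W n) then ennreal q else \<infinity>) u) \<in> borel_measurable N"
  proof (rule borel_measurable_INF)
    show "countable (\<rat> \<inter> {0..} :: real set)" by (simp add: countable_rat)
    fix q :: real assume "q \<in> \<rat> \<inter> {0..}"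
    show "(\<lambda>n. min (if ennreal (g n) < A q (W n) then ennreal q else \<infinity>) u) \<in> borel_measurable N"
    proof (cases "ennreal q \<le> u")
      case True
      then have [measurable]: "(\<lambda>n. A q (W n)) \<in> borel_measurable N"
        using \<open>q \<in> _\<close> by (intro measurable_compose[OF W PCAF_measurable_mono[OF A]]) auto
      note [measurable] = g
      show ?thesis by measurable
    next
      case False
      then have "min (if ennreal (g n) < A q (W n) then ennreal q else \<infinity>) u = u" for n
        by (auto simp: min_def top_unique)
      then show ?thesis by simp
    qed
  qed
  also have "(\<lambda>n. INF q\<in>\<rat> \<inter> {0..}. min (if ennreal (g n) < A q (W n) then ennreal q else \<infinity>) u) =
      (\<lambda>n. min (rho A (g n) (W n)) u)"
  proof
    fix n
    have ne: "(\<rat> \<inter> {0..} :: real set) \<noteq> {}" by (metis IntI Rats_0 atLeast_iff empty_iff order_refl)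
    show "(INF q\<in>\<rat> \<inter> {0..}. min (if ennreal (g n) < A q (W n) then ennreal q else \<infinity>) u) = min (rho A (g n) (W n)) u"
      unfolding inverse_time_def inf_min[symmetric] by (rule INF_inf_const2[OF ne])
  qed
  finally show ?thesis .
qed

text \<open>Whether the inverse is at most \<open>t\<close> can be read off its cap at any later
  time s, hence belongs to \<open>F s\<close> for all s > t; right continuity of the filtration
  brings it down to \<open>t\<close>.\<close>

lemma stopping_time_rho:
  assumes A: "PCAF M X P \<theta> A"
  shows "stopping_time F (rho A r)"
proof
  fix t
  show "Measurable.pred (F t) (\<lambda>\<omega>. rho A r \<omega> \<le> t)"
  proof (cases "t < \<infinity>")
    case True
    have "{\<omega>\<in>space M. rho A r \<omega> \<le> t} \<in> sets (F s)" if "t < s" for s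
    proof -
      have "(\<lambda>\<omega>. min (rho A r \<omega>) s) \<in> borel_measurable (F s)" by (rule measurable_min_rho[OF A]) auto
      then have "{\<omega>\<in>space (F s). min (rho A r \<omega>) s \<le> t} \<in> sets (F s)" by measurable
      then show ?thesis using that by (simp add: aug.space_F min_le_iff_disj not_le[symmetric])
    qed
    then have "{\<omega>\<in>space M. rho A r \<omega> \<le> t} \<in> (\<Inter>s\<in>{t<..}. sets (F s))" by auto
    then show ?thesis unfolding filtration_right_continuous[OF True, symmetric] by (simp add: pred_def aug.space_F)
  next
    case False
    then have "rho A r \<omega> \<le> t" for \<omega> by (simp add: not_less top_unique)
    then show ?thesis by simp
  qed
qed

lemma measurable_discounted_total:
  assumes A: "PCAF M X P \<theta> A" shows "discounted_total A \<in> borel_measurable (F \<infinity>)"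
proof -
  have [measurable]: "(\<lambda>x. rho A (snd x) (fst x)) \<in> borel_measurable (F \<infinity> \<Otimes>\<^sub>M lborel)"
    by (rule measurable_rho[OF A]) auto
  have "(\<lambda>(\<omega>, r). exp_neg (rho A r \<omega>) * indicator {0<..} r) \<in> borel_measurable (F \<infinity> \<Otimes>\<^sub>M lborel)"
    unfolding split_beta by measurable
  from lborel.borel_measurable_nn_integral[OF this] show ?thesis
    unfolding discounted_total_def[abs_def] discounted_top by simp
qed

text \<open>The change of variables is made path by path, on regular paths. The guard on infinite
  \<open>rho\<close> matters because \<open>enn2real\<close> would turn infinity into time
  0.\<close>

lemma Revuz_time_change:
  assumes A: "PCAF M X P \<theta> A" and R: "Revuz_corresponds X P p A \<mu>" and \<alpha>: "0 < \<alpha>" and f: "f \<in> borel_measurable borel"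
  shows "(\<integral>\<^sup>+\<omega>. (\<integral>\<^sup>+r\<in>{0<..}. (if rho A r \<omega> < \<infinity> then ennreal (exp (- \<alpha> * enn2real (rho A r \<omega>))) else 0) *
      cemetery_ext f (X (rho A r \<omega>) \<omega>) \<partial>lborel) \<partial>C (Some x)) = (\<integral>\<^sup>+y. resolvent_density p \<alpha> x y * f y \<partial>\<mu>)"
proof -
  have "(\<integral>\<^sup>+y. resolvent_density p \<alpha> x y * f y \<partial>\<mu>) = (\<integral>\<^sup>+\<omega>. Stieltjes_integral
            (\<lambda>t. ennreal (exp (- \<alpha> * t)) * cemetery_ext f (X (ennreal t) \<omega>)) (\<lambda>t. A t \<omega>)
          \<partial>C (Some x))"
    using R \<alpha> f unfolding Revuz_corresponds_def by simp
  also have "\<dots> = (\<integral>\<^sup>+\<omega>. (\<integral>\<^sup>+r\<in>{0<..}. (if rho A r \<omega> < \<infinity> then ennreal (exp (- \<alpha> * enn2real (rho A r \<omega>))) else 0) *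
      cemetery_ext f (X (rho A r \<omega>) \<omega>) \<partial>lborel) \<partial>C (Some x))"
  proof (rule nn_integral_cong_AE, use PCAF_regular[OF A, of x] in \<open>elim AE_mp, intro AE_I2 impI\<close>)
    fix \<omega> assume \<omega>: "\<omega> \<in> space (C (Some x))" "regular A \<omega>"
    interpret clock "\<lambda>t. A t \<omega>" using \<omega>(2) by (rule regularD)
    \<comment> \<open>Borel measurability of a single path: the random time lemma with a constant
      path and the time as the variable.\<close>
    have "(\<lambda>t. X (ennreal t) \<omega>) \<in> borel \<rightarrow>\<^sub>M cemetery_borel"
      by (rule measurable_X_random_time[of "\<lambda>_. \<omega>" _ "Some x"]) (use \<omega> in auto)
    from measurable_compose[OF this measurable_cemetery_ext[OF f]]
    have [measurable]: "(\<lambda>t. cemetery_ext f (X (ennreal t) \<omega>)) \<in> borel_measurable borel" .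
    have "Stieltjes_integral (\<lambda>t. ennreal (exp (- \<alpha> * t)) * cemetery_ext f (X (ennreal t) \<omega>)) (\<lambda>t. A t \<omega>) =
      (\<integral>\<^sup>+r\<in>{0<..}. (if rho A r \<omega> < \<infinity> then ennreal (exp (- \<alpha> * enn2real (rho A r \<omega>))) *
        cemetery_ext f (X (ennreal (enn2real (rho A r \<omega>))) \<omega>) else 0) \<partial>lborel)"
      by (rule Stieltjes_integral_eq) measurable
    also have "\<dots> = (\<integral>\<^sup>+r\<in>{0<..}. (if rho A r \<omega> < \<infinity> then ennreal (exp (- \<alpha> * enn2real (rho A r \<omega>))) else 0) *
      cemetery_ext f (X (rho A r \<omega>) \<omega>) \<partial>lborel)"
      by (intro nn_integral_cong) auto
    finally show "Stieltjes_integral (\<lambda>t. ennreal (exp (- \<alpha> * t)) * cemetery_ext f (X (ennreal t) \<omega>)) (\<lambda>t. A t \<omega>) =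
      (\<integral>\<^sup>+r\<in>{0<..}. (if rho A r \<omega> < \<infinity> then ennreal (exp (- \<alpha> * enn2real (rho A r \<omega>))) else 0) *
      cemetery_ext f (X (rho A r \<omega>) \<omega>) \<partial>lborel)" .
  qed
  finally show ?thesis ..
qed

text \<open>The Revuz formula with f = 1. Its extension by 0 to the cemetery does no harm, as on a
  regular path every level reached is reached while the process is alive.\<close>

lemma nn_integral_discounted_total:
  assumes A: "PCAF M X P \<theta> A" and R: "Revuz_corresponds X P p A \<mu>"
  shows "(\<integral>\<^sup>+\<omega>. discounted_total A \<omega> \<partial>C (Some x)) = potential p 1 \<mu> x"
proof -
  have "(\<integral>\<^sup>+\<omega>. discounted_total A \<omega> \<partial>C (Some x)) = (\<integral>\<^sup>+\<omega>. (\<integral>\<^sup>+r\<in>{0<..}. (if rho A r \<omega> < \<infinity> then ennreal (exp (- 1 * enn2real (rho A r \<omega>))) else 0) *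
      cemetery_ext (\<lambda>_. 1) (X (rho A r \<omega>) \<omega>) \<partial>lborel) \<partial>C (Some x))"
  proof (rule nn_integral_cong_AE, use PCAF_regular[OF A, of x] in \<open>elim AE_mp, intro AE_I2 impI\<close>)
    fix \<omega> assume \<omega>: "regular A \<omega>"
    show "discounted_total A \<omega> = (\<integral>\<^sup>+r\<in>{0<..}. (if rho A r \<omega> < \<infinity> then ennreal (exp (- 1 * enn2real (rho A r \<omega>))) else 0) *
      cemetery_ext (\<lambda>_. 1) (X (rho A r \<omega>) \<omega>) \<partial>lborel)"
      unfolding discounted_total_def discounted_top
    proof (rule nn_integral_cong)
      fix r :: real
      have "X (rho A r \<omega>) \<omega> \<noteq> None" if "0 < r" "rho A r \<omega> < \<infinity>" using regularD(4)[OF \<omega> _ that(2)] that by simp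
      then show "exp_neg (rho A r \<omega>) * indicator {0<..} r = (if rho A r \<omega> < \<infinity> then ennreal (exp (- 1 * enn2real (rho A r \<omega>))) else 0) *
          cemetery_ext (\<lambda>_. 1) (X (rho A r \<omega>) \<omega>) * indicator {0<..} r"
        by (auto simp: exp_neg_def cemetery_ext_def less_top split: split_indicator)
    qed
  qed
  also have "\<dots> = potential p 1 \<mu> x"
    unfolding potential_def by (subst Revuz_time_change[OF A R]) auto
  finally show ?thesis .
qed

text \<open>One factor is the discount of the outer integral, the other comes from restarting the
  inner one; together they are the origin of the index 2 in the energy identity.\<close>

lemma exp_neg_square: "(if t < \<infinity> then ennreal (exp (- 2 * enn2real t)) else 0) = exp_neg t * exp_neg t"
  by (cases t) (auto simp flip: ennreal_mult exp_add)

lemma measurable_tail: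
  fixes z
  assumes A: "PCAF M X P \<theta> A" and B: "PCAF M X P \<theta> B" and S: "S = (\<lambda>t. {t..}) \<or> S = (\<lambda>t. {t<..})"
  shows "(\<lambda>(\<omega>, s). exp_neg (rho B s \<omega>) *
      (\<integral>\<^sup>+r\<in>{0<..}. exp_neg (rho A r \<omega>) * indicator (S (rho B s \<omega>)) (rho A r \<omega>) \<partial>lborel) *
      indicator {0<..} s) \<in> borel_measurable (C z \<Otimes>\<^sub>M lborel)"
proof -
  let ?Q = "C z"
  have f1: "fst \<in> (?Q \<Otimes>\<^sub>M lborel) \<rightarrow>\<^sub>M F \<infinity>" by (rule measurable_compose[OF measurable_fst measurable_id_augmented])
  have f2: "(\<lambda>x. fst (fst x)) \<in> ((?Q \<Otimes>\<^sub>M lborel) \<Otimes>\<^sub>M lborel) \<rightarrow>\<^sub>M F \<infinity>" by (rule measurable_compose[OF measurable_fst f1])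
  have [measurable]: "(\<lambda>x. rho B (snd (fst x)) (fst (fst x))) \<in> borel_measurable ((?Q \<Otimes>\<^sub>M lborel) \<Otimes>\<^sub>M lborel)"
      "(\<lambda>x. rho A (snd x) (fst (fst x))) \<in> borel_measurable ((?Q \<Otimes>\<^sub>M lborel) \<Otimes>\<^sub>M lborel)"
    by (rule measurable_rho[OF B f2], simp) (rule measurable_rho[OF A f2], simp)
  have rB: "(\<lambda>x. rho B (snd x) (fst x)) \<in> borel_measurable (?Q \<Otimes>\<^sub>M lborel)"
    by (rule measurable_rho[OF B f1]) auto
  have "(\<lambda>(y, r). exp_neg (rho A r (fst y)) * indicator (S (rho B (snd y) (fst y))) (rho A r (fst y)) * indicator {0<..} r)
      \<in> borel_measurable ((?Q \<Otimes>\<^sub>M lborel) \<Otimes>\<^sub>M lborel)"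
    using S by (elim disjE) (simp_all add: indicator_def split_beta)
  from lborel.borel_measurable_nn_integral[OF this] rB show ?thesis by (simp add: split_beta)
qed

text \<open>Conditioning at the stopping time \<open>rho B s\<close>, one level s at a time: what
  \<open>A\<close> accumulates from then on is discounted once more by that time, and its
  conditional mean is the potential of \<open>\<mu>\<close> at the current position. Integrating
  over s is then the Revuz formula for \<open>B\<close> at \<alpha> = 2.\<close>

lemma energy_half:
  assumes A: "PCAF M X P \<theta> A" "Revuz_corresponds X P p A \<mu>" and B: "PCAF M X P \<theta> B" "Revuz_corresponds X P p B \<nu>"
    and pot: "potential p 1 \<mu> \<in> borel_measurable borel" "potential p 1 \<mu> x < \<infinity>"
    and S: "S = (\<lambda>t. {t..}) \<or> S = (\<lambda>t. {t<..})"
  shows "(\<integral>\<^sup>+\<omega>. (\<integral>\<^sup>+s\<in>{0<..}. exp_neg (rho B s \<omega>) *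
      (\<integral>\<^sup>+r\<in>{0<..}. exp_neg (rho A r \<omega>) * indicator (S (rho B s \<omega>)) (rho A r \<omega>) \<partial>lborel) \<partial>lborel) \<partial>C (Some x)) =
    (\<integral>\<^sup>+y. resolvent_density p 2 x y * potential p 1 \<mu> y \<partial>\<nu>)"
proof -
  let ?Q = "C (Some x)"
  interpret prob_space ?Q by (rule prob_space_completion)
  interpret pair: pair_sigma_finite ?Q lborel ..
  have rB: "(\<lambda>x. rho B (snd x) (fst x)) \<in> borel_measurable (?Q \<Otimes>\<^sub>M lborel)"
    by (rule measurable_rho[OF B(1) measurable_compose[OF measurable_fst measurable_id_augmented]]) auto
  define \<kappa> where "\<kappa> \<omega> s = (\<integral>\<^sup>+r\<in>{0<..}. exp_neg (rho A r \<omega>) * indicator (S (rho B s \<omega>)) (rho A r \<omega>) \<partial>lborel)" for \<omega> s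
  have m1: "(\<lambda>(\<omega>, s). exp_neg (rho B s \<omega>) * \<kappa> \<omega> s * indicator {0<..} s) \<in> borel_measurable (?Q \<Otimes>\<^sub>M lborel)"
    unfolding \<kappa>_def by (rule measurable_tail[OF A(1) B(1) S])
  let ?u = "cemetery_ext (potential p 1 \<mu>)"
  have mX: "(\<lambda>y. X (rho B (snd y) (fst y)) (fst y)) \<in> (?Q \<Otimes>\<^sub>M lborel) \<rightarrow>\<^sub>M cemetery_borel"
    by (rule measurable_X_random_time[OF measurable_fst rB])
  have "(\<lambda>y. exp_neg (rho B (snd y) (fst y)) * exp_neg (rho B (snd y) (fst y)) *
      ?u (X (rho B (snd y) (fst y)) (fst y)) * indicator {0<..} (snd y)) \<in> borel_measurable (?Q \<Otimes>\<^sub>M lborel)"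
    using rB measurable_compose[OF mX measurable_cemetery_ext[OF pot(1)]] by simp
  then have m2: "(\<lambda>(\<omega>, s). exp_neg (rho B s \<omega>) * exp_neg (rho B s \<omega>) * ?u (X (rho B s \<omega>) \<omega>) * indicator {0<..} s)
      \<in> borel_measurable (?Q \<Otimes>\<^sub>M lborel)" by (simp add: split_beta)
  have tot: "(\<integral>\<^sup>+\<omega>. discounted_total A \<omega> \<partial>?Q) < \<infinity>" using nn_integral_discounted_total[OF A] pot by simp
  have fin: "AE \<omega> in ?Q. discounted_total A \<omega> < \<infinity>"
    using nn_integral_PInf_AE[of "discounted_total A" ?Q] tot measurable_augmented_completion[OF measurable_discounted_total[OF A(1)]]
    by (auto simp: top.not_eq_extremum)
  have fixed_s: "(\<integral>\<^sup>+\<omega>. exp_neg (rho B s \<omega>) * \<kappa> \<omega> s \<partial>?Q) =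
      (\<integral>\<^sup>+\<omega>. exp_neg (rho B s \<omega>) * exp_neg (rho B s \<omega>) * ?u (X (rho B s \<omega>) \<omega>) \<partial>?Q)" if s: "0 < s" for s
  proof -
    note st = stopping_time_rho[OF B(1), of s]
    \<comment> \<open>The indicator of being alive is inserted because the mean of
      \<open>discounted_total A\<close> has been computed only for starting points in S. At a finite
      \<open>rho B s\<close> it is almost surely 1, and at infinity the discount vanishes
      anyway.\<close>
    define W where "W \<omega> = exp_neg (rho B s \<omega>) * exp_neg (rho B s \<omega>) * indicator (- {None}) (X (rho B s \<omega>) \<omega>)" for \<omega>
    from measurable_compose[OF measurable_X_stopping_time[OF st] borel_measurable_alive]
    have mW: "W \<in> borel_measurable (aug.pre_sigma (rho B s))"
      unfolding W_def using aug.measurable_stopping_time_pre_sigma[OF st]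
      by (intro borel_measurable_times_ennreal measurable_compose[OF _ borel_measurable_exp_neg])
    have "(\<integral>\<^sup>+\<omega>. exp_neg (rho B s \<omega>) * \<kappa> \<omega> s \<partial>?Q) = (\<integral>\<^sup>+\<omega>. W \<omega> * discounted_total A (\<theta> (rho B s \<omega>) \<omega>) \<partial>?Q)"
    proof (rule nn_integral_cong_AE, use PCAF_regular[OF A(1), of x] PCAF_regular[OF B(1), of x] fin in eventually_elim)
      case (elim \<omega>)
      show ?case
      proof (cases "rho B s \<omega> < \<infinity>")
        case True
        define t where "t = enn2real (rho B s \<omega>)"
        have t: "rho B s \<omega> = ennreal t" "0 \<le> t" using True by (auto simp: t_def)
        have X: "X (rho B s \<omega>) \<omega> \<noteq> None" using regularD(4)[OF elim(2) _ True] s by simp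
        interpret A: clock "\<lambda>t. A t \<omega>" using elim(1) by (rule regularD)
        have "A t \<omega> < \<infinity>" using elim(3) t(2) unfolding discounted_total_def by (intro A.finite_if_discounted_finite)
        then have "\<kappa> \<omega> s = ennreal (exp (- t)) * discounted_total A (\<theta> (ennreal t) \<omega>)"
          unfolding \<kappa>_def discounted_total_def using elim(1) t S
          by (intro A.nn_integral_tail_shift) (auto intro: regularD)
        then show ?thesis using X t by (simp add: W_def mult.assoc)
      qed (simp add: W_def)
    qed
    also have "\<dots> = (\<integral>\<^sup>+\<omega>. W \<omega> * (\<integral>\<^sup>+\<omega>'. discounted_total A \<omega>' \<partial>C (X (rho B s \<omega>) \<omega>)) \<partial>?Q)"
      by (rule strong_Markov_functional[OF st measurable_discounted_total[OF A(1)] mW])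
    also have "\<dots> = (\<integral>\<^sup>+\<omega>. exp_neg (rho B s \<omega>) * exp_neg (rho B s \<omega>) * ?u (X (rho B s \<omega>) \<omega>) \<partial>?Q)"
      by (intro nn_integral_cong)
         (auto simp: W_def cemetery_ext_def nn_integral_discounted_total[OF A] split: option.split split_indicator)
    finally show ?thesis .
  qed
  have "(\<integral>\<^sup>+\<omega>. (\<integral>\<^sup>+s\<in>{0<..}. exp_neg (rho B s \<omega>) * \<kappa> \<omega> s \<partial>lborel) \<partial>?Q) =
      (\<integral>\<^sup>+s. (\<integral>\<^sup>+\<omega>. exp_neg (rho B s \<omega>) * \<kappa> \<omega> s * indicator {0<..} s \<partial>?Q) \<partial>lborel)"
    using pair.Fubini'[OF m1] by simp
  also have "\<dots> = (\<integral>\<^sup>+s. (\<integral>\<^sup>+\<omega>. exp_neg (rho B s \<omega>) * exp_neg (rho B s \<omega>) * ?u (X (rho B s \<omega>) \<omega>) * indicator {0<..} s \<partial>?Q) \<partial>lborel)"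
    by (rule nn_integral_cong, rename_tac s, case_tac "0 < s") (simp_all add: fixed_s)
  also have "\<dots> = (\<integral>\<^sup>+\<omega>. (\<integral>\<^sup>+s\<in>{0<..}. exp_neg (rho B s \<omega>) * exp_neg (rho B s \<omega>) * ?u (X (rho B s \<omega>) \<omega>) \<partial>lborel) \<partial>?Q)"
    using pair.Fubini'[OF m2] by simp
  also have "\<dots> = (\<integral>\<^sup>+y. resolvent_density p 2 x y * potential p 1 \<mu> y \<partial>\<nu>)"
    using Revuz_time_change[OF B, of 2 "potential p 1 \<mu>" x] pot unfolding exp_neg_square by simp
  finally show ?thesis unfolding \<kappa>_def .
qed

text \<open>In each half of the square the functional with the earlier time provides the stopping
  time and the other one its potential, which explains the crossed pairing of potentials and
  measures.\<close>

lemma energy: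
  assumes A: "PCAF M X P \<theta> A" "Revuz_corresponds X P p A \<mu>" and B: "PCAF M X P \<theta> B" "Revuz_corresponds X P p B \<nu>"
    and pA: "potential p 1 \<mu> \<in> borel_measurable borel" "potential p 1 \<mu> x < \<infinity>"
    and pB: "potential p 1 \<nu> \<in> borel_measurable borel" "potential p 1 \<nu> x < \<infinity>"
  shows "(\<integral>\<^sup>+\<omega>. discounted_total A \<omega> * discounted_total B \<omega> \<partial>C (Some x)) =
    (\<integral>\<^sup>+y. resolvent_density p 2 x y * potential p 1 \<mu> y \<partial>\<nu>) + (\<integral>\<^sup>+y. resolvent_density p 2 x y * potential p 1 \<nu> y \<partial>\<mu>)"
proof -
  note m = lborel.borel_measurable_nn_integral[OF measurable_tail, of _ _ _ "Some x", simplified]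
  show ?thesis
    unfolding discounted_total_def discounted_product
    by (subst nn_integral_add)
       (use m[OF A(1) B(1), of "\<lambda>t. {t..}"] m[OF B(1) A(1), of "\<lambda>t. {t<..}"]
          energy_half[OF A B pA, of "\<lambda>t. {t..}"] energy_half[OF B A pB, of "\<lambda>t. {t<..}"] in simp_all)
qed

section \<open>Conditional expectation of the discounted total at a fixed time\<close>

lemma const_pre_sigma: "sets (F t) \<subseteq> sets (aug.pre_sigma (\<lambda>_. t))"
proof
  fix A assume A: "A \<in> sets (F t)"
  show "A \<in> sets (aug.pre_sigma (\<lambda>_. t))"
  proof (rule aug.sets_pre_sigmaI[OF stopping_time_const])
    fix t' show "{\<omega> \<in> A. t \<le> t'} \<in> sets (F t')"
      using A aug.sets_F_mono[of t t'] by (cases "t \<le> t'") auto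
  qed
qed

text \<open>The total splits at \<open>t\<close> into the mass already accumulated and a discounted
  total of the shifted path, whose conditional mean is the potential at \<open>X t\<close>. Testing
  against non-negative \<open>W\<close> replaces a conditional expectation operator.\<close>

lemma projection_at_const_time:
  assumes A: "PCAF M X P \<theta> A" "Revuz_corresponds X P p A \<mu>"
    and pA: "potential p 1 \<mu> \<in> borel_measurable borel" "potential p 1 \<mu> x < \<infinity>"
    and t: "0 \<le> t" and W: "W \<in> borel_measurable (F (ennreal t))"
  shows "(\<integral>\<^sup>+\<omega>. W \<omega> * discounted_total A \<omega> \<partial>C (Some x)) = (\<integral>\<^sup>+\<omega>. W \<omega> * (discounted (\<lambda>t. A t \<omega>) (ennreal t) +
      ennreal (exp (- t)) * cemetery_ext (potential p 1 \<mu>) (X (ennreal t) \<omega>)) \<partial>C (Some x))"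
    and "(\<lambda>\<omega>. discounted (\<lambda>t. A t \<omega>) (ennreal t)) \<in> borel_measurable (F (ennreal t))"
proof -
  let ?Q = "C (Some x)" and ?d = "\<lambda>\<omega>. discounted (\<lambda>t. A t \<omega>) (ennreal t)"
  show md: "?d \<in> borel_measurable (F (ennreal t))"
  proof -
    have [measurable]: "(\<lambda>x. min (rho A (snd x) (fst x)) (ennreal t)) \<in> borel_measurable (F (ennreal t) \<Otimes>\<^sub>M lborel)"
      by (rule measurable_min_rho[OF A(1)]) auto
    have "(\<lambda>(\<omega>, r). (if min (rho A r \<omega>) (ennreal t) < ennreal t then exp_neg (min (rho A r \<omega>) (ennreal t)) else 0) *
        indicator {0<..} r) \<in> borel_measurable (F (ennreal t) \<Otimes>\<^sub>M lborel)"
      unfolding split_beta by measurable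
    from lborel.borel_measurable_nn_integral[OF this]
    have "(\<lambda>\<omega>. \<integral>\<^sup>+r. (if min (rho A r \<omega>) (ennreal t) < ennreal t then exp_neg (min (rho A r \<omega>) (ennreal t)) else 0) *
        indicator {0<..} r \<partial>lborel) \<in> borel_measurable (F (ennreal t))" by simp
    also have "(\<lambda>\<omega>. \<integral>\<^sup>+r. (if min (rho A r \<omega>) (ennreal t) < ennreal t then exp_neg (min (rho A r \<omega>) (ennreal t)) else 0) *
        indicator {0<..} r \<partial>lborel) = ?d"
      unfolding discounted_def by (intro ext nn_integral_cong) (auto split: split_indicator simp: min_def)
    finally show ?thesis .
  qed
  let ?u = "cemetery_ext (potential p 1 \<mu>)"
  have st: "stopping_time F (\<lambda>_. ennreal t)" by (rule stopping_time_const)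
  define V where "V \<omega> = W \<omega> * ennreal (exp (- t)) * indicator (- {None}) (X (ennreal t) \<omega>)" for \<omega>
  from measurable_compose[OF measurable_X_augmented[OF order_refl] borel_measurable_alive]
  have "V \<in> borel_measurable (F (ennreal t))" unfolding V_def using W
    by (intro borel_measurable_times_ennreal) auto
  then have mV: "V \<in> borel_measurable (aug.pre_sigma (\<lambda>_. ennreal t))"
    using const_pre_sigma[of "ennreal t"]
    by (rule_tac measurable_from_subalg) (auto simp: subalgebra_def aug.space_F aug.space_pre_sigma)
  have mQ: "W \<in> borel_measurable ?Q" "?d \<in> borel_measurable ?Q"
    using W md by (auto intro: measurable_augmented_completion)
  have mu: "(\<lambda>\<omega>. ?u (X (ennreal t) \<omega>)) \<in> borel_measurable ?Q"
    by (rule measurable_compose[OF measurable_X_completion measurable_cemetery_ext[OF pA(1)]])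
  have mT: "discounted_total A \<in> borel_measurable ?Q" by (rule measurable_augmented_completion[OF measurable_discounted_total[OF A(1)]])
  have fin: "AE \<omega> in ?Q. discounted_total A \<omega> < \<infinity>"
    using nn_integral_PInf_AE[of "discounted_total A" ?Q] nn_integral_discounted_total[OF A] pA mT
    by (auto simp: top.not_eq_extremum)
  have split: "AE \<omega> in ?Q. discounted_total A \<omega> = ?d \<omega> + ennreal (exp (- t)) * indicator (- {None}) (X (ennreal t) \<omega>) * discounted_total A (\<theta> (ennreal t) \<omega>)"
    using PCAF_regular[OF A(1), of x] fin
  proof eventually_elim
    case (elim \<omega>)
    interpret A: clock "\<lambda>t. A t \<omega>" using elim(1) by (rule regularD)
    have At: "A t \<omega> < \<infinity>" using elim(2) t unfolding discounted_total_def by (intro A.finite_if_discounted_finite)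
    have 1: "discounted_total A \<omega> = ?d \<omega> + ennreal (exp (- t)) * discounted_total A (\<theta> (ennreal t) \<omega>)"
      unfolding discounted_total_def using elim(1) t At by (intro A.discounted_split) (auto intro: regularD)
    show ?case
    proof (cases "X (ennreal t) \<omega> = None")
      case True
      \<comment> \<open>On a dead path the functional has stopped, so by additivity its shifted copy
        vanishes. The indicator can therefore be inserted, confining the Revuz formula to starting
        points in S.\<close>
      have "A s (\<theta> (ennreal t) \<omega>) = 0" if "0 \<le> s" for s
      proof -
        have "A t \<omega> + A s (\<theta> (ennreal t) \<omega>) = A t \<omega> + 0"
          using regularD(3)[OF elim(1) t that] regularD(5)[OF elim(1) t True that] by simp
        then show ?thesis using At by (auto simp: ennreal_add_left_cancel)
      qed
      then have "rho A r (\<theta> (ennreal t) \<omega>) = \<infinity>" for r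
        by (auto simp: inverse_time_def top_unique[symmetric] intro!: INF_greatest)
      then have "discounted_total A (\<theta> (ennreal t) \<omega>) = 0" unfolding discounted_total_def discounted_top by simp
      then show ?thesis using 1 by simp
    qed (use 1 in simp)
  qed
  \<comment> \<open>The shifted total enters as a difference of measurable functions to which it is
    almost surely equal; this makes additivity of the integral applicable.\<close>
  have diff: "AE \<omega> in ?Q. W \<omega> * discounted_total A \<omega> = W \<omega> * ?d \<omega> + W \<omega> * (discounted_total A \<omega> - ?d \<omega>) \<and>
      W \<omega> * (discounted_total A \<omega> - ?d \<omega>) = V \<omega> * discounted_total A (\<theta> (ennreal t) \<omega>)"
    using split fin
  proof eventually_elim
    case (elim \<omega>)
    define e where "e = ennreal (exp (- t)) * indicator (- {None}) (X (ennreal t) \<omega>) * discounted_total A (\<theta> (ennreal t) \<omega>)"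
    have e: "discounted_total A \<omega> = ?d \<omega> + e" using elim(1) by (simp add: e_def)
    then have "?d \<omega> \<noteq> top" using elim(2) by auto
    then have "discounted_total A \<omega> - ?d \<omega> = e" unfolding e by simp
    then show ?case using e by (simp add: V_def e_def distrib_left mult.assoc)
  qed
  have "(\<integral>\<^sup>+\<omega>. W \<omega> * discounted_total A \<omega> \<partial>?Q) = (\<integral>\<^sup>+\<omega>. W \<omega> * ?d \<omega> + W \<omega> * (discounted_total A \<omega> - ?d \<omega>) \<partial>?Q)"
    by (rule nn_integral_cong_AE) (use diff in auto)
  also have "\<dots> = (\<integral>\<^sup>+\<omega>. W \<omega> * ?d \<omega> \<partial>?Q) + (\<integral>\<^sup>+\<omega>. W \<omega> * (discounted_total A \<omega> - ?d \<omega>) \<partial>?Q)"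
    using mQ mT by (intro nn_integral_add) auto
  also have "(\<integral>\<^sup>+\<omega>. W \<omega> * (discounted_total A \<omega> - ?d \<omega>) \<partial>?Q) = (\<integral>\<^sup>+\<omega>. V \<omega> * discounted_total A (\<theta> (ennreal t) \<omega>) \<partial>?Q)"
    by (rule nn_integral_cong_AE) (use diff in auto)
  also have "\<dots> = (\<integral>\<^sup>+\<omega>. V \<omega> * (\<integral>\<^sup>+\<omega>'. discounted_total A \<omega>' \<partial>C (X (ennreal t) \<omega>)) \<partial>?Q)"
    by (rule strong_Markov_functional[OF st measurable_discounted_total[OF A(1)] mV])
  also have "\<dots> = (\<integral>\<^sup>+\<omega>. W \<omega> * (ennreal (exp (- t)) * ?u (X (ennreal t) \<omega>)) \<partial>?Q)"
    by (intro nn_integral_cong)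
       (auto simp: V_def cemetery_ext_def nn_integral_discounted_total[OF A] mult.assoc split: option.split split_indicator)
  also have "(\<integral>\<^sup>+\<omega>. W \<omega> * ?d \<omega> \<partial>?Q) + (\<integral>\<^sup>+\<omega>. W \<omega> * (ennreal (exp (- t)) * ?u (X (ennreal t) \<omega>)) \<partial>?Q) =
      (\<integral>\<^sup>+\<omega>. W \<omega> * ?d \<omega> + W \<omega> * (ennreal (exp (- t)) * ?u (X (ennreal t) \<omega>)) \<partial>?Q)"
    using mQ mu by (intro nn_integral_add[symmetric]) auto
  finally show "(\<integral>\<^sup>+\<omega>. W \<omega> * discounted_total A \<omega> \<partial>?Q) = (\<integral>\<^sup>+\<omega>. W \<omega> * (?d \<omega> + ennreal (exp (- t)) * ?u (X (ennreal t) \<omega>)) \<partial>?Q)"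
    by (simp only: distrib_left)
qed

end

section \<open>Doob's inequality\<close>

lemma integrable_mult_square:
  fixes f g :: "'a \<Rightarrow> real"
  assumes [measurable]: "f \<in> borel_measurable Q" "g \<in> borel_measurable Q"
    and "integrable Q (\<lambda>x. (f x)\<^sup>2)" "integrable Q (\<lambda>x. (g x)\<^sup>2)"
  shows "integrable Q (\<lambda>x. f x * g x)"
proof (rule Bochner_Integration.integrable_bound)
  show "integrable Q (\<lambda>x. (f x)\<^sup>2 + (g x)\<^sup>2)" using assms by auto
  show "AE x in Q. norm (f x * g x) \<le> norm ((f x)\<^sup>2 + (g x)\<^sup>2)"
  proof (rule AE_I2)
    fix x
    have "2 * \<bar>f x\<bar> * \<bar>g x\<bar> \<le> (f x)\<^sup>2 + (g x)\<^sup>2"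
      using zero_le_power2[of "\<bar>f x\<bar> - \<bar>g x\<bar>"] by (simp add: power2_diff)
    moreover have "0 \<le> \<bar>f x\<bar> * \<bar>g x\<bar>" by simp
    ultimately have "\<bar>f x\<bar> * \<bar>g x\<bar> \<le> (f x)\<^sup>2 + (g x)\<^sup>2" by linarith
    then show "norm (f x * g x) \<le> norm ((f x)\<^sup>2 + (g x)\<^sup>2)" by (simp add: abs_mult)
  qed
qed measurable

lemma integrable_square_mono:
  fixes f g :: "'a \<Rightarrow> real"
  assumes [measurable]: "f \<in> borel_measurable Q" and "integrable Q (\<lambda>x. (g x)\<^sup>2)"
    and "AE x in Q. \<bar>f x\<bar> \<le> \<bar>g x\<bar>"
  shows "integrable Q (\<lambda>x. (f x)\<^sup>2)"
  by (rule Bochner_Integration.integrable_bound[OF assms(2)])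
     (use assms(3) in \<open>auto simp: abs_le_square_iff\<close>)

lemma integrable_square_add:
  fixes f g :: "'a \<Rightarrow> real"
  assumes [measurable]: "f \<in> borel_measurable Q" "g \<in> borel_measurable Q"
    and "integrable Q (\<lambda>x. (f x)\<^sup>2)" "integrable Q (\<lambda>x. (g x)\<^sup>2)"
  shows "integrable Q (\<lambda>x. (f x + g x)\<^sup>2)" "integrable Q (\<lambda>x. (f x - g x)\<^sup>2)"
  unfolding power2_sum power2_diff
  using assms integrable_mult_square[OF assms] by (auto simp: mult.assoc)

primrec running_max :: "(nat \<Rightarrow> 'a \<Rightarrow> real) \<Rightarrow> nat \<Rightarrow> 'a \<Rightarrow> real" where
  "running_max f 0 \<omega> = 0"
| "running_max f (Suc n) \<omega> = max (running_max f n \<omega>) \<bar>f n \<omega>\<bar>"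

lemma running_max_nonneg: "0 \<le> running_max f n \<omega>"
  by (induction n) auto

lemma le_running_max: "k < n \<Longrightarrow> \<bar>f k \<omega>\<bar> \<le> running_max f n \<omega>"
  by (induction n) (auto simp: less_Suc_eq)

text \<open>
  Summing the increments \<open>s\<^sub>k\<^sub>+\<^sub>1\<^sup>2 - s\<^sub>k\<^sup>2 \<le> 2 \<bar>f\<^sub>k\<bar> (s\<^sub>k\<^sub>+\<^sub>1 - s\<^sub>k)\<close> of the running maximum \<open>s\<close> gives
  \<open>E s\<^sub>n\<^sup>2 \<le> 2 E (\<bar>Y\<bar> s\<^sub>n)\<close>; here \<open>f k\<close> is the conditional expectation of \<open>Y\<close> given \<open>G k\<close>.
\<close>

lemma Doob_L2:
  fixes f :: "nat \<Rightarrow> 'a \<Rightarrow> real" and Y :: "'a \<Rightarrow> real"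
  assumes sub: "\<And>k. k < n \<Longrightarrow> subalgebra Q (G k)" and mono: "\<And>k l. k \<le> l \<Longrightarrow> l < n \<Longrightarrow> sets (G k) \<subseteq> sets (G l)"
    and f: "\<And>k. k < n \<Longrightarrow> f k \<in> borel_measurable (G k)" and f2: "\<And>k. k < n \<Longrightarrow> integrable Q (\<lambda>\<omega>. (f k \<omega>)\<^sup>2)"
    and Y [measurable]: "Y \<in> borel_measurable Q" and Y2: "integrable Q (\<lambda>\<omega>. (Y \<omega>)\<^sup>2)"
    and proj: "\<And>k W. k < n \<Longrightarrow> W \<in> borel_measurable (G k) \<Longrightarrow> (\<And>\<omega>. 0 \<le> W \<omega>) \<Longrightarrow> integrable Q (\<lambda>\<omega>. (W \<omega>)\<^sup>2) \<Longrightarrow>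
      (\<integral>\<omega>. W \<omega> * f k \<omega> \<partial>Q) = (\<integral>\<omega>. W \<omega> * Y \<omega> \<partial>Q)"
  shows "integrable Q (\<lambda>\<omega>. (running_max f n \<omega>)\<^sup>2)"
    and "(\<integral>\<omega>. (running_max f n \<omega>)\<^sup>2 \<partial>Q) \<le> 4 * (\<integral>\<omega>. (Y \<omega>)\<^sup>2 \<partial>Q)"
proof -
  have fQ: "f k \<in> borel_measurable Q" if "k < n" for k
    using measurable_from_subalg[OF sub[OF that] f[OF that]] .
  have fG: "f i \<in> borel_measurable (G k)" if "i \<le> k" "k < n" for i k
  proof (rule measurable_from_subalg[OF _ f])
    show "subalgebra (G k) (G i)"
      using sub[of i] sub[of k] mono[OF that] that by (simp add: subalgebra_def)
  qed (use that in auto)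
  have sG: "running_max f j \<in> borel_measurable (G k)" if "j \<le> Suc k" "k < n" for j k
    using that
  proof (induction j)
    case (Suc j)
    then have "running_max f j \<in> borel_measurable (G k)" "f j \<in> borel_measurable (G k)" using fG by auto
    then show ?case by simp
  qed (simp add: measurable_cong[of _ "running_max f 0" "\<lambda>_. 0"])
  have sQ: "running_max f k \<in> borel_measurable Q" if "k \<le> n" for k
    using that
  proof (induction k)
    case (Suc j)
    then have "running_max f j \<in> borel_measurable Q" "f j \<in> borel_measurable Q" using fQ by auto
    then show ?case by simp
  qed (simp add: measurable_cong[of _ "running_max f 0" "\<lambda>_. 0"])
  have s2: "integrable Q (\<lambda>\<omega>. (running_max f k \<omega>)\<^sup>2)" if "k \<le> n" for k
    using that
  proof (induction k)
    case (Suc k)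
    show ?case
    proof (rule Bochner_Integration.integrable_bound)
      show "integrable Q (\<lambda>\<omega>. (running_max f k \<omega>)\<^sup>2 + (f k \<omega>)\<^sup>2)" using Suc f2[of k] by auto
      show "(\<lambda>\<omega>. (running_max f (Suc k) \<omega>)\<^sup>2) \<in> borel_measurable Q" using sQ[OF Suc.prems] by measurable
      show "AE \<omega> in Q. norm ((running_max f (Suc k) \<omega>)\<^sup>2) \<le> norm ((running_max f k \<omega>)\<^sup>2 + (f k \<omega>)\<^sup>2)"
        by (intro AE_I2) (auto simp: max_def)
    qed
  qed simp
  have Ys: "integrable Q (\<lambda>\<omega>. \<bar>Y \<omega>\<bar> * running_max f k \<omega>)" if "k \<le> n" for k
    using sQ[OF that] s2[OF that] Y2 by (intro integrable_mult_square) auto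
  have main: "(\<integral>\<omega>. (running_max f k \<omega>)\<^sup>2 \<partial>Q) \<le> 2 * (\<integral>\<omega>. \<bar>Y \<omega>\<bar> * running_max f k \<omega> \<partial>Q)" if "k \<le> n" for k
    using that
  proof (induction k)
    case (Suc k)
    then have k: "k < n" by simp
    let ?s = "running_max f"
    \<comment> \<open>The increment of the maximum, restricted to one sign of \<open>f k\<close>:
      the projection property is only available for non-negative weights, so \<bar>f k\<bar> is
      tested by the two signs separately. \<open>Z\<close> depends on indices up to \<open>k\<close>
      and is thus admissible.\<close>
    define Z where "Z \<sigma> \<omega> = (if 0 < \<sigma> * f k \<omega> then ?s (Suc k) \<omega> - ?s k \<omega> else 0)" for \<sigma> :: real and \<omega>
    have Zn: "0 \<le> Z \<sigma> \<omega>" for \<sigma> \<omega> by (simp add: Z_def)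
    have Zle: "Z \<sigma> \<omega> \<le> ?s (Suc k) \<omega>" for \<sigma> \<omega> using running_max_nonneg[of f k \<omega>] by (auto simp: Z_def)
    have mZ: "Z \<sigma> \<in> borel_measurable (G k)" for \<sigma>
      using sG[of "Suc k" k] sG[of k k] f[of k] k unfolding Z_def by simp
    have mZQ: "Z \<sigma> \<in> borel_measurable Q" for \<sigma> by (rule measurable_from_subalg[OF sub[OF k] mZ])
    have Z2: "integrable Q (\<lambda>\<omega>. (Z \<sigma> \<omega>)\<^sup>2)" for \<sigma>
      using Zn Zle by (intro integrable_square_mono[OF mZQ s2[OF Suc.prems]] AE_I2) (metis abs_of_nonneg order_trans)
    have iZf: "integrable Q (\<lambda>\<omega>. Z \<sigma> \<omega> * f k \<omega>)" and iZY: "integrable Q (\<lambda>\<omega>. Z \<sigma> \<omega> * Y \<omega>)" for \<sigma>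
      using mZQ Z2 fQ[OF k] f2[OF k] Y2 by (auto intro!: integrable_mult_square)
    have pr: "(\<integral>\<omega>. Z \<sigma> \<omega> * f k \<omega> \<partial>Q) = (\<integral>\<omega>. Z \<sigma> \<omega> * Y \<omega> \<partial>Q)" for \<sigma>
      by (rule proj[OF k mZ Zn Z2])
    have 1: "(?s (Suc k) \<omega>)\<^sup>2 \<le> (?s k \<omega>)\<^sup>2 + 2 * (Z 1 \<omega> * f k \<omega> - Z (-1) \<omega> * f k \<omega>)" for \<omega>
    proof (cases "\<bar>f k \<omega>\<bar> \<le> ?s k \<omega>")
      case True
      then have "max (?s k \<omega>) \<bar>f k \<omega>\<bar> = ?s k \<omega>" by (rule max_absorb1)
      then show ?thesis by (simp add: Z_def)
    next
      case False
      have "\<bar>f k \<omega>\<bar>\<^sup>2 \<le> (?s k \<omega>)\<^sup>2 + 2 * ((\<bar>f k \<omega>\<bar> - ?s k \<omega>) * \<bar>f k \<omega>\<bar>)"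
        using zero_le_power2[of "\<bar>f k \<omega>\<bar> - ?s k \<omega>"] by (simp add: power2_eq_square algebra_simps)
      then show ?thesis using False running_max_nonneg[of f k \<omega>]
        by (cases "0 < f k \<omega>") (auto simp: Z_def max_def)
    qed
    have 2: "Z 1 \<omega> * Y \<omega> - Z (-1) \<omega> * Y \<omega> \<le> \<bar>Y \<omega>\<bar> * ?s (Suc k) \<omega> - \<bar>Y \<omega>\<bar> * ?s k \<omega>" for \<omega>
    proof -
      have "\<bar>Z 1 \<omega> - Z (-1) \<omega>\<bar> \<le> ?s (Suc k) \<omega> - ?s k \<omega>" by (auto simp: Z_def)
      then have "\<bar>Z 1 \<omega> - Z (-1) \<omega>\<bar> * \<bar>Y \<omega>\<bar> \<le> (?s (Suc k) \<omega> - ?s k \<omega>) * \<bar>Y \<omega>\<bar>" by (rule mult_right_mono) simp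
      moreover have "(Z 1 \<omega> - Z (-1) \<omega>) * Y \<omega> \<le> \<bar>Z 1 \<omega> - Z (-1) \<omega>\<bar> * \<bar>Y \<omega>\<bar>" by (metis abs_ge_self abs_mult)
      ultimately show ?thesis by (simp add: algebra_simps)
    qed
    have "(\<integral>\<omega>. (?s (Suc k) \<omega>)\<^sup>2 \<partial>Q) \<le> (\<integral>\<omega>. (?s k \<omega>)\<^sup>2 + 2 * (Z 1 \<omega> * f k \<omega> - Z (-1) \<omega> * f k \<omega>) \<partial>Q)"
      using 1 s2[OF Suc.prems] s2[of k] k iZf by (intro integral_mono) auto
    also have "\<dots> = (\<integral>\<omega>. (?s k \<omega>)\<^sup>2 \<partial>Q) + 2 * ((\<integral>\<omega>. Z 1 \<omega> * f k \<omega> \<partial>Q) - (\<integral>\<omega>. Z (-1) \<omega> * f k \<omega> \<partial>Q))"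
      using s2[of k] k iZf by simp
    also have "\<dots> = (\<integral>\<omega>. (?s k \<omega>)\<^sup>2 \<partial>Q) + 2 * (\<integral>\<omega>. Z 1 \<omega> * Y \<omega> - Z (-1) \<omega> * Y \<omega> \<partial>Q)"
      using iZY by (simp add: pr)
    also have "(\<integral>\<omega>. Z 1 \<omega> * Y \<omega> - Z (-1) \<omega> * Y \<omega> \<partial>Q) \<le> (\<integral>\<omega>. \<bar>Y \<omega>\<bar> * ?s (Suc k) \<omega> - \<bar>Y \<omega>\<bar> * ?s k \<omega> \<partial>Q)"
      using iZY Ys[OF Suc.prems] Ys[of k] k 2 by (intro integral_mono Bochner_Integration.integrable_diff) auto
    also have "\<dots> = (\<integral>\<omega>. \<bar>Y \<omega>\<bar> * ?s (Suc k) \<omega> \<partial>Q) - (\<integral>\<omega>. \<bar>Y \<omega>\<bar> * ?s k \<omega> \<partial>Q)"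
      using Ys[OF Suc.prems] Ys[of k] k by (intro Bochner_Integration.integral_diff) auto
    finally show ?case using Suc.IH k by simp
  qed simp
  show "integrable Q (\<lambda>\<omega>. (running_max f n \<omega>)\<^sup>2)" by (rule s2) simp
  have "(\<integral>\<omega>. (running_max f n \<omega>)\<^sup>2 \<partial>Q) \<le> (\<integral>\<omega>. 2 * (\<bar>Y \<omega>\<bar> * running_max f n \<omega>) \<partial>Q)"
    using main[of n] by simp
  \<comment> \<open>Young's inequality with weights 2 and 1/2; half of the left side is absorbed,
    which yields the factor 4.\<close>
  also have "\<dots> \<le> (\<integral>\<omega>. 2 * (Y \<omega>)\<^sup>2 + (running_max f n \<omega>)\<^sup>2 / 2 \<partial>Q)"
  proof (rule integral_mono)
    show "2 * (\<bar>Y \<omega>\<bar> * running_max f n \<omega>) \<le> 2 * (Y \<omega>)\<^sup>2 + (running_max f n \<omega>)\<^sup>2 / 2" for \<omega>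
      using zero_le_power2[of "2 * \<bar>Y \<omega>\<bar> - running_max f n \<omega>"] by (simp add: power2_diff power_mult_distrib)
  qed (use Ys[of n] s2[of n] Y2 in auto)
  also have "\<dots> = 2 * (\<integral>\<omega>. (Y \<omega>)\<^sup>2 \<partial>Q) + (\<integral>\<omega>. (running_max f n \<omega>)\<^sup>2 \<partial>Q) / 2"
    using s2[of n] Y2 by simp
  finally show "(\<integral>\<omega>. (running_max f n \<omega>)\<^sup>2 \<partial>Q) \<le> 4 * (\<integral>\<omega>. (Y \<omega>)\<^sup>2 \<partial>Q)" by simp
qed

section \<open>The projection formula for real square-integrable functions\<close>

lemma resolvent_density_antimono: "\<alpha> \<le> \<beta> \<Longrightarrow> resolvent_density p \<beta> x y \<le> resolvent_density p \<alpha> x y"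
  unfolding resolvent_density_def
  by (intro nn_integral_mono) (auto split: split_indicator intro!: mult_right_mono ennreal_leI)

lemma potential_antimono: "\<alpha> \<le> \<beta> \<Longrightarrow> potential p \<beta> \<mu> x \<le> potential p \<alpha> \<mu> x"
  unfolding potential_def by (intro nn_integral_mono resolvent_density_antimono)

context locally_compact_process
begin

text \<open>Real-valued version of the projection formula, so that two functionals can be
  subtracted. The bound \<open>K\<close> on the potential dominates \<open>f\<close> by the total
  plus \<open>K\<close>, and square integrability follows.\<close>

lemma integral_projection:
  assumes A: "PCAF M X P \<theta> A" "Revuz_corresponds X P p A \<mu>"
    and pA: "potential p 1 \<mu> \<in> borel_measurable borel" "\<And>y. potential p 1 \<mu> y \<le> ennreal K" and K: "0 \<le> K"
    and g2: "integrable (C (Some x)) (\<lambda>\<omega>. (enn2real (discounted_total A \<omega>))\<^sup>2)"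
    and t: "0 \<le> t"
  defines "f \<equiv> \<lambda>\<omega>. enn2real (discounted (\<lambda>t. A t \<omega>) (ennreal t)) +
      exp (- t) * enn2real (cemetery_ext (potential p 1 \<mu>) (X (ennreal t) \<omega>))"
  shows "f \<in> borel_measurable (F (ennreal t))" "integrable (C (Some x)) (\<lambda>\<omega>. (f \<omega>)\<^sup>2)"
    and "W \<in> borel_measurable (F (ennreal t)) \<Longrightarrow> (\<And>\<omega>. 0 \<le> W \<omega>) \<Longrightarrow> integrable (C (Some x)) (\<lambda>\<omega>. (W \<omega>)\<^sup>2) \<Longrightarrow>
      (\<integral>\<omega>. W \<omega> * f \<omega> \<partial>C (Some x)) = (\<integral>\<omega>. W \<omega> * enn2real (discounted_total A \<omega>) \<partial>C (Some x))"
proof -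
  let ?Q = "C (Some x)" and ?g = "\<lambda>\<omega>. enn2real (discounted_total A \<omega>)"
  let ?d = "\<lambda>\<omega>. discounted (\<lambda>t. A t \<omega>) (ennreal t)" and ?u = "\<lambda>\<omega>. cemetery_ext (potential p 1 \<mu>) (X (ennreal t) \<omega>)"
  interpret prob_space ?Q by (rule prob_space_completion)
  have fx: "potential p 1 \<mu> x < \<infinity>" using pA(2)[of x] by (auto intro: le_less_trans)
  note pr = projection_at_const_time[OF A pA(1) fx t]
  have md: "?d \<in> borel_measurable (F (ennreal t))" by (rule pr(2)[of "\<lambda>_. 0"]) simp
  have mu: "?u \<in> borel_measurable (F (ennreal t))"
    by (rule measurable_compose[OF measurable_X_augmented[OF order_refl] measurable_cemetery_ext[OF pA(1)]])
  show mf: "f \<in> borel_measurable (F (ennreal t))" unfolding f_def using md mu by measurable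
  have mfQ: "f \<in> borel_measurable ?Q" by (rule measurable_augmented_completion[OF mf])
  have mT: "discounted_total A \<in> borel_measurable ?Q" by (rule measurable_augmented_completion[OF measurable_discounted_total[OF A(1)]])
  then have mg: "?g \<in> borel_measurable ?Q" by measurable
  have fin: "AE \<omega> in ?Q. discounted_total A \<omega> < \<infinity>"
    using nn_integral_PInf_AE[of "discounted_total A" ?Q] nn_integral_discounted_total[OF A] fx mT
    by (auto simp: top.not_eq_extremum)
  have uK: "?u \<omega> \<le> ennreal K" for \<omega> using pA(2) by (auto simp: cemetery_ext_def split: option.split)
  have dle: "?d \<omega> \<le> discounted_total A \<omega>" for \<omega>
    unfolding discounted_total_def discounted_top discounted_def by (intro nn_integral_mono) (auto split: split_indicator)
  have f0: "0 \<le> f \<omega>" for \<omega> by (simp add: f_def)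
  have gK2: "integrable ?Q (\<lambda>\<omega>. (?g \<omega> + K)\<^sup>2)" using mg g2 by (intro integrable_square_add) auto
  show "integrable ?Q (\<lambda>\<omega>. (f \<omega>)\<^sup>2)"
  proof (rule integrable_square_mono[OF mfQ gK2], use fin in eventually_elim)
    case (elim \<omega>)
    have "enn2real (?d \<omega>) \<le> ?g \<omega>" using dle[of \<omega>] elim by (intro enn2real_mono) auto
    moreover have "exp (- t) * enn2real (?u \<omega>) \<le> 1 * K"
      using uK[of \<omega>] K t by (intro mult_mono) (auto simp: enn2real_leI)
    ultimately show ?case using f0[of \<omega>] K unfolding f_def by simp
  qed
  assume W: "W \<in> borel_measurable (F (ennreal t))" "\<And>\<omega>. 0 \<le> W \<omega>" "integrable ?Q (\<lambda>\<omega>. (W \<omega>)\<^sup>2)"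
  have mW: "W \<in> borel_measurable ?Q" by (rule measurable_augmented_completion[OF W(1)])
  have "(\<integral>\<^sup>+\<omega>. ennreal (W \<omega> * f \<omega>) \<partial>?Q) = (\<integral>\<^sup>+\<omega>. ennreal (W \<omega>) * (?d \<omega> + ennreal (exp (- t)) * ?u \<omega>) \<partial>?Q)"
  proof (rule nn_integral_cong_AE, use fin in eventually_elim)
    case (elim \<omega>)
    have "?d \<omega> < top" "?u \<omega> < top" using dle[of \<omega>] elim uK[of \<omega>] by (auto intro: le_less_trans)
    then have "?d \<omega> + ennreal (exp (- t)) * ?u \<omega> = ennreal (f \<omega>)"
      unfolding f_def by (simp add: ennreal_mult)
    then show ?case using W(2) f0 by (simp add: ennreal_mult)
  qed
  also have "\<dots> = (\<integral>\<^sup>+\<omega>. ennreal (W \<omega>) * discounted_total A \<omega> \<partial>?Q)"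
    using pr(1)[of "\<lambda>\<omega>. ennreal (W \<omega>)"] W(1) by simp
  also have "\<dots> = (\<integral>\<^sup>+\<omega>. ennreal (W \<omega> * ?g \<omega>) \<partial>?Q)"
    by (rule nn_integral_cong_AE, use fin in eventually_elim) (use W(2) in \<open>simp add: ennreal_mult\<close>)
  finally show "(\<integral>\<omega>. W \<omega> * f \<omega> \<partial>?Q) = (\<integral>\<omega>. W \<omega> * ?g \<omega> \<partial>?Q)"
    using W(2) f0 mW mfQ mg by (subst (1 2) integral_eq_nn_integral) auto
qed

end

section \<open>Comparison of two functionals\<close>

text \<open>\<open>A\<close> and \<open>\<mu>\<close> stand for a member of the sequence,
  \<open>B\<close> and \<open>\<nu>\<close> for the limit: a quantitative bound \<open>V\<close> is
  available for the limit alone. The one-sided comparisons are those that replace the diagonal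
  energy terms by mixed ones.\<close>

locale functional_pair = locally_compact_process M X P \<theta>
  for M :: "'w measure"
    and X :: "ennreal \<Rightarrow> 'w \<Rightarrow> 's::{metric_space, second_countable_topology} option"
    and P :: "'s option \<Rightarrow> 'w measure"
    and \<theta> :: "ennreal \<Rightarrow> 'w \<Rightarrow> 'w" +
  fixes p :: "real \<Rightarrow> 's \<Rightarrow> 's \<Rightarrow> ennreal" and A B :: "real \<Rightarrow> 'w \<Rightarrow> ennreal" and \<mu> \<nu> :: "'s measure"
    and \<epsilon> V :: real
  assumes PCAF_A: "PCAF M X P \<theta> A" and PCAF_B: "PCAF M X P \<theta> B"
    and Revuz_A: "Revuz_corresponds X P p A \<mu>" and Revuz_B: "Revuz_corresponds X P p B \<nu>"
    and sets_\<mu>: "sets \<mu> = sets borel" and sets_\<nu>: "sets \<nu> = sets borel"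
    and measurable_potential: "potential p 1 \<mu> \<in> borel_measurable borel" "potential p 1 \<nu> \<in> borel_measurable borel"
    and measurable_resolvent: "resolvent_density p 2 x \<in> borel_measurable borel"
    and finite_\<mu>: "potential p 1 \<mu> x < \<infinity>" and bound_\<nu>: "potential p 1 \<nu> x \<le> ennreal V"
    and nonneg: "0 \<le> \<epsilon>" "0 \<le> V"
    and close_\<mu>: "AE y in \<mu>. potential p 1 \<mu> y \<le> potential p 1 \<nu> y + ennreal \<epsilon>"
    and close_\<nu>: "AE y in \<nu>. potential p 1 \<nu> y \<le> potential p 1 \<mu> y + ennreal \<epsilon>"
begin

abbreviation U where "U \<equiv> potential p 1 \<mu>"
abbreviation V' where "V' \<equiv> potential p 1 \<nu>"
abbreviation GA where "GA \<equiv> discounted_total A"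
abbreviation GB where "GB \<equiv> discounted_total B"

lemma measurable_resolvent' [measurable]:
  "resolvent_density p 2 x \<in> borel_measurable \<mu>" "resolvent_density p 2 x \<in> borel_measurable \<nu>"
  using measurable_resolvent by (simp_all add: measurable_cong_sets[OF sets_\<mu> refl] measurable_cong_sets[OF sets_\<nu> refl])

lemma measurable_potential' [measurable]:
  "U \<in> borel_measurable \<mu>" "U \<in> borel_measurable \<nu>" "V' \<in> borel_measurable \<mu>" "V' \<in> borel_measurable \<nu>"
  using measurable_potential by (simp_all add: measurable_cong_sets[OF sets_\<mu> refl] measurable_cong_sets[OF sets_\<nu> refl])

lemma finite_\<nu>: "V' x < \<infinity>"
  using bound_\<nu>[of x] by (auto intro: le_less_trans)

lemma measurable_G: "GA \<in> borel_measurable (C z)" "GB \<in> borel_measurable (C z)"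
  using PCAF_A PCAF_B by (auto intro: measurable_augmented_completion measurable_discounted_total)

lemmas E_GA = nn_integral_discounted_total[OF PCAF_A Revuz_A]
lemmas E_GB = nn_integral_discounted_total[OF PCAF_B Revuz_B]

lemma finite_G: "AE \<omega> in C (Some x). GA \<omega> < \<infinity>" "AE \<omega> in C (Some x). GB \<omega> < \<infinity>"
  using nn_integral_PInf_AE[OF measurable_G(1), of "Some x"] nn_integral_PInf_AE[OF measurable_G(2), of "Some x"]
    E_GA[of x] E_GB[of x] finite_\<mu>[of x] finite_\<nu>[of x]
  by (auto simp: top.not_eq_extremum)

lemmas energy_AA = energy[OF PCAF_A Revuz_A PCAF_A Revuz_A measurable_potential(1) finite_\<mu> measurable_potential(1) finite_\<mu>]
lemmas energy_BB = energy[OF PCAF_B Revuz_B PCAF_B Revuz_B measurable_potential(2) finite_\<nu> measurable_potential(2) finite_\<nu>]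
lemmas energy_AB = energy[OF PCAF_A Revuz_A PCAF_B Revuz_B measurable_potential(1) finite_\<mu> measurable_potential(2) finite_\<nu>]

lemma square_mean_le:
  assumes [measurable]: "g \<in> borel_measurable (C z)"
  shows "(\<integral>\<^sup>+\<omega>. g \<omega> \<partial>C z) * (\<integral>\<^sup>+\<omega>. g \<omega> \<partial>C z) \<le> (\<integral>\<^sup>+\<omega>. g \<omega> * g \<omega> \<partial>C z)"
proof -
  interpret prob_space "C z" by (rule prob_space_completion)
  show ?thesis using Cauchy_Schwarz_nn_integral[of g "C z" "\<lambda>_. 1"] by (simp add: power2_eq_square emeasure_space_1[simplified])
qed

text \<open>
  A maximum principle up to the factor 2: \<open>U\<^sup>2 \<le> E GA\<^sup>2 \<le> 2 \<parallel>U\<parallel> U\<close> with the norm in \<open>L\<^sup>\<infinity>(\<mu>)\<close>.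
\<close>

lemma bound_\<mu>: "U x \<le> ennreal (2 * (V + \<epsilon>))"
proof -
  have "U x * U x \<le> (\<integral>\<^sup>+\<omega>. GA \<omega> * GA \<omega> \<partial>C (Some x))"
    using square_mean_le[OF measurable_G(1), of "Some x"] by (simp add: E_GA)
  also have "\<dots> = (\<integral>\<^sup>+y. resolvent_density p 2 x y * U y \<partial>\<mu>) + (\<integral>\<^sup>+y. resolvent_density p 2 x y * U y \<partial>\<mu>)"
    by (rule energy_AA)
  also have "(\<integral>\<^sup>+y. resolvent_density p 2 x y * U y \<partial>\<mu>) \<le> (\<integral>\<^sup>+y. resolvent_density p 2 x y * ennreal (V + \<epsilon>) \<partial>\<mu>)"
  proof (rule nn_integral_mono_AE, use close_\<mu> in eventually_elim)
    case (elim y)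
    have "U y \<le> ennreal V + ennreal \<epsilon>" using elim bound_\<nu>[of y] by (meson add_right_mono order_trans)
    then show ?case using nonneg by (intro mult_left_mono) auto
  qed
  also have "\<dots> = potential p 2 \<mu> x * ennreal (V + \<epsilon>)"
    unfolding potential_def by (rule nn_integral_multc) measurable
  also have "\<dots> \<le> U x * ennreal (V + \<epsilon>)" by (intro mult_right_mono potential_antimono) auto
  finally have "U x * U x \<le> U x * ennreal (V + \<epsilon>) + U x * ennreal (V + \<epsilon>)" by (simp add: add_mono)
  also have "\<dots> = U x * ennreal (2 * (V + \<epsilon>))"
  proof -
    have "ennreal (V + \<epsilon>) + ennreal (V + \<epsilon>) = ennreal (2 * (V + \<epsilon>))"
      using nonneg by (subst ennreal_plus[symmetric]) auto
    then show ?thesis by (simp only: distrib_left[symmetric])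
  qed
  finally have le: "U x * U x \<le> U x * ennreal (2 * (V + \<epsilon>))" .
  \<comment> \<open>One factor of the potential is divided out; its finiteness, known only
    qualitatively so far, is what permits this.\<close>
  obtain c where c: "U x = ennreal c" "0 \<le> c" using finite_\<mu>[of x] by (cases "U x") auto
  show ?thesis
  proof (cases "c = 0")
    case False
    have "ennreal (c * c) = U x * U x" "ennreal (c * (2 * (V + \<epsilon>))) = U x * ennreal (2 * (V + \<epsilon>))"
      unfolding c(1) using c(2) nonneg by (intro ennreal_mult; simp)+
    with le have "ennreal (c * c) \<le> ennreal (c * (2 * (V + \<epsilon>)))" by (simp only:)
    then have "c * c \<le> c * (2 * (V + \<epsilon>))" using c nonneg by (subst (asm) ennreal_le_iff) auto
    then have "c \<le> 2 * (V + \<epsilon>)" 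
      by (rule mult_left_le_imp_le) (use False c(2) in auto)
    then show ?thesis using c by (simp add: ennreal_leI)
  qed (use c in simp)
qed

definition K where "K = 2 * (V + \<epsilon>)"
text \<open>Bound for the mean square of the difference of totals: four energy integrals are
  altered, each at a cost of at most \<epsilon> times the common bound \<open>K\<close> of the
  potentials.\<close>

definition \<kappa> where "\<kappa> = 4 * \<epsilon> * K"

lemma K: "0 \<le> K" "U x \<le> ennreal K" "V' x \<le> ennreal K" "0 \<le> \<kappa>"
proof -
  show "U x \<le> ennreal K" using bound_\<mu> by (simp add: K_def)
  have "ennreal V \<le> ennreal K" using nonneg by (intro ennreal_leI) (simp add: K_def)
  then show "V' x \<le> ennreal K" using bound_\<nu>[of x] by (rule order_trans[rotated])
qed (use nonneg in \<open>auto simp: K_def \<kappa>_def\<close>)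

lemma finite_energy:
  assumes f: "\<And>y. f y \<le> ennreal K" and \<xi>: "potential p 1 \<xi> x \<le> ennreal K"
    and m: "resolvent_density p 2 x \<in> borel_measurable \<xi>"
  shows "(\<integral>\<^sup>+y. resolvent_density p 2 x y * f y \<partial>\<xi>) < \<infinity>"
proof -
  have "(\<integral>\<^sup>+y. resolvent_density p 2 x y * f y \<partial>\<xi>) \<le> (\<integral>\<^sup>+y. resolvent_density p 2 x y * ennreal K \<partial>\<xi>)"
    by (intro nn_integral_mono mult_left_mono f) auto
  also have "\<dots> = potential p 2 \<xi> x * ennreal K" unfolding potential_def by (rule nn_integral_multc[OF m])
  also have "\<dots> \<le> ennreal K * ennreal K" by (intro mult_right_mono order_trans[OF potential_antimono \<xi>]) auto
  also have "\<dots> < \<infinity>" by (simp add: ennreal_mult_less_top)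
  finally show ?thesis .
qed

section \<open>The mean square of the difference of the totals\<close>

definition Y where "Y \<omega> = enn2real (GA \<omega>) - enn2real (GB \<omega>)"

lemma measurable_Y [measurable]: "Y \<in> borel_measurable (C z)"
  unfolding Y_def using measurable_G by measurable

text \<open>The square is expanded additively to avoid subtraction in \<open>ennreal\<close>. In the
  diagonal energies, exchanging the potentials under \<open>\<mu>\<close> and under
  \<open>\<nu>\<close> produces exactly twice the mixed energy plus error; being finite, the mixed
  energy cancels.\<close>

lemma nn_integral_Y_square: "(\<integral>\<^sup>+\<omega>. ennreal ((Y \<omega>)\<^sup>2) \<partial>C (Some x)) \<le> ennreal \<kappa>"
proof -
  let ?Q = "C (Some x)" and ?r = "resolvent_density p 2 x"
  note [measurable] = measurable_G
  define I where "I = (\<integral>\<^sup>+\<omega>. ennreal ((Y \<omega>)\<^sup>2) \<partial>?Q)"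
  define c where "c = (\<integral>\<^sup>+\<omega>. GA \<omega> * GB \<omega> \<partial>?Q)"
  have "I + (c + c) = (\<integral>\<^sup>+\<omega>. ennreal ((Y \<omega>)\<^sup>2) + (GA \<omega> * GB \<omega> + GA \<omega> * GB \<omega>) \<partial>?Q)"
    unfolding I_def c_def by (simp add: nn_integral_add)
  also have "\<dots> = (\<integral>\<^sup>+\<omega>. GA \<omega> * GA \<omega> + GB \<omega> * GB \<omega> \<partial>?Q)"
  proof (rule nn_integral_cong_AE, use finite_G[of x] in eventually_elim)
    case (elim \<omega>)
    obtain a b where ab: "GA \<omega> = ennreal a" "0 \<le> a" "GB \<omega> = ennreal b" "0 \<le> b"
      using elim by (cases "GA \<omega>"; cases "GB \<omega>") auto
    have "(a - b)\<^sup>2 + (a * b + a * b) = a * a + b * b" by (simp add: power2_eq_square algebra_simps)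
    moreover have "0 \<le> a * b" using ab by simp
    ultimately show ?case
      unfolding Y_def using ab by (simp flip: ennreal_mult ennreal_plus)
  qed
  also have "\<dots> = (\<integral>\<^sup>+\<omega>. GA \<omega> * GA \<omega> \<partial>?Q) + (\<integral>\<^sup>+\<omega>. GB \<omega> * GB \<omega> \<partial>?Q)"
    by (intro nn_integral_add) measurable
  also have "\<dots> = ((\<integral>\<^sup>+y. ?r y * U y \<partial>\<mu>) + (\<integral>\<^sup>+y. ?r y * U y \<partial>\<mu>)) +
      ((\<integral>\<^sup>+y. ?r y * V' y \<partial>\<nu>) + (\<integral>\<^sup>+y. ?r y * V' y \<partial>\<nu>))"
    by (simp add: energy_AA energy_BB)
  finally have eq: "I + (c + c) = \<dots>" .
  have 1: "(\<integral>\<^sup>+y. ?r y * U y \<partial>\<mu>) \<le> (\<integral>\<^sup>+y. ?r y * V' y \<partial>\<mu>) + ennreal (\<epsilon> * K)"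
  proof -
    have "(\<integral>\<^sup>+y. ?r y * U y \<partial>\<mu>) \<le> (\<integral>\<^sup>+y. ?r y * V' y + ?r y * ennreal \<epsilon> \<partial>\<mu>)"
      by (rule nn_integral_mono_AE, use close_\<mu> in eventually_elim) (simp add: mult_left_mono flip: distrib_left)
    also have "\<dots> = (\<integral>\<^sup>+y. ?r y * V' y \<partial>\<mu>) + (\<integral>\<^sup>+y. ?r y * ennreal \<epsilon> \<partial>\<mu>)"
      by (rule nn_integral_add) measurable
    also have "(\<integral>\<^sup>+y. ?r y * ennreal \<epsilon> \<partial>\<mu>) = potential p 2 \<mu> x * ennreal \<epsilon>"
      unfolding potential_def by (rule nn_integral_multc) measurable
    also have "potential p 2 \<mu> x * ennreal \<epsilon> \<le> ennreal K * ennreal \<epsilon>"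
      by (intro mult_right_mono order_trans[OF potential_antimono K(2)]) auto
    also have "\<dots> = ennreal (\<epsilon> * K)" using nonneg K(1) by (simp add: ennreal_mult mult.commute)
    finally show ?thesis by (simp add: add_left_mono)
  qed
  have 2: "(\<integral>\<^sup>+y. ?r y * V' y \<partial>\<nu>) \<le> (\<integral>\<^sup>+y. ?r y * U y \<partial>\<nu>) + ennreal (\<epsilon> * K)"
  proof -
    have "(\<integral>\<^sup>+y. ?r y * V' y \<partial>\<nu>) \<le> (\<integral>\<^sup>+y. ?r y * U y + ?r y * ennreal \<epsilon> \<partial>\<nu>)"
      by (rule nn_integral_mono_AE, use close_\<nu> in eventually_elim) (simp add: mult_left_mono flip: distrib_left)
    also have "\<dots> = (\<integral>\<^sup>+y. ?r y * U y \<partial>\<nu>) + (\<integral>\<^sup>+y. ?r y * ennreal \<epsilon> \<partial>\<nu>)"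
      by (rule nn_integral_add) measurable
    also have "(\<integral>\<^sup>+y. ?r y * ennreal \<epsilon> \<partial>\<nu>) = potential p 2 \<nu> x * ennreal \<epsilon>"
      unfolding potential_def by (rule nn_integral_multc) measurable
    also have "potential p 2 \<nu> x * ennreal \<epsilon> \<le> ennreal K * ennreal \<epsilon>"
      by (intro mult_right_mono order_trans[OF potential_antimono K(3)]) auto
    also have "\<dots> = ennreal (\<epsilon> * K)" using nonneg K(1) by (simp add: ennreal_mult mult.commute)
    finally show ?thesis by (simp add: add_left_mono)
  qed
  have c: "c = (\<integral>\<^sup>+y. ?r y * U y \<partial>\<nu>) + (\<integral>\<^sup>+y. ?r y * V' y \<partial>\<mu>)" unfolding c_def by (rule energy_AB)
  have cfin: "c < \<infinity>" unfolding c using finite_energy[of U \<nu>] finite_energy[of V' \<mu>] K by (simp add: measurable_resolvent')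
  have "I + (c + c) \<le> ((\<integral>\<^sup>+y. ?r y * V' y \<partial>\<mu>) + ennreal (\<epsilon> * K) + ((\<integral>\<^sup>+y. ?r y * V' y \<partial>\<mu>) + ennreal (\<epsilon> * K))) +
      ((\<integral>\<^sup>+y. ?r y * U y \<partial>\<nu>) + ennreal (\<epsilon> * K) + ((\<integral>\<^sup>+y. ?r y * U y \<partial>\<nu>) + ennreal (\<epsilon> * K)))"
    unfolding eq by (intro add_mono 1 2)
  also have "\<dots> = (ennreal (\<epsilon> * K) + ennreal (\<epsilon> * K) + ennreal (\<epsilon> * K) + ennreal (\<epsilon> * K)) + (c + c)"
    unfolding c by (simp add: ac_simps)
  also have "ennreal (\<epsilon> * K) + ennreal (\<epsilon> * K) + ennreal (\<epsilon> * K) + ennreal (\<epsilon> * K) = ennreal \<kappa>"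
    using nonneg K(1) by (simp add: \<kappa>_def flip: ennreal_plus)
  finally have "(c + c) + I \<le> (c + c) + ennreal \<kappa>" by (simp only: add.commute)
  then have "I \<le> ennreal \<kappa>" using cfin by (auto simp: ennreal_add_left_cancel_le)
  then show ?thesis by (simp add: I_def)
qed

lemma integrable_Y_square: "integrable (C (Some x)) (\<lambda>\<omega>. (Y \<omega>)\<^sup>2)"
  and integral_Y_square: "(\<integral>\<omega>. (Y \<omega>)\<^sup>2 \<partial>C (Some x)) \<le> \<kappa>"
proof -
  have "(\<integral>\<^sup>+\<omega>. ennreal ((Y \<omega>)\<^sup>2) \<partial>C (Some x)) < \<infinity>" using nn_integral_Y_square[of x] by (auto intro: le_less_trans)
  then show i: "integrable (C (Some x)) (\<lambda>\<omega>. (Y \<omega>)\<^sup>2)" by (intro integrableI_nonneg) auto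
  have "ennreal (\<integral>\<omega>. (Y \<omega>)\<^sup>2 \<partial>C (Some x)) \<le> ennreal \<kappa>"
    using nn_integral_Y_square[of x] by (simp add: nn_integral_eq_integral[OF i])
  then show "(\<integral>\<omega>. (Y \<omega>)\<^sup>2 \<partial>C (Some x)) \<le> \<kappa>" using K(4) by (simp add: ennreal_le_iff)
qed

lemma integrable_G_square:
  "integrable (C (Some x)) (\<lambda>\<omega>. (enn2real (GA \<omega>))\<^sup>2)" "integrable (C (Some x)) (\<lambda>\<omega>. (enn2real (GB \<omega>))\<^sup>2)"
proof -
  have *: "integrable (C (Some x)) (\<lambda>\<omega>. (enn2real (G \<omega>))\<^sup>2)"
    if [measurable]: "G \<in> borel_measurable (C (Some x))" and fin: "(\<integral>\<^sup>+\<omega>. G \<omega> * G \<omega> \<partial>C (Some x)) < \<infinity>" for G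
  proof (rule integrableI_nonneg)
    have "(\<integral>\<^sup>+\<omega>. ennreal ((enn2real (G \<omega>))\<^sup>2) \<partial>C (Some x)) \<le> (\<integral>\<^sup>+\<omega>. G \<omega> * G \<omega> \<partial>C (Some x))"
    proof (rule nn_integral_mono)
      fix \<omega> show "ennreal ((enn2real (G \<omega>))\<^sup>2) \<le> G \<omega> * G \<omega>"
        by (cases "G \<omega>") (auto simp: power2_eq_square ennreal_mult)
    qed
    then show "(\<integral>\<^sup>+\<omega>. ennreal ((enn2real (G \<omega>))\<^sup>2) \<partial>C (Some x)) < \<infinity>" using fin by (rule le_less_trans)
  qed auto
  show "integrable (C (Some x)) (\<lambda>\<omega>. (enn2real (GA \<omega>))\<^sup>2)"
    by (rule *[OF measurable_G(1)]) (use finite_energy[of U \<mu>] K in \<open>simp add: energy_AA measurable_resolvent'\<close>)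
  show "integrable (C (Some x)) (\<lambda>\<omega>. (enn2real (GB \<omega>))\<^sup>2)"
    by (rule *[OF measurable_G(2)]) (use finite_energy[of V' \<nu>] K in \<open>simp add: energy_BB measurable_resolvent'\<close>)
qed

text \<open>The difference of potentials is the mean of \<open>Y\<close>, and the variance is
  non-negative. An almost everywhere hypothesis thus becomes a bound at every point, as the position
  of the process at time t demands.\<close>

lemma potential_difference: "\<bar>enn2real (U x) - enn2real (V' x)\<bar> \<le> sqrt \<kappa>"
proof -
  interpret prob_space "C (Some x)" by (rule prob_space_completion)
  have iG: "integrable (C (Some x)) (\<lambda>\<omega>. enn2real (G \<omega>)) \<and> (\<integral>\<omega>. enn2real (G \<omega>) \<partial>C (Some x)) = enn2real c"
    if [measurable]: "G \<in> borel_measurable (C (Some x))" and G: "(\<integral>\<^sup>+\<omega>. G \<omega> \<partial>C (Some x)) = c" and c: "c < \<infinity>"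
      and fin: "AE \<omega> in C (Some x). G \<omega> < \<infinity>" for G c
  proof -
    have e: "(\<integral>\<^sup>+\<omega>. ennreal (enn2real (G \<omega>)) \<partial>C (Some x)) = c"
      unfolding G[symmetric] by (rule nn_integral_cong_AE, use fin in eventually_elim) simp
    show ?thesis using e c by (auto intro!: integrableI_nonneg simp: integral_eq_nn_integral)
  qed
  have A: "integrable (C (Some x)) (\<lambda>\<omega>. enn2real (GA \<omega>))" "(\<integral>\<omega>. enn2real (GA \<omega>) \<partial>C (Some x)) = enn2real (U x)"
    using iG[OF measurable_G(1) E_GA finite_\<mu> finite_G(1)] by auto
  have B: "integrable (C (Some x)) (\<lambda>\<omega>. enn2real (GB \<omega>))" "(\<integral>\<omega>. enn2real (GB \<omega>) \<partial>C (Some x)) = enn2real (V' x)"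
    using iG[OF measurable_G(2) E_GB finite_\<nu> finite_G(2)] by auto
  have Y: "integrable (C (Some x)) Y" "(\<integral>\<omega>. Y \<omega> \<partial>C (Some x)) = enn2real (U x) - enn2real (V' x)"
    unfolding Y_def[abs_def] using A B by auto
  have "0 \<le> variance Y" by (rule variance_positive)
  then have "(expectation Y)\<^sup>2 \<le> expectation (\<lambda>\<omega>. (Y \<omega>)\<^sup>2)" using variance_eq[OF Y(1) integrable_Y_square] by simp
  then have "(enn2real (U x) - enn2real (V' x))\<^sup>2 \<le> \<kappa>" using integral_Y_square[of x] Y(2) by simp
  then show ?thesis by (metis real_sqrt_abs real_sqrt_le_mono)
qed

section \<open>The maximal estimate for the discounted difference\<close>

definition D where "D t \<omega> = enn2real (discounted (\<lambda>t. A t \<omega>) (ennreal t)) - enn2real (discounted (\<lambda>t. B t \<omega>) (ennreal t))"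

definition N where "N t \<omega> = enn2real (discounted (\<lambda>t. A t \<omega>) (ennreal t)) + exp (- t) * enn2real (cemetery_ext U (X (ennreal t) \<omega>)) -
   (enn2real (discounted (\<lambda>t. B t \<omega>) (ennreal t)) + exp (- t) * enn2real (cemetery_ext V' (X (ennreal t) \<omega>)))"

lemma D_le_N: assumes "0 \<le> t" shows "\<bar>D t \<omega>\<bar> \<le> \<bar>N t \<omega>\<bar> + sqrt \<kappa>"
proof -
  define h where "h = enn2real (cemetery_ext U (X (ennreal t) \<omega>)) - enn2real (cemetery_ext V' (X (ennreal t) \<omega>))"
  have "\<bar>h\<bar> \<le> sqrt \<kappa>" unfolding h_def cemetery_ext_def using potential_difference K(4) by (auto split: option.split)
  moreover have "exp (- t) * \<bar>h\<bar> \<le> 1 * \<bar>h\<bar>" using assms by (intro mult_right_mono) auto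
  ultimately have "\<bar>exp (- t) * h\<bar> \<le> sqrt \<kappa>" by (simp add: abs_mult)
  moreover have "N t \<omega> = D t \<omega> + exp (- t) * h" by (simp add: N_def D_def h_def algebra_simps)
  ultimately show ?thesis by linarith
qed

lemma N_facts:
  assumes t: "0 \<le> t"
  shows "N t \<in> borel_measurable (F (ennreal t))" "integrable (C (Some x)) (\<lambda>\<omega>. (N t \<omega>)\<^sup>2)"
    and "W \<in> borel_measurable (F (ennreal t)) \<Longrightarrow> (\<And>\<omega>. 0 \<le> W \<omega>) \<Longrightarrow> integrable (C (Some x)) (\<lambda>\<omega>. (W \<omega>)\<^sup>2) \<Longrightarrow>
      (\<integral>\<omega>. W \<omega> * N t \<omega> \<partial>C (Some x)) = (\<integral>\<omega>. W \<omega> * Y \<omega> \<partial>C (Some x))"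
proof -
  note a = integral_projection[OF PCAF_A Revuz_A measurable_potential(1) K(2) K(1) integrable_G_square(1) t]
  note b = integral_projection[OF PCAF_B Revuz_B measurable_potential(2) K(3) K(1) integrable_G_square(2) t]
  note ma = measurable_augmented_completion[OF a(1)]
  note mb = measurable_augmented_completion[OF b(1)]
  show "N t \<in> borel_measurable (F (ennreal t))"
    unfolding N_def[abs_def] by (intro borel_measurable_diff a(1) b(1))
  show "integrable (C (Some x)) (\<lambda>\<omega>. (N t \<omega>)\<^sup>2)"
    unfolding N_def by (rule integrable_square_add(2)[OF ma mb a(2) b(2)])
  assume W: "W \<in> borel_measurable (F (ennreal t))" "\<And>\<omega>. 0 \<le> W \<omega>" "integrable (C (Some x)) (\<lambda>\<omega>. (W \<omega>)\<^sup>2)"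
  note mW = measurable_augmented_completion[OF W(1)]
  have mG: "(\<lambda>\<omega>. enn2real (GA \<omega>)) \<in> borel_measurable (C (Some x))" "(\<lambda>\<omega>. enn2real (GB \<omega>)) \<in> borel_measurable (C (Some x))"
    using measurable_G by auto
  show "(\<integral>\<omega>. W \<omega> * N t \<omega> \<partial>C (Some x)) = (\<integral>\<omega>. W \<omega> * Y \<omega> \<partial>C (Some x))"
    unfolding N_def Y_def right_diff_distrib[of "W _"]
    by (subst (1 2) Bochner_Integration.integral_diff)
       (use a(3)[OF W] b(3)[OF W] integrable_mult_square[OF mW ma W(3) a(2)] integrable_mult_square[OF mW mb W(3) b(2)]
          integrable_mult_square[OF mW mG(1) W(3) integrable_G_square(1)] integrable_mult_square[OF mW mG(2) W(3) integrable_G_square(2)] in simp_all)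
qed

text \<open>Doob's inequality on the grid of mesh T / 2^j with \<open>Y\<close> as terminal
  variable. The bound does not depend on \<open>j\<close>, which leaves the passage to finer grids
  free of cost.\<close>

lemma grid_bound:
  assumes T: "0 < T"
  defines "s \<equiv> \<lambda>j. running_max (\<lambda>k. N (real k * T / 2 ^ j)) (2 ^ j)"
  shows "integrable (C (Some x)) (\<lambda>\<omega>. (s j \<omega>)\<^sup>2)" "(\<integral>\<omega>. (s j \<omega>)\<^sup>2 \<partial>C (Some x)) \<le> 4 * \<kappa>"
proof -
  have t: "0 \<le> real k * T / 2 ^ j" for k using T by simp
  have "subalgebra (C (Some x)) (F (ennreal (real k * T / 2 ^ j)))" for k
    using augmented_subset_completion by (simp add: subalgebra_def aug.space_F)
  moreover have "sets (F (ennreal (real k * T / 2 ^ j))) \<subseteq> sets (F (ennreal (real l * T / 2 ^ j)))" if "k \<le> l" for k l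
    using that T by (intro aug.sets_F_mono ennreal_leI divide_right_mono mult_right_mono) auto
  ultimately have "integrable (C (Some x)) (\<lambda>\<omega>. (s j \<omega>)\<^sup>2) \<and>
      (\<integral>\<omega>. (s j \<omega>)\<^sup>2 \<partial>C (Some x)) \<le> 4 * (\<integral>\<omega>. (Y \<omega>)\<^sup>2 \<partial>C (Some x))"
    unfolding s_def
    by (intro conjI Doob_L2[where G="\<lambda>k. F (ennreal (real k * T / 2 ^ j))" and Y=Y] N_facts t measurable_Y integrable_Y_square)
  then show "integrable (C (Some x)) (\<lambda>\<omega>. (s j \<omega>)\<^sup>2)" "(\<integral>\<omega>. (s j \<omega>)\<^sup>2 \<partial>C (Some x)) \<le> 4 * \<kappa>"
    using integral_Y_square[of x] by auto
qed

text \<open>The dyadic grids are nested, so their suprema increase and monotone convergence applies;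
  \<open>bound_from_discounted\<close> dominates the supremum over [0, T] path by path. From
  \<bar>D\<bar> <= s + sqrt \<kappa>, with s the running maximum, the mean of the squared supremum
  is at most (2 * 4 + 2) \<kappa>, whence the 10.\<close>

theorem sup_bound:
  assumes T: "0 < T"
  shows "(\<integral>\<^sup>+\<omega>. (SUP t\<in>{0..T}. (absdiff (A t \<omega>) (B t \<omega>))\<^sup>2) \<partial>C (Some x)) \<le> ennreal (10 * ((1 + T) * exp T)\<^sup>2 * \<kappa>)"
proof -
  let ?Q = "C (Some x)"
  interpret prob_space ?Q by (rule prob_space_completion)
  define L where "L = (1 + T) * exp T"
  have L: "0 < L" using T by (simp add: L_def)
  define \<Psi> where "\<Psi> j \<omega> = (SUP k\<in>{..<2 ^ j}. ennreal ((D (real k * T / 2 ^ j) \<omega>)\<^sup>2))" for j :: nat and \<omega>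
  have mD: "D t \<in> borel_measurable ?Q" if "0 \<le> t" for t
  proof -
    have "(\<lambda>\<omega>. discounted (\<lambda>t. A t \<omega>) (ennreal t)) \<in> borel_measurable ?Q" "(\<lambda>\<omega>. discounted (\<lambda>t. B t \<omega>) (ennreal t)) \<in> borel_measurable ?Q"
      using projection_at_const_time(2)[OF PCAF_A Revuz_A measurable_potential(1) finite_\<mu> that, of "\<lambda>_. 0"]
        projection_at_const_time(2)[OF PCAF_B Revuz_B measurable_potential(2) finite_\<nu> that, of "\<lambda>_. 0"]
      by (auto intro: measurable_augmented_completion)
    then show ?thesis unfolding D_def[abs_def] by measurable
  qed
  have m\<Psi>: "\<Psi> j \<in> borel_measurable ?Q" for j
    unfolding \<Psi>_def[abs_def] using mD T by (intro borel_measurable_SUP) auto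
  have inc: "incseq \<Psi>"
  proof (rule incseq_SucI, rule le_funI)
    fix j \<omega>
    show "\<Psi> j \<omega> \<le> \<Psi> (Suc j) \<omega>"
      unfolding \<Psi>_def
    proof (rule SUP_mono)
      fix k :: nat assume "k \<in> {..<2 ^ j}"
      then have "2 * k \<in> {..<2 ^ Suc j}" "real (2 * k) * T / 2 ^ Suc j = real k * T / 2 ^ j" by auto
      then show "\<exists>k'\<in>{..<2 ^ Suc j}. ennreal ((D (real k * T / 2 ^ j) \<omega>)\<^sup>2) \<le> ennreal ((D (real k' * T / 2 ^ Suc j) \<omega>)\<^sup>2)"
        by (metis order_refl)
    qed
  qed
  have \<Psi>_bound: "(\<integral>\<^sup>+\<omega>. \<Psi> j \<omega> \<partial>?Q) \<le> ennreal (10 * \<kappa>)" for j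
  proof -
    define s where "s = running_max (\<lambda>k. N (real k * T / 2 ^ j)) (2 ^ j)"
    have s: "integrable ?Q (\<lambda>\<omega>. (s \<omega>)\<^sup>2)" "(\<integral>\<omega>. (s \<omega>)\<^sup>2 \<partial>?Q) \<le> 4 * \<kappa>"
      using grid_bound[OF T, of x j] by (simp_all add: s_def)
    have "\<Psi> j \<omega> \<le> ennreal (2 * (s \<omega>)\<^sup>2 + 2 * \<kappa>)" for \<omega>
      unfolding \<Psi>_def
    proof (rule SUP_least, rule ennreal_leI)
      fix k :: nat assume "k \<in> {..<2 ^ j}"
      then have "\<bar>N (real k * T / 2 ^ j) \<omega>\<bar> \<le> s \<omega>" unfolding s_def using le_running_max[of k "2 ^ j" "\<lambda>k. N (real k * T / 2 ^ j)" \<omega>] by simp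
      then have "\<bar>D (real k * T / 2 ^ j) \<omega>\<bar> \<le> s \<omega> + sqrt \<kappa>" using D_le_N[of "real k * T / 2 ^ j" \<omega>] T by simp
      then have "(D (real k * T / 2 ^ j) \<omega>)\<^sup>2 \<le> (s \<omega> + sqrt \<kappa>)\<^sup>2" by (metis abs_ge_zero power2_abs power_mono)
      also have "\<dots> \<le> 2 * (s \<omega>)\<^sup>2 + 2 * (sqrt \<kappa>)\<^sup>2"
        using zero_le_power2[of "s \<omega> - sqrt \<kappa>"] unfolding power2_sum power2_diff by linarith
      finally show "(D (real k * T / 2 ^ j) \<omega>)\<^sup>2 \<le> 2 * (s \<omega>)\<^sup>2 + 2 * \<kappa>" using K(4) by simp
    qed
    then have "(\<integral>\<^sup>+\<omega>. \<Psi> j \<omega> \<partial>?Q) \<le> (\<integral>\<^sup>+\<omega>. ennreal (2 * (s \<omega>)\<^sup>2 + 2 * \<kappa>) \<partial>?Q)" by (intro nn_integral_mono)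
    also have "\<dots> = ennreal (\<integral>\<omega>. 2 * (s \<omega>)\<^sup>2 + 2 * \<kappa> \<partial>?Q)"
      using s(1) K(4) by (intro nn_integral_eq_integral) auto
    also have "(\<integral>\<omega>. 2 * (s \<omega>)\<^sup>2 + 2 * \<kappa> \<partial>?Q) = 2 * (\<integral>\<omega>. (s \<omega>)\<^sup>2 \<partial>?Q) + 2 * \<kappa>" using s(1) by (simp add: prob_space[simplified])
    also have "ennreal \<dots> \<le> ennreal (10 * \<kappa>)" using s(2) by (intro ennreal_leI) simp
    finally show ?thesis .
  qed
  have path: "AE \<omega> in ?Q. (SUP t\<in>{0..T}. (absdiff (A t \<omega>) (B t \<omega>))\<^sup>2) \<le> ennreal (L\<^sup>2) * (SUP j. \<Psi> j \<omega>)"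
    using PCAF_regular[OF PCAF_A, of x] PCAF_regular[OF PCAF_B, of x] finite_G[of x]
  proof eventually_elim
    case (elim \<omega>)
    interpret A: clock "\<lambda>t. A t \<omega>" using elim(1) by (rule regularD)
    interpret B: clock "\<lambda>t. B t \<omega>" using elim(2) by (rule regularD)
    have fA: "A t \<omega> < \<infinity>" if "0 \<le> t" for t
      using elim(3) that unfolding discounted_total_def by (intro A.finite_if_discounted_finite)
    have fB: "B t \<omega> < \<infinity>" if "0 \<le> t" for t
      using elim(4) that unfolding discounted_total_def by (intro B.finite_if_discounted_finite)
    define \<delta> where "\<delta> t = enn2real (A t \<omega>) - enn2real (B t \<omega>)" for t
    have dA: "enn2real (discounted (\<lambda>t. A t \<omega>) (ennreal t)) =
        exp (- t) * enn2real (A t \<omega>) + integral {0..t} (\<lambda>q. exp (- q) * enn2real (A q \<omega>))" if "0 \<le> t" for t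
      by (rule A.enn2real_discounted(1)) (use fA that in auto)
    have dB: "enn2real (discounted (\<lambda>t. B t \<omega>) (ennreal t)) =
        exp (- t) * enn2real (B t \<omega>) + integral {0..t} (\<lambda>q. exp (- q) * enn2real (B q \<omega>))" if "0 \<le> t" for t
      by (rule B.enn2real_discounted(1)) (use fB that in auto)
    have "continuous_on {0..} (\<lambda>t. enn2real (A t \<omega>))" by (rule A.enn2real_discounted(2)[of 0]) (use fA in auto)
    moreover have "continuous_on {0..} (\<lambda>t. enn2real (B t \<omega>))" by (rule B.enn2real_discounted(2)[of 0]) (use fB in auto)
    ultimately
    have cA: "continuous_on {0..t} (\<lambda>t. enn2real (A t \<omega>))" and cB: "continuous_on {0..t} (\<lambda>t. enn2real (B t \<omega>))" for t
      by (auto intro: continuous_on_subset)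
    have Deq: "D t \<omega> = exp (- t) * \<delta> t + integral {0..t} (\<lambda>q. exp (- q) * \<delta> q)" if "0 \<le> t" for t
    proof -
      have "integral {0..t} (\<lambda>q. exp (- q) * enn2real (A q \<omega>) - exp (- q) * enn2real (B q \<omega>)) =
          integral {0..t} (\<lambda>q. exp (- q) * enn2real (A q \<omega>)) - integral {0..t} (\<lambda>q. exp (- q) * enn2real (B q \<omega>))"
        by (intro Henstock_Kurzweil_Integration.integral_diff integrable_continuous_real continuous_intros cA cB)
      then show ?thesis unfolding D_def dA[OF that] dB[OF that] \<delta>_def by (simp add: algebra_simps)
    qed
    show ?case
    proof (cases "SUP j. \<Psi> j \<omega>")
      case top
      show ?thesis unfolding top using L by (simp add: ennreal_mult_top)
    next
      case (real b)
      have grid: "\<bar>D (real k * T / 2 ^ n) \<omega>\<bar> \<le> sqrt b" if "k < 2 ^ n" for n k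
      proof -
        have "ennreal ((D (real k * T / 2 ^ n) \<omega>)\<^sup>2) \<le> \<Psi> n \<omega>" unfolding \<Psi>_def using that by (intro SUP_upper) auto
        also have "\<dots> \<le> ennreal b" unfolding real(2)[symmetric] by (intro SUP_upper) auto
        finally have "(D (real k * T / 2 ^ n) \<omega>)\<^sup>2 \<le> b" using real(1) by (simp add: ennreal_le_iff)
        then show ?thesis by (metis real_sqrt_abs real_sqrt_le_mono)
      qed
      show ?thesis
      proof (rule SUP_least)
        fix t assume t: "t \<in> {0..T}"
        have "\<bar>\<delta> t\<bar> \<le> L * sqrt b"
          unfolding L_def
        proof (rule bound_from_discounted[where D="\<lambda>t. D t \<omega>" and \<delta>=\<delta> and T=T])
          show "continuous_on {0..T} \<delta>" unfolding \<delta>_def by (intro continuous_intros cA cB)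
          show "\<bar>D (real k * T / 2 ^ n) \<omega>\<bar> \<le> sqrt b" if "k < 2 ^ n" for n k by (rule grid[OF that])
        qed (use T t Deq in auto)
        then have "(\<delta> t)\<^sup>2 \<le> (L * sqrt b)\<^sup>2" by (metis abs_ge_zero power2_abs power_mono)
        then have "(\<delta> t)\<^sup>2 \<le> L\<^sup>2 * b" using real(1) by (simp add: power_mult_distrib)
        moreover have "absdiff (A t \<omega>) (B t \<omega>) = ennreal \<bar>\<delta> t\<bar>"
          unfolding \<delta>_def using t by (intro absdiff_enn2real fA fB) auto
        ultimately show "(absdiff (A t \<omega>) (B t \<omega>))\<^sup>2 \<le> ennreal (L\<^sup>2) * (SUP j. \<Psi> j \<omega>)"
          unfolding real(2) using real(1) by (simp add: ennreal_power ennreal_leI flip: ennreal_mult)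
      qed
    qed
  qed
  have "(\<integral>\<^sup>+\<omega>. (SUP t\<in>{0..T}. (absdiff (A t \<omega>) (B t \<omega>))\<^sup>2) \<partial>?Q) \<le> (\<integral>\<^sup>+\<omega>. ennreal (L\<^sup>2) * (SUP j. \<Psi> j \<omega>) \<partial>?Q)"
    by (rule nn_integral_mono_AE[OF path])
  also have "\<dots> = ennreal (L\<^sup>2) * (\<integral>\<^sup>+\<omega>. (SUP j. \<Psi> j \<omega>) \<partial>?Q)"
    using m\<Psi> by (intro nn_integral_cmult) auto
  also have "(\<integral>\<^sup>+\<omega>. (SUP j. \<Psi> j \<omega>) \<partial>?Q) = (SUP j. \<integral>\<^sup>+\<omega>. \<Psi> j \<omega> \<partial>?Q)"
    by (rule nn_integral_monotone_convergence_SUP[OF inc m\<Psi>])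
  also have "ennreal (L\<^sup>2) * \<dots> \<le> ennreal (L\<^sup>2) * ennreal (10 * \<kappa>)"
    by (intro mult_left_mono SUP_least \<Psi>_bound) auto
  also have "\<dots> = ennreal (10 * ((1 + T) * exp T)\<^sup>2 * \<kappa>)"
    using K(4) by (simp add: L_def ac_simps flip: ennreal_mult)
  finally show ?thesis .
qed

end

section \<open>The convergence theorem\<close>

lemma emeasure_add_measure:
  assumes "sets \<mu> = sets \<nu>" "E \<in> sets \<mu>"
  shows "emeasure (add_measure \<mu> \<nu>) E = emeasure \<mu> E + emeasure \<nu> E"
proof (rule emeasure_measure_of[OF add_measure_def])
  have ss: "sets (add_measure \<mu> \<nu>) = sets \<mu>" by (simp add: add_measure_def)
  show "countably_additive (sets (add_measure \<mu> \<nu>)) (\<lambda>B. emeasure \<mu> B + emeasure \<nu> B)"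
  proof (rule countably_additiveI)
    fix A :: "nat \<Rightarrow> 'a set" assume "range A \<subseteq> sets (add_measure \<mu> \<nu>)" "disjoint_family A"
    then have A: "range A \<subseteq> sets \<mu>" "range A \<subseteq> sets \<nu>" "disjoint_family A"
      using assms(1) ss by simp_all
    show "(\<Sum>i. emeasure \<mu> (A i) + emeasure \<nu> (A i)) = emeasure \<mu> (\<Union>i. A i) + emeasure \<nu> (\<Union>i. A i)"
      using A by (simp add: suminf_add[symmetric] suminf_emeasure)
  qed
  show "E \<in> sets (add_measure \<mu> \<nu>)" using assms(2) ss by simp
qed (use sets.space_closed in \<open>auto simp: positive_def\<close>)

lemma AE_add_measureD:
  assumes s: "sets \<mu> = sets \<nu>" and ae: "AE x in add_measure \<mu> \<nu>. Q x"
  shows "AE x in \<mu>. Q x" "AE x in \<nu>. Q x"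
proof -
  have ss: "sets (add_measure \<mu> \<nu>) = sets \<mu>" "space (add_measure \<mu> \<nu>) = space \<mu>" by (simp_all add: add_measure_def)
  obtain N where N: "{x \<in> space \<mu>. \<not> Q x} \<subseteq> N" "N \<in> sets \<mu>" "emeasure (add_measure \<mu> \<nu>) N = 0"
    using AE_E[OF ae] ss by metis
  then have "N \<in> null_sets \<mu>" "N \<in> null_sets \<nu>" using emeasure_add_measure[OF s N(2)] s by auto
  then show "AE x in \<mu>. Q x" "AE x in \<nu>. Q x"
    using N(1) sets_eq_imp_space_eq[OF s] by (auto intro: AE_I')
qed

lemma le_add_of_absdiff_le:
  assumes "absdiff a b \<le> ennreal C" "a < \<infinity>" "b < \<infinity>" "0 \<le> C"
  shows "a \<le> b + ennreal C" "b \<le> a + ennreal C"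
  using assms
  by (cases a; cases b; auto simp: absdiff_ennreal ennreal_le_iff abs_le_iff simp flip: ennreal_plus intro!: ennreal_leI)+

context standard_processes_in_duality
begin

text \<open>The time integral is moved to the restricted space of positive times, where the joint
  measurability of \<open>p\<close> is given.\<close>

lemma measurable_resolvent_density:
  "(\<lambda>(x, y). resolvent_density p \<alpha> x y) \<in> borel_measurable (borel \<Otimes>\<^sub>M borel)"
proof -
  let ?R = "restrict_space lborel {0<..} :: real measure"
  interpret R: sigma_finite_measure ?R
    by (rule sigma_finite_measure_restrict_space) (auto intro: lborel.sigma_finite_measure_axioms)
  have sR: "sets ?R = sets (restrict_space borel {0<..})" by (rule sets_restrict_space_cong) simp
  have p: "(\<lambda>(t, x, y). p t x y) \<in> borel_measurable (?R \<Otimes>\<^sub>M borel \<Otimes>\<^sub>M borel)"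
    using measurable_p by (simp add: measurable_cong_sets[OF sets_pair_measure_cong[OF sR refl] refl])
  have "(\<lambda>z. (snd z, fst z)) \<in> (borel \<Otimes>\<^sub>M borel) \<Otimes>\<^sub>M ?R \<rightarrow>\<^sub>M ?R \<Otimes>\<^sub>M borel \<Otimes>\<^sub>M borel" by measurable
  from measurable_compose[OF this p]
  have 1: "(\<lambda>z. p (snd z) (fst (fst z)) (snd (fst z))) \<in> borel_measurable ((borel \<Otimes>\<^sub>M borel) \<Otimes>\<^sub>M ?R)"
    by (simp add: split_beta)
  have "(\<lambda>t. ennreal (exp (- \<alpha> * t))) \<in> borel_measurable ?R"
    by (intro measurable_restrict_space1) measurable
  from borel_measurable_times_ennreal[OF measurable_compose[OF measurable_snd this] 1]
  have "(\<lambda>(z, t). ennreal (exp (- \<alpha> * t)) * p t (fst z) (snd z)) \<in> borel_measurable ((borel \<Otimes>\<^sub>M borel) \<Otimes>\<^sub>M ?R)"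
    unfolding split_beta .
  from R.borel_measurable_nn_integral[OF this] show ?thesis
    by (simp add: resolvent_density_def nn_integral_restrict_space split_beta)
qed

lemma measurable_potential:
  assumes "finite_measure \<mu>" "sets \<mu> = sets borel"
  shows "potential p \<alpha> \<mu> \<in> borel_measurable borel"
proof -
  interpret finite_measure \<mu> by fact
  have "(\<lambda>(x, y). resolvent_density p \<alpha> x y) \<in> borel_measurable (borel \<Otimes>\<^sub>M \<mu>)"
    using measurable_resolvent_density by (simp add: measurable_cong_sets[OF sets_pair_measure_cong[OF refl assms(2)] refl])
  from borel_measurable_nn_integral[OF this] show ?thesis by (simp add: potential_def[abs_def])
qed

lemma measurable_resolvent_density': "resolvent_density p \<alpha> x \<in> borel_measurable borel"
  using measurable_compose[OF measurable_Pair1'[of x borel borel] measurable_resolvent_density] by simp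

end

lemma tendsto_zero_ennrealI:
  fixes f :: "nat \<Rightarrow> ennreal"
  assumes "\<And>e. 0 < e \<Longrightarrow> eventually (\<lambda>n. f n \<le> ennreal e) sequentially"
  shows "f \<longlonglongrightarrow> 0"
proof (rule order_tendstoI)
  fix a :: ennreal assume "0 < a"
  then obtain w where w: "0 < w" "w < a" using dense by blast
  then have "w < top" using less_trans top.not_eq_extremum by fastforce
  then have e: "w = ennreal (enn2real w)" "0 < enn2real w" using w(1) by (auto simp: enn2real_positive_iff)
  show "eventually (\<lambda>n. f n < a) sequentially"
    using assms[OF e(2)] by eventually_elim (use e(1) w(2) in auto)
qed simp

theorem theorem1p3:
  fixes M :: "'w measure"
    and X :: "ennreal \<Rightarrow> 'w \<Rightarrow> 's::{metric_space, second_countable_topology} option"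
    and P :: "'s option \<Rightarrow> 'w measure"
    and \<theta> :: "ennreal \<Rightarrow> 'w \<Rightarrow> 'w"
    and M' :: "'v measure"
    and X' :: "ennreal \<Rightarrow> 'v \<Rightarrow> 's option"
    and P' :: "'s option \<Rightarrow> 'v measure"
    and \<theta>' :: "ennreal \<Rightarrow> 'v \<Rightarrow> 'v"
    and m :: "'s measure"
    and p :: "real \<Rightarrow> 's \<Rightarrow> 's \<Rightarrow> ennreal"
    and \<mu> :: "'s measure" and \<mu>\<^sub>n :: "nat \<Rightarrow> 's measure"
    and A :: "real \<Rightarrow> 'w \<Rightarrow> ennreal" and A\<^sub>n :: "nat \<Rightarrow> real \<Rightarrow> 'w \<Rightarrow> ennreal"
    and T :: real
  assumes "locally_compact_space (euclidean :: 's topology)"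
    and "standard_processes_in_duality M X P \<theta> M' X' P' \<theta>' m p"
    and "\<mu> \<in> S00 M X P p"
    and "\<And>n. \<mu>\<^sub>n n \<in> S00 M X P p"
    and "(\<lambda>n. Linfty_norm (add_measure (\<mu>\<^sub>n n) \<mu>)
           (\<lambda>x. absdiff (potential p 1 (\<mu>\<^sub>n n) x) (potential p 1 \<mu> x))) \<longlonglongrightarrow> 0"
    and "PCAF M X P \<theta> A" and "Revuz_corresponds X P p A \<mu>"
    and "\<And>n. PCAF M X P \<theta> (A\<^sub>n n)" and "\<And>n. Revuz_corresponds X P p (A\<^sub>n n) (\<mu>\<^sub>n n)"
    and "T > 0"
  shows "(\<lambda>n. SUP x::'s. \<integral>\<^sup>+\<omega>. (SUP t\<in>{0..T}. (absdiff (A\<^sub>n n t \<omega>) (A t \<omega>))\<^sup>2)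
           \<partial>completion (P (Some x))) \<longlonglongrightarrow> 0"
proof (rule tendsto_zero_ennrealI)
  fix e :: real assume e: "0 < e"
  interpret standard_processes_in_duality M X P \<theta> M' X' P' \<theta>' m p by fact
  have \<mu>: "sets \<mu> = sets borel" "finite_measure \<mu>" "(SUP x. potential p 1 \<mu> x) < \<infinity>"
    using assms(3) by (auto simp: S00_def)
  have \<mu>n: "sets (\<mu>\<^sub>n n) = sets borel" "finite_measure (\<mu>\<^sub>n n)" "(SUP x. potential p 1 (\<mu>\<^sub>n n) x) < \<infinity>" for n
    using assms(4)[of n] by (auto simp: S00_def)
  have fin: "potential p 1 \<mu> x < \<infinity>" "potential p 1 (\<mu>\<^sub>n n) x < \<infinity>" for n x
    by (rule le_less_trans[OF SUP_upper \<mu>(3)], simp) (rule le_less_trans[OF SUP_upper \<mu>n(3)], simp)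
  define V where "V = enn2real (SUP x. potential p 1 \<mu> x)"
  have V: "0 \<le> V" "potential p 1 \<mu> x \<le> ennreal V" for x
    using \<mu>(3) by (auto simp: V_def intro: SUP_upper)
  define L where "L = ((1 + T) * exp T)\<^sup>2"
  have L: "0 < L" using assms(10) by (simp add: L_def)
  \<comment> \<open>With \<epsilon> <= 1 one has \<kappa> = 8 \<epsilon> (V + \<epsilon>) <= 8
    \<epsilon> (V + 1), so the bound 10 L \<kappa> of \<open>sup_bound\<close> is at most 80 L (V +
    1) \<epsilon> <= e.\<close>
  define \<epsilon> where "\<epsilon> = min 1 (e / (80 * L * (V + 1)))"
  have \<epsilon>: "0 < \<epsilon>" "\<epsilon> \<le> 1" "\<epsilon> \<le> e / (80 * L * (V + 1))" using e L V(1) by (auto simp: \<epsilon>_def)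
  have ev: "eventually (\<lambda>n. Linfty_norm (add_measure (\<mu>\<^sub>n n) \<mu>)
           (\<lambda>x. absdiff (potential p 1 (\<mu>\<^sub>n n) x) (potential p 1 \<mu> x)) < ennreal \<epsilon>) sequentially"
    using order_tendstoD(2)[OF assms(5)] \<epsilon>(1) by simp
  show "eventually (\<lambda>n. (SUP x::'s. \<integral>\<^sup>+\<omega>. (SUP t\<in>{0..T}. (absdiff (A\<^sub>n n t \<omega>) (A t \<omega>))\<^sup>2)
           \<partial>completion (P (Some x))) \<le> ennreal e) sequentially"
    using ev
  proof eventually_elim
    case (elim n)
    \<comment> \<open>The norm is an infimum of admissible constants, so a value below \<epsilon>
      provides an actual almost everywhere bound \<open>C\<close>.\<close>
    then obtain C where C: "0 < C" "C < \<epsilon>"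
      "AE x in add_measure (\<mu>\<^sub>n n) \<mu>. absdiff (potential p 1 (\<mu>\<^sub>n n) x) (potential p 1 \<mu> x) \<le> ennreal C"
      unfolding Linfty_norm_def Inf_less_iff by (auto simp: ennreal_less_iff)
    have le: "absdiff (potential p 1 (\<mu>\<^sub>n n) x) (potential p 1 \<mu> x) \<le> ennreal C \<Longrightarrow>
        potential p 1 (\<mu>\<^sub>n n) x \<le> potential p 1 \<mu> x + ennreal \<epsilon> \<and> potential p 1 \<mu> x \<le> potential p 1 (\<mu>\<^sub>n n) x + ennreal \<epsilon>" for x
      using C \<epsilon>(1) fin by (intro conjI le_add_of_absdiff_le) (auto elim!: order_trans intro!: ennreal_leI)
    have s: "sets (\<mu>\<^sub>n n) = sets \<mu>" using \<mu>(1) \<mu>n(1) by simp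
    \<comment> \<open>The sequence takes the first place and the limit the second, so that
      \<open>V\<close> and \<epsilon>, and with them \<open>\<kappa>\<close>, do not depend on
      n.\<close>
    interpret functional_pair M X P \<theta> p "A\<^sub>n n" A "\<mu>\<^sub>n n" \<mu> \<epsilon> V
    proof
      show "AE y in \<mu>\<^sub>n n. potential p 1 (\<mu>\<^sub>n n) y \<le> potential p 1 \<mu> y + ennreal \<epsilon>"
        using AE_add_measureD(1)[OF s C(3)] by eventually_elim (use le in blast)
      show "AE y in \<mu>. potential p 1 \<mu> y \<le> potential p 1 (\<mu>\<^sub>n n) y + ennreal \<epsilon>"
        using AE_add_measureD(2)[OF s C(3)] by eventually_elim (use le in blast)
    qed (use assms \<mu> \<mu>n V fin \<epsilon> measurable_potential measurable_resolvent_density' in auto)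
    have "\<kappa> = \<epsilon> * (8 * (V + \<epsilon>))" by (simp add: \<kappa>_def K_def)
    also have "\<dots> \<le> e / (80 * L * (V + 1)) * (8 * (V + 1))" using \<epsilon> V(1) by (intro mult_mono) auto
    also have "\<dots> = e / (10 * L)"
    proof -
      have "e / (80 * L * w) * (8 * w) = e / (10 * L)" if "0 < w" for w using that L by (simp add: field_simps)
      from this[of "V + 1"] V(1) show ?thesis by linarith
    qed
    finally have "10 * L * \<kappa> \<le> e" using L by (simp add: field_simps)
    then show ?case using sup_bound[OF assms(10)] unfolding L_def
      by (intro SUP_least) (blast intro: order_trans ennreal_leI)
  qed
qed

end
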